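(* Let $W:\mathbb{C}^2\to\mathbb{R}$ be an admissible potential with wells $\mathbf a=(a,0)$, $\mathbf b=(0,b)$, and let $m=\inf_{\Psi\in Y}E(\Psi)$. Then there exists $\Psi=(\psi_1,\psi_2)\in Y$ with $E(\Psi)=m$. Moreover, every minimizer $\Psi=(\psi_1,\psi_2)$ of $E$ in $Y$ has the form $\psi_1=e^{i\beta_1}u_1$, $\psi_2=e^{i\beta_2}u_2$ for some nonnegative real-valued $U=(u_1,u_2)\in X$ and real constants $\beta_1,\beta_2$. Furthermore, for any sequence $(\Psi_n)\subset Y$ with $E(\Psi_n)\to m$, there exist a minimizer $\Psi\in Y$ of $E$ in $Y$, a sequence $\tau_n\in\mathbb{R}$, and a subsequence $(n_k)$ such that for every constant $A>0$, $$\rho_A\bigl(\Psi_{n_k}(\cdot+\tau_{n_k}),\Psi(\cdot)\bigr)\to 0\quad\text{as }k\to\infty .$$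
   Context: $\mathbb{R}^2_+=\{(x,y)\in\mathbb{R}^2: x,y\ge 0\}$. A function $W:\mathbb{C}^2\to\mathbb{R}$ is called an admissible potential if: (1) $W(\Psi)=W(|\psi_1|,|\psi_2|)=F(|\psi_1|^2,|\psi_2|^2)$ for all $\Psi=(\psi_1,\psi_2)\in\mathbb{C}^2$, with some $F\in C^3(\mathbb{R}^2;\mathbb{R})$; (2) $W\ge 0$ on $\mathbb{C}^2$, and there are $a,b>0$ such that $W(\Psi)=0$ if and only if $(|\psi_1|,|\psi_2|)=\mathbf a:=(a,0)$ or $(|\psi_1|,|\psi_2|)=\mathbf b:=(0,b)$; (3) $\mathbf a,\mathbf b$ are non-degenerate global minima of $W$ restricted to $\mathbb{R}^2$; (4) there are $R_0,c_0>0$ with $\nabla W(U)\cdot U\ge c_0|U|^2$ for all $U\in\mathbb{R}^2_+$ with $|U|\ge R_0$. Energy: $E(\Psi)=\frac12\int_{-\infty}^{\infty}\bigl(|\psi_1'|^2+|\psi_2'|^2+W(\psi_1,\psi_2)\bigr)\,dx\in[0,\infty]$. $X$ is the set of $U=(u_1,u_2)\in H^1_{loc}(\mathbb{R};\mathbb{R}^2)$ with $U(x)\to\mathbf a$ as $x\to+\infty$ and $U(x)\to\mathbf b$ as $x\to-\infty$. $Y$ is the set of $\Psi=(\psi_1,\psi_2)\in H^1_{loc}(\mathbb{R};\mathbb{C}^2)$ with $(|\psi_1(x)|,|\psi_2(x)|)\to\mathbf a$ as $x\to+\infty$ and $\to\mathbf b$ as $x\to-\infty$. For $A>0$: $\rho_A(\Psi,\Phi)=\sum_{j=1,2}\bigl[\|\psi_j'-\varphi_j'\|_{L^2(\mathbb{R})}+\||\psi_j|-|\varphi_j|\|_{L^2(\mathbb{R})}+\|\psi_j-\varphi_j\|_{L^\infty(-A,A)}\bigr]$.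 *)

theory Defs
  imports "HOL-Probability.Essential_Supremum"
begin

text \<open>\<open>f\<close> is of class C^k on the whole space: it is differentiable up to order \<open>k\<close> along
  arbitrary directions, with continuous derivatives.\<close>

primrec Ck :: "nat \<Rightarrow> ('a::real_normed_vector \<Rightarrow> 'b::real_normed_vector) \<Rightarrow> bool" where
  "Ck 0 f \<longleftrightarrow> continuous_on UNIV f"
| "Ck (Suc k) f \<longleftrightarrow> (\<forall>x. f differentiable (at x)) \<and>
     (\<forall>v. Ck k (\<lambda>x. frechet_derivative f (at x) v))"

definition test_function :: "(real \<Rightarrow> real) \<Rightarrow> bool" where
  "test_function \<phi> \<longleftrightarrow> (\<forall>k. Ck k \<phi>) \<and> compact (closure {x. \<phi> x \<noteq> 0})"

definition has_weak_derivative :: "(real \<Rightarrow> 'a::euclidean_space) \<Rightarrow> (real \<Rightarrow> 'a) \<Rightarrow> bool" where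
  "has_weak_derivative f g \<longleftrightarrow>
     (\<forall>s t. set_integrable lborel {s..t} f) \<and> (\<forall>s t. set_integrable lborel {s..t} g) \<and>
     (\<forall>\<phi>. test_function \<phi> \<longrightarrow>
       (\<integral>x. deriv \<phi> x *\<^sub>R f x \<partial>lborel) = - (\<integral>x. \<phi> x *\<^sub>R g x \<partial>lborel))"

text \<open>Weak derivatives are determined only almost everywhere. An arbitrary one is chosen, and
  it is only ever used under an integral.\<close>

definition weak_derivative :: "(real \<Rightarrow> 'a::euclidean_space) \<Rightarrow> real \<Rightarrow> 'a" where
  "weak_derivative f = (SOME g. has_weak_derivative f g)"

definition L2_loc :: "(real \<Rightarrow> 'a::euclidean_space) set" where
  "L2_loc = {f \<in> borel_measurable lborel.
     \<forall>s t. set_integrable lborel {s..t} (\<lambda>x. (norm (f x))\<^sup>2)}"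

text \<open>As usual in dimension one, an element of H^1_loc is identified with its continuous
  representative, so that pointwise values and limits at infinity make sense.\<close>

definition H1_loc :: "(real \<Rightarrow> 'a::euclidean_space) set" where
  "H1_loc = {f. continuous_on UNIV f \<and> f \<in> L2_loc \<and> (\<exists>g\<in>L2_loc. has_weak_derivative f g)}"

definition restrict_R2 :: "(complex \<times> complex \<Rightarrow> real) \<Rightarrow> real \<times> real \<Rightarrow> real" where
  "restrict_R2 W U = W (complex_of_real (fst U), complex_of_real (snd U))"

definition gradient :: "('a::real_inner \<Rightarrow> real) \<Rightarrow> 'a \<Rightarrow> 'a" where
  "gradient w p = (THE D. GDERIV w p :> D)"

definition hessian :: "('a::real_normed_vector \<Rightarrow> real) \<Rightarrow> 'a \<Rightarrow> 'a \<Rightarrow> 'a \<Rightarrow> real" where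
  "hessian w p u v = frechet_derivative (\<lambda>q. frechet_derivative w (at q) u) (at p) v"

definition nondegenerate_global_min :: "('a::real_normed_vector \<Rightarrow> real) \<Rightarrow> 'a \<Rightarrow> bool" where
  "nondegenerate_global_min w p \<longleftrightarrow>
     (\<forall>q. w p \<le> w q) \<and> (\<forall>u. (\<forall>v. hessian w p u v = 0) \<longrightarrow> u = 0)"

definition admissible_potential :: "(complex \<times> complex \<Rightarrow> real) \<Rightarrow> real \<Rightarrow> real \<Rightarrow> bool" where
  "admissible_potential W a b \<longleftrightarrow>
     (\<exists>F :: real \<times> real \<Rightarrow> real. Ck 3 F \<and>
        (\<forall>z1 z2. W (z1, z2) = restrict_R2 W (cmod z1, cmod z2) \<and>
                 W (z1, z2) = F ((cmod z1)\<^sup>2, (cmod z2)\<^sup>2))) \<and>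
     (\<forall>z. W z \<ge> 0) \<and> a > 0 \<and> b > 0 \<and>
     (\<forall>z1 z2. W (z1, z2) = 0 \<longleftrightarrow>
        (cmod z1, cmod z2) = (a, 0) \<or> (cmod z1, cmod z2) = (0, b)) \<and>
     nondegenerate_global_min (restrict_R2 W) (a, 0) \<and>
     nondegenerate_global_min (restrict_R2 W) (0, b) \<and>
     (\<exists>R0 c0. R0 > 0 \<and> c0 > 0 \<and>
        (\<forall>U. fst U \<ge> 0 \<and> snd U \<ge> 0 \<and> norm U \<ge> R0 \<longrightarrow>
             gradient (restrict_R2 W) U \<bullet> U \<ge> c0 * (norm U)\<^sup>2))"

definition energy ::
  "(complex \<times> complex \<Rightarrow> real) \<Rightarrow> (real \<Rightarrow> complex \<times> complex) \<Rightarrow> ennreal" where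
  "energy W \<Psi> = (1 / 2) * (\<integral>\<^sup>+x. ennreal
      ((cmod (weak_derivative (\<lambda>y. fst (\<Psi> y)) x))\<^sup>2 +
       (cmod (weak_derivative (\<lambda>y. snd (\<Psi> y)) x))\<^sup>2 + W (\<Psi> x)) \<partial>lborel)"

definition space_X :: "real \<Rightarrow> real \<Rightarrow> (real \<Rightarrow> real \<times> real) set" where
  "space_X a b = {U \<in> H1_loc. (U \<longlongrightarrow> (a, 0)) at_top \<and> (U \<longlongrightarrow> (0, b)) at_bot}"

definition space_Y :: "real \<Rightarrow> real \<Rightarrow> (real \<Rightarrow> complex \<times> complex) set" where
  "space_Y a b = {\<Psi> \<in> H1_loc.
     ((\<lambda>x. (cmod (fst (\<Psi> x)), cmod (snd (\<Psi> x)))) \<longlongrightarrow> (a, 0)) at_top \<and>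
     ((\<lambda>x. (cmod (fst (\<Psi> x)), cmod (snd (\<Psi> x)))) \<longlongrightarrow> (0, b)) at_bot}"

definition L2_norm :: "(real \<Rightarrow> 'a::euclidean_space) \<Rightarrow> ennreal" where
  "L2_norm f = (let I = (\<integral>\<^sup>+x. ennreal ((norm (f x))\<^sup>2) \<partial>lborel)
     in if I = \<infinity> then \<infinity> else ennreal (sqrt (enn2real I)))"

definition Linf_norm_on :: "real set \<Rightarrow> (real \<Rightarrow> 'a::euclidean_space) \<Rightarrow> ennreal" where
  "Linf_norm_on S f = esssup (restrict_space lborel S) (\<lambda>x. ennreal (norm (f x)))"

definition rho_comp :: "real \<Rightarrow> (real \<Rightarrow> complex) \<Rightarrow> (real \<Rightarrow> complex) \<Rightarrow> ennreal" where
  "rho_comp A \<psi> \<phi> =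
     L2_norm (\<lambda>x. weak_derivative \<psi> x - weak_derivative \<phi> x) +
     L2_norm (\<lambda>x. cmod (\<psi> x) - cmod (\<phi> x)) +
     Linf_norm_on {-A<..<A} (\<lambda>x. \<psi> x - \<phi> x)"

definition rho ::
  "real \<Rightarrow> (real \<Rightarrow> complex \<times> complex) \<Rightarrow> (real \<Rightarrow> complex \<times> complex) \<Rightarrow> ennreal" where
  "rho A \<Psi> \<Phi> = rho_comp A (\<lambda>x. fst (\<Psi> x)) (\<lambda>x. fst (\<Phi> x)) +
                rho_comp A (\<lambda>x. snd (\<Psi> x)) (\<lambda>x. snd (\<Phi> x))"

end

theory Submission
  imports Defs "HOL-Probability.Distributions" "HOL-Complex_Analysis.Great_Picard"
begin

text \<open>By the direct method, a minimizing sequence is translated so that the last time at which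
  \<open>|\<psi>\<^sub>1| \<le> a/2\<close> is \<open>0\<close>; energy bounds and Arzela-Ascoli give a locally uniform limit. Its
  moduli tend to a well at each end, to \<open>(a, 0)\<close> at \<open>+\<infinity>\<close> by the choice of the translation. If they
  came close to \<open>(a, 0)\<close> also on the left, then cutting the sequence there and joining it to
  \<open>(a, 0)\<close> would save a fixed amount of energy, contradicting minimality. Convergence of the
  energies makes the derivatives converge strongly, and the tails are controlled by the cost of
  leaving a well and by the non-degeneracy of the wells.

  A minimizer solves \<open>\<psi>\<^sub>j'' = c\<^sub>j(x) \<psi>\<^sub>j\<close> with real \<open>c\<^sub>j\<close>, so \<open>Im (cnj \<psi>\<^sub>j \<psi>\<^sub>j')\<close> is constant, hence
  zero, and the phase of \<open>\<psi>\<^sub>j\<close> can only jump at a zero of \<open>\<psi>\<^sub>j\<close>. There is no such zero \<open>x0\<close>: changing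
  the sign of \<open>\<psi>\<^sub>j\<close> to the left of \<open>x0\<close> gives another minimizer, so \<open>\<psi>\<^sub>j'(x0) = 0\<close> and \<open>\<psi>\<^sub>j\<close> vanishes
  identically.\<close>

section \<open>Smooth bump functions\<close>

text \<open>Elements of \<open>H1_loc\<close> carry an arbitrarily chosen weak derivative, so the
  argument runs on pairs: a curve \<open>\<Psi>\<close> and a density \<open>g\<close> with
  \<open>primitive_of g \<Psi>\<close>. The bump functions serve the du Bois-Reymond lemma, which
  translates weak derivatives into such pairs.

  The obstacle to compactness is translation invariance: a limit of arbitrary translates may be a
  single well. The level \<open>a / 2\<close> excludes both wells at \<open>0\<close>. A curve that
  is near \<open>(a, 0)\<close> left of \<open>0\<close> has to leave that well again before
  \<open>0\<close>, and by \<open>crossing_cost\<close> this loop costs a fixed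
  \<open>\<kappa>\<close>, while joining the curve to \<open>(a, 0)\<close> costs at most
  \<open>\<kappa> / 2\<close>.

  Weak limits in L^2 are replaced by a convexity argument with the parallelogram law. Kinetic and
  potential energy are separately lower semicontinuous, so convergence of the sum to the minimum
  forces convergence of each.

  In the squared moduli each well lies on the boundary of the quadrant, so non-degeneracy means a
  nonzero first derivative in one direction and a nonzero second derivative in the other.\<close>

lemma Ck_mult_const:
  fixes f :: "real \<Rightarrow> real"
  assumes "Ck k f"
  shows "Ck k (\<lambda>x. f x * c)"
  using assms
proof (induction k arbitrary: f)
  case 0
  then show ?case by (auto intro: continuous_intros)
next
  case (Suc k)
  have "frechet_derivative (\<lambda>x. f x * c) (at x) = (\<lambda>v. frechet_derivative f (at x) v * c)" for x
  proof -
    have "(f has_derivative frechet_derivative f (at x)) (at x)"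
      using Suc.prems by (simp add: frechet_derivative_works)
    then have "((\<lambda>x. f x * c) has_derivative (\<lambda>v. frechet_derivative f (at x) v * c)) (at x)"
      by (rule has_derivative_mult_left)
    then show ?thesis by (simp add: frechet_derivative_at[symmetric])
  qed
  with Suc show ?case by auto
qed

text \<open>On the line the derivative along \<open>v\<close> is \<open>f' x * v\<close>, so the
  quantifier over directions in \<open>Ck\<close> reduces to the single function \<open>f'\<close>,
  up to the constant factors handled by \<open>Ck_mult_const\<close>.\<close>

lemma Ck_SucI:
  fixes f f' :: "real \<Rightarrow> real"
  assumes d: "\<And>x. (f has_real_derivative f' x) (at x)" and k: "Ck k f'"
  shows "Ck (Suc k) f"
proof -
  have "frechet_derivative f (at x) = (\<lambda>v. f' x * v)" for x
    using d[of x] by (simp add: has_field_derivative_def frechet_derivative_at[symmetric])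
  moreover have "f differentiable (at x)" for x
    using d[of x] by (auto simp: has_field_derivative_def differentiable_def)
  ultimately show ?thesis using Ck_mult_const[OF k] by simp
qed

lemma Ck_SucD:
  fixes f :: "real \<Rightarrow> real"
  assumes "Ck (Suc k) f"
  shows "\<exists>f'. (\<forall>x. (f has_real_derivative f' x) (at x)) \<and> Ck k f'"
proof -
  define f' where "f' = (\<lambda>x. frechet_derivative f (at x) 1)"
  have "(f has_real_derivative f' x) (at x)" for x
  proof -
    have d: "(f has_derivative frechet_derivative f (at x)) (at x)"
      using assms by (simp add: frechet_derivative_works)
    have "frechet_derivative f (at x) v = f' x * v" for v
      using linear_scale[OF has_derivative_linear[OF d], of v 1] by (simp add: f'_def)
    then have "frechet_derivative f (at x) = (*) (f' x)" by auto
    with d show ?thesis by (simp add: has_field_derivative_def)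
  qed
  moreover have "Ck k f'" using assms by (simp add: f'_def)
  ultimately show ?thesis by blast
qed

lemma Ck_SucD': "Ck (Suc k) (f :: real \<Rightarrow> real) \<Longrightarrow> Ck k f"
proof (induction k arbitrary: f)
  case 0
  then obtain f' where "\<And>x. (f has_real_derivative f' x) (at x)" using Ck_SucD by blast
  then show ?case using DERIV_isCont by (auto simp: continuous_on_eq_continuous_at)
next
  case (Suc k)
  from Suc.prems obtain f' where "\<And>x. (f has_real_derivative f' x) (at x)" "Ck (Suc k) f'"
    using Ck_SucD by blast
  then show ?case using Suc.IH Ck_SucI by blast
qed

lemma Ck_add: "Ck k f \<Longrightarrow> Ck k g \<Longrightarrow> Ck k (\<lambda>x. f x + g x :: real)" for f g :: "real \<Rightarrow> real"
proof (induction k arbitrary: f g)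
  case 0
  then show ?case by (auto intro: continuous_intros)
next
  case (Suc k)
  obtain f' where f': "\<And>x. (f has_real_derivative f' x) (at x)" "Ck k f'"
    using Ck_SucD[OF Suc.prems(1)] by blast
  obtain g' where g': "\<And>x. (g has_real_derivative g' x) (at x)" "Ck k g'"
    using Ck_SucD[OF Suc.prems(2)] by blast
  show ?case
    by (rule Ck_SucI[OF DERIV_add]) (use f' g' Suc.IH in auto)
qed

lemma Ck_diff: "Ck k f \<Longrightarrow> Ck k g \<Longrightarrow> Ck k (\<lambda>x. f x - g x :: real)" for f g :: "real \<Rightarrow> real"
  using Ck_add[of k f "\<lambda>x. g x * (-1)"] Ck_mult_const[of k g "-1"] by simp

lemma Ck_mult: "Ck k f \<Longrightarrow> Ck k g \<Longrightarrow> Ck k (\<lambda>x. f x * g x :: real)" for f g :: "real \<Rightarrow> real"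
proof (induction k arbitrary: f g)
  case 0
  then show ?case by (auto intro: continuous_intros)
next
  case (Suc k)
  obtain f' where f': "\<And>x. (f has_real_derivative f' x) (at x)" "Ck k f'"
    using Ck_SucD[OF Suc.prems(1)] by blast
  obtain g' where g': "\<And>x. (g has_real_derivative g' x) (at x)" "Ck k g'"
    using Ck_SucD[OF Suc.prems(2)] by blast
  show ?case
    by (rule Ck_SucI[OF DERIV_mult])
       (use f' g' Suc.IH Suc.prems Ck_SucD' in \<open>auto intro!: Ck_add\<close>)
qed

lemma Ck_affine: "Ck k f \<Longrightarrow> Ck k (\<lambda>x. f (c * x + d) :: real)" for f :: "real \<Rightarrow> real"
proof (induction k arbitrary: f)
  case 0
  then show ?case
    by (auto intro!: continuous_intros continuous_on_compose2[of UNIV f])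
next
  case (Suc k)
  obtain f' where f': "\<And>x. (f has_real_derivative f' x) (at x)" "Ck k f'"
    using Ck_SucD[OF Suc.prems(1)] by blast
  have "((\<lambda>x. f (c * x + d)) has_real_derivative f' (c * x + d) * c) (at x)" for x
    by (rule DERIV_chain2[of f]) (auto intro!: derivative_eq_intros f')
  then show ?case
    by (rule Ck_SucI) (intro Ck_mult_const Suc.IH f')
qed

text \<open>The powers of \<open>1 / x\<close> are included so that the family is closed under
  differentiation up to linear combinations; smoothness of all members then follows by one induction
  with \<open>n\<close> arbitrary.\<close>

definition exp_flat :: "nat \<Rightarrow> real \<Rightarrow> real" where
  "exp_flat n x = (if x > 0 then (1 / x) ^ n * exp (- (1 / x)) else 0)"

lemma exp_flat_tendsto: "(exp_flat n \<longlongrightarrow> 0) (at 0)"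
proof -
  have "((\<lambda>x::real. x ^ n * exp (- x)) \<longlongrightarrow> 0) at_top"
    using tendsto_power_div_exp_0[of n] by (simp add: exp_minus divide_inverse)
  moreover have "filterlim (\<lambda>x::real. 1 / x) at_top (at_right 0)"
    using filterlim_inverse_at_top_right by (simp add: divide_inverse)
  ultimately have "((\<lambda>x::real. (1 / x) ^ n * exp (- (1 / x))) \<longlongrightarrow> 0) (at_right 0)"
    by (rule filterlim_compose)
  then have "(exp_flat n \<longlongrightarrow> 0) (at_right 0)"
    by (rule Lim_transform_eventually)
       (auto simp: exp_flat_def eventually_at_right_field intro: exI[of _ 1])
  moreover have "(exp_flat n \<longlongrightarrow> 0) (at_left 0)"
    by (rule Lim_transform_eventually[of "\<lambda>_. 0"])
       (auto simp: exp_flat_def eventually_at_left_field intro: exI[of _ "-1"])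
  ultimately show ?thesis by (simp add: filterlim_at_split)
qed

lemma exp_flat_deriv:
  "(exp_flat n has_real_derivative exp_flat (n + 2) x - real n * exp_flat (n + 1) x) (at x)"
proof -
  consider "x > 0" | "x < 0" | "x = 0" by linarith
  then show ?thesis
  proof cases
    case 1
    have "((\<lambda>x. (1 / x) ^ n * exp (- (1 / x))) has_real_derivative
        exp_flat (n + 2) x - real n * exp_flat (n + 1) x) (at x)"
    proof -
      have "((\<lambda>x::real. 1 / x) has_real_derivative - ((1 / x) ^ 2)) (at x)"
        using 1 by (auto intro!: derivative_eq_intros simp: power2_eq_square)
      note d = this
      have p: "real n * ((1 / x) ^ (n - Suc 0) * (1 / x) ^ 2) = real n * (1 / x) ^ (n + 1)"
        by (cases n) (simp_all add: power_add[symmetric] power2_eq_square)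
      show ?thesis
        by (rule DERIV_cong[OF DERIV_mult[OF DERIV_power[OF d] DERIV_fun_exp[OF DERIV_minus[OF d]]]])
           (use 1 p in \<open>simp add: exp_flat_def algebra_simps power_add power2_eq_square\<close>)
    qed
    then show ?thesis
      by (rule has_field_derivative_transform_within_open[of _ _ _ "{0<..}"])
         (use 1 in \<open>auto simp: exp_flat_def\<close>)
  next
    case 2
    have "((\<lambda>x. 0) has_real_derivative exp_flat (n + 2) x - real n * exp_flat (n + 1) x) (at x)"
      using 2 by (simp add: exp_flat_def)
    then show ?thesis
      by (rule has_field_derivative_transform_within_open[of _ _ _ "{..<0}"])
         (use 2 in \<open>auto simp: exp_flat_def\<close>)
  next
    case 3
    \<comment> \<open>At \<open>0\<close> the difference quotient is again a member of the family:
      \<open>exp_flat n h / h\<close> equals \<open>exp_flat (Suc n) h\<close>.\<close>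
    have "((\<lambda>h. (exp_flat n (0 + h) - exp_flat n 0) / h) \<longlongrightarrow> 0) (at 0)"
      by (rule Lim_transform_eventually[OF exp_flat_tendsto[of "Suc n"]])
         (auto simp: exp_flat_def eventually_at intro: exI[of _ 1])
    then show ?thesis using 3 by (simp add: DERIV_def exp_flat_def)
  qed
qed

lemma Ck_exp_flat: "Ck k (exp_flat n)"
proof (induction k arbitrary: n)
  case 0
  show ?case using DERIV_isCont[OF exp_flat_deriv] by (simp add: continuous_on_eq_continuous_at)
next
  case (Suc k)
  show ?case
    by (rule Ck_SucI[OF exp_flat_deriv])
       (use Ck_mult_const[OF Suc.IH, of "n + 1" "real n"] in \<open>auto intro!: Ck_diff Suc.IH simp: mult.commute\<close>)
qed

text \<open>The two factors vanish for \<open>x \<le> -1\<close> and for \<open>x \<ge> 1\<close>.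
  The arguments are spelled \<open>1 * x + 1\<close> and \<open>(-1) * x + 1\<close> to have the
  shape of \<open>Ck_affine\<close>.\<close>

definition bump :: "real \<Rightarrow> real" where
  "bump x = exp_flat 0 (1 * x + 1) * exp_flat 0 ((-1) * x + 1)"

lemma Ck_bump: "Ck k bump"
  unfolding bump_def[abs_def] by (intro Ck_mult Ck_affine Ck_exp_flat)

lemma bump_nonneg: "bump x \<ge> 0" and bump_pos: "\<bar>x\<bar> < 1 \<Longrightarrow> bump x > 0"
  and bump_eq_0: "\<bar>x\<bar> \<ge> 1 \<Longrightarrow> bump x = 0"
  by (auto simp: bump_def exp_flat_def abs_if split: if_splits)

text \<open>A bump is not the derivative of a test function, but the difference of two translates of
  it is: by the constancy on both sides, the corresponding difference of antiderivatives has compact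
  support.\<close>

lemma bump_antideriv:
  obtains P where "\<And>x. (P has_real_derivative bump x) (at x)"
    "\<And>x. x \<ge> 1 \<Longrightarrow> P x = P 1" "\<And>x. x \<le> -1 \<Longrightarrow> P x = P (-1)"
proof -
  have cont: "isCont bump x" for x
    using Ck_bump[of 0] by (simp add: continuous_on_eq_continuous_at)
  obtain P where P0: "\<And>x. -\<infinity> < ereal x \<Longrightarrow> ereal x < \<infinity> \<Longrightarrow> (P has_vector_derivative bump x) (at x)"
    using einterval_antiderivative[of "-\<infinity>" "\<infinity>" bump] cont by auto
  have P: "(P has_real_derivative bump x) (at x)" for x
    using P0[of x] by (simp add: has_real_derivative_iff_has_vector_derivative)
  have *: "\<exists>c. \<forall>x\<in>S. P x = c" if "convex S" "\<And>x. x \<in> S \<Longrightarrow> \<bar>x\<bar> \<ge> 1" for S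
    using that P bump_eq_0
    by (intro has_field_derivative_zero_constant) (metis has_field_derivative_at_within)+
  obtain c1 where c1: "\<forall>x\<in>{1..}. P x = c1" using *[of "{1..}"] by auto
  obtain c2 where c2: "\<forall>x\<in>{..-1}. P x = c2" using *[of "{..-1}"] by auto
  have 1: "P x = P 1" if "x \<ge> 1" for x using c1 that by auto
  have 2: "P x = P (-1)" if "x \<le> -1" for x using c2 that by auto
  show ?thesis using that P 1 2 by blast
qed

section \<open>Primitives and weak derivatives\<close>

definition locally_integrable :: "(real \<Rightarrow> 'a::euclidean_space) \<Rightarrow> bool" where
  "locally_integrable g \<longleftrightarrow> (\<forall>s t. set_integrable lborel {s..t} g)"

text \<open>Local absolute continuity with density \<open>g\<close>, in integrated form. For
  continuous \<open>f\<close> this is equivalent to \<open>g\<close> being a weak derivative of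
  \<open>f\<close>; test functions occur only in the proof of that equivalence.\<close>

definition primitive_of :: "(real \<Rightarrow> 'a::euclidean_space) \<Rightarrow> (real \<Rightarrow> 'a) \<Rightarrow> bool" where
  "primitive_of g f \<longleftrightarrow> locally_integrable g \<and>
     (\<forall>s t. s \<le> t \<longrightarrow> f t - f s = (LINT x:{s..t}|lborel. g x))"

lemma locally_integrableD: "locally_integrable g \<Longrightarrow> set_integrable lborel {s..t} g"
  by (simp add: locally_integrable_def)

lemma primitive_ofD:
  assumes "primitive_of g f"
  shows "locally_integrable g" "s \<le> t \<Longrightarrow> f t - f s = (LINT x:{s..t}|lborel. g x)"
  using assms by (auto simp: primitive_of_def)

lemma locally_integrable_measurable:
  assumes "locally_integrable g"
  shows "g \<in> borel_measurable borel"
proof -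
  have "(\<lambda>x. indicator {- real n..real n} x *\<^sub>R g x) \<in> borel_measurable borel" for n
    using borel_measurable_integrable[OF locally_integrableD[OF assms, of "- real n" "real n", unfolded set_integrable_def]]
    by simp
  moreover have "(\<lambda>n. indicator {- real n..real n} x *\<^sub>R g x) \<longlonglongrightarrow> g x" for x
  proof (rule tendsto_eventually)
    obtain N :: nat where "\<bar>x\<bar> \<le> real N" using real_arch_simple by blast
    then show "\<forall>\<^sub>F n in sequentially. indicator {- real n..real n} x *\<^sub>R g x = g x"
      by (intro eventually_sequentiallyI[of N]) (auto simp: indicator_def)
  qed
  ultimately show ?thesis by (rule borel_measurable_LIMSEQ_metric)
qed

lemma continuous_locally_integrable:
  "continuous_on UNIV f \<Longrightarrow> locally_integrable f"
  unfolding locally_integrable_def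
  by (metis borel_integrable_atLeastAtMost' continuous_on_subset subset_UNIV)

text \<open>The sets over which a truncation of \<open>g\<close> integrates to \<open>0\<close>
  contain the closed intervals and are closed under complements and countable disjoint unions, so
  they exhaust the Borel sets. Truncation to \<open>{- real n..real n}\<close> makes
  \<open>g\<close> integrable on the whole line.\<close>

lemma AE_0_if_interval_integrals_0:
  fixes g :: "real \<Rightarrow> 'a::euclidean_space"
  assumes g: "locally_integrable g"
    and 0: "\<And>s t. s \<le> t \<Longrightarrow> (LINT x:{s..t}|lborel. g x) = 0"
  shows "AE x in lborel. g x = 0"
proof -
  have "AE x in lborel. indicator {- real n..real n} x *\<^sub>R g x = 0" for n :: nat
  proof (rule sigma_finite_measure.density_zero[OF lborel.sigma_finite_measure_axioms])
    let ?f = "\<lambda>x. indicator {- real n..real n} x *\<^sub>R g x"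
    show int: "integrable lborel ?f"
      using locally_integrableD[OF g] by (simp add: set_integrable_def)
    have si: "set_integrable lborel A ?f" if "A \<in> sets borel" for A
      using integrable_mult_indicator[OF _ int, of A] that by (simp add: set_integrable_def)
    have ival: "(LINT x:{a..b}|lborel. ?f x) = 0" for a b
    proof -
      have "(LINT x:{a..b}|lborel. ?f x) = (LINT x:{max a (- real n)..min b (real n)}|lborel. g x)"
        unfolding set_lebesgue_integral_def by (intro Bochner_Integration.integral_cong) (auto simp: indicator_def)
      also have "\<dots> = 0"
        using 0[of "max a (- real n)" "min b (real n)"]
        by (cases "max a (- real n) \<le> min b (real n)") (simp_all add: set_lebesgue_integral_def del: max.bounded_iff min.bounded_iff)
      finally show ?thesis .
    qed
    show "(LINT x:A|lborel. ?f x) = 0" if "A \<in> sets lborel" for A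
    proof -
      from that have "A \<in> sets borel" by simp
      then show ?thesis
      proof (induction rule: borel_set_induct)
        case empty
        then show ?case by (simp add: set_lebesgue_integral_def)
      next
        case (interval a b)
        show ?case by (rule ival)
      next
        case (compl A)
        have "(LINT x:A \<union> (-A)|lborel. ?f x) = (LINT x:A|lborel. ?f x) + (LINT x:-A|lborel. ?f x)"
          using compl.hyps by (intro set_integral_Un si) auto
        moreover have "(LINT x:A \<union> (-A)|lborel. ?f x) = (LINT x:{- real n..real n}|lborel. ?f x)"
          unfolding set_lebesgue_integral_def by (intro Bochner_Integration.integral_cong) (auto simp: indicator_def)
        ultimately show ?case using compl.IH ival by simp
      next
        case (union F)
        have "(LINT x:(\<Union>i. F i)|lborel. ?f x) = (\<Sum>i. (LINT x:F i|lborel. ?f x))"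
          using union.hyps by (intro lebesgue_integral_countable_add si) (auto simp: disjoint_family_on_def)
        then show ?case using union.IH by simp
      qed
    qed
  qed
  then have "AE x in lborel. \<forall>n::nat. indicator {- real n..real n} x *\<^sub>R g x = 0"
    unfolding AE_all_countable by blast
  then show ?thesis
  proof eventually_elim
    case (elim x)
    obtain n :: nat where "\<bar>x\<bar> \<le> real n" using real_arch_simple by blast
    with elim[rule_format, of n] show ?case by (auto simp: indicator_def split: if_splits)
  qed
qed

lemma locally_integrable_diff:
  "locally_integrable f \<Longrightarrow> locally_integrable g \<Longrightarrow> locally_integrable (\<lambda>x. f x - g x)"
  by (auto simp: locally_integrable_def)

lemma primitive_of_unique:
  assumes "primitive_of g f" "primitive_of g' f"
  shows "AE x in lborel. g x = g' x"
proof -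
  have "AE x in lborel. g x - g' x = 0"
  proof (rule AE_0_if_interval_integrals_0)
    show "locally_integrable (\<lambda>x. g x - g' x)"
      using assms by (intro locally_integrable_diff primitive_ofD(1))
    show "(LINT x:{s..t}|lborel. g x - g' x) = 0" if "s \<le> t" for s t
      using primitive_ofD(2)[OF assms(1) that] primitive_ofD(2)[OF assms(2) that]
        set_integral_diff(2)[OF locally_integrableD[OF primitive_ofD(1)[OF assms(1)]]
          locally_integrableD[OF primitive_ofD(1)[OF assms(2)]], of s t]
      by simp
  qed
  then show ?thesis by simp
qed

lemma primitive_of_continuous:
  assumes "primitive_of g f"
  shows "continuous_on UNIV f"
proof -
  have "isCont f x" for x
  proof -
    have eq: "f y = f (x - 1) + integral {x - 1..y} g" if "y \<in> {x - 1..x + 1}" for y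
      using primitive_ofD(2)[OF assms, of "x - 1" y] that
        set_borel_integral_eq_integral(2)[OF locally_integrableD[OF primitive_ofD(1)[OF assms]], of "x - 1" y]
      by (simp add: algebra_simps)
    have "g integrable_on {x - 1..x + 1}"
      using set_borel_integral_eq_integral(1)[OF locally_integrableD[OF primitive_ofD(1)[OF assms]]] .
    then have "continuous_on {x - 1..x + 1} (\<lambda>y. f (x - 1) + integral {x - 1..y} g)"
      by (intro continuous_intros indefinite_integral_continuous_1)
    then have "continuous_on {x - 1..x + 1} f"
      by (rule continuous_on_eq) (rule eq[symmetric])
    then show ?thesis by (rule continuous_on_interior) simp
  qed
  then show ?thesis by (simp add: continuous_on_eq_continuous_at)
qed

lemma locally_integrable_scaleR_continuous:
  fixes g :: "real \<Rightarrow> 'a::euclidean_space" and F :: "real \<Rightarrow> real"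
  assumes "locally_integrable g" "continuous_on UNIV F"
  shows "locally_integrable (\<lambda>x. F x *\<^sub>R g x)"
  unfolding locally_integrable_def
proof (intro allI)
  fix s t :: real
  have "compact (F ` {s..t})"
    using assms(2) by (intro compact_continuous_image) (auto intro: continuous_on_subset)
  from compact_imp_bounded[OF this] obtain B where "\<forall>y\<in>F ` {s..t}. norm y \<le> B"
    unfolding bounded_iff by blast
  then have B: "\<bar>F x\<bar> \<le> B" if "x \<in> {s..t}" for x
    using that by simp
  have [measurable]: "F \<in> borel_measurable borel" "g \<in> borel_measurable borel"
    using borel_measurable_continuous_onI[OF assms(2)] locally_integrable_measurable[OF assms(1)] by auto
  show "set_integrable lborel {s..t} (\<lambda>x. F x *\<^sub>R g x)"
  proof (rule set_integrable_bound[of _ _ "\<lambda>x. B *\<^sub>R g x"])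
    show "set_integrable lborel {s..t} (\<lambda>x. B *\<^sub>R g x)"
      using locally_integrableD[OF assms(1)] by auto
    show "set_borel_measurable lborel {s..t} (\<lambda>x. F x *\<^sub>R g x)"
      by (simp add: set_borel_measurable_def)
    show "AE x in lborel. x \<in> {s..t} \<longrightarrow> norm (F x *\<^sub>R g x) \<le> norm (B *\<^sub>R g x)"
    proof (intro AE_I2 impI)
      fix x assume "x \<in> {s..t}"
      then have "\<bar>F x\<bar> \<le> \<bar>B\<bar>" using B[of x] by linarith
      then show "norm (F x *\<^sub>R g x) \<le> norm (B *\<^sub>R g x)" by (simp add: mult_right_mono)
    qed
  qed
qed

text \<open>Both factors are only absolutely continuous, so instead of a product rule Fubini is
  applied to \<open>q x * p y\<close> on the triangle \<open>y \<le> x\<close> of the square over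
  \<open>{s..t}\<close>: integrating out \<open>y\<close> first gives
  \<open>q x * (P x - P s)\<close>, integrating out \<open>x\<close> first gives
  \<open>p y * (Q t - Q y)\<close>.\<close>

lemma primitive_of_by_parts:
  fixes p q P Q :: "real \<Rightarrow> real"
  assumes P: "primitive_of p P" and Q: "primitive_of q Q" and st: "s \<le> t"
  shows "(LINT x:{s..t}|lborel. p x * Q x + P x * q x) = P t * Q t - P s * Q s"
proof -
  define p' where "p' = (\<lambda>x. indicator {s..t} x * p x)"
  define q' where "q' = (\<lambda>x. indicator {s..t} x * q x)"
  have ip: "integrable lborel p'" and iq: "integrable lborel q'"
    using locally_integrableD[OF primitive_ofD(1)[OF P], of s t] locally_integrableD[OF primitive_ofD(1)[OF Q], of s t]
    by (simp_all add: p'_def q'_def set_integrable_def)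
  have [measurable]: "p' \<in> borel_measurable borel" "q' \<in> borel_measurable borel"
    using borel_measurable_integrable[OF ip] borel_measurable_integrable[OF iq] by simp_all
  have Pi: "(\<integral>y. p' y * indicator {y. y \<le> x} y \<partial>lborel) = P x - P s" if "x \<in> {s..t}" for x
  proof -
    have "(\<integral>y. p' y * indicator {y. y \<le> x} y \<partial>lborel) = (LINT y:{s..x}|lborel. p y)"
      unfolding set_lebesgue_integral_def
      by (rule Bochner_Integration.integral_cong) (use that in \<open>auto simp: p'_def indicator_def\<close>)
    then show ?thesis using primitive_ofD(2)[OF P, of s x] that by simp
  qed
  have Qi: "(\<integral>x. q' x * indicator {x. y \<le> x} x \<partial>lborel) = Q t - Q y" if "y \<in> {s..t}" for y
  proof -
    have "(\<integral>x. q' x * indicator {x. y \<le> x} x \<partial>lborel) = (LINT x:{y..t}|lborel. q x)"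
      unfolding set_lebesgue_integral_def
      by (rule Bochner_Integration.integral_cong) (use that in \<open>auto simp: q'_def indicator_def\<close>)
    then show ?thesis using primitive_ofD(2)[OF Q, of y t] that by simp
  qed
  define k where "k = (\<lambda>x y. q' x * (p' y * indicator {z. z \<le> x} y))"
  have "integrable (lborel \<Otimes>\<^sub>M lborel) (\<lambda>(x, y). q' x * p' y)"
  proof (rule lborel_pair.Fubini_integrable)
    show "integrable lborel (\<lambda>x. \<integral>y. norm (case (x, y) of (x, y) \<Rightarrow> q' x * p' y) \<partial>lborel)"
      using iq by (simp add: abs_mult integrable_abs)
    show "AE x in lborel. integrable lborel (\<lambda>y. case (x, y) of (x, y) \<Rightarrow> q' x * p' y)"
      using ip by simp
  qed simp
  then have kint: "integrable (lborel \<Otimes>\<^sub>M lborel) (\<lambda>(x, y). k x y)"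
  proof (rule Bochner_Integration.integrable_bound)
    show "(\<lambda>(x, y). k x y) \<in> borel_measurable (lborel \<Otimes>\<^sub>M lborel)"
      unfolding k_def by measurable
    show "AE z in lborel \<Otimes>\<^sub>M lborel. norm (case z of (x, y) \<Rightarrow> k x y) \<le> norm (case z of (x, y) \<Rightarrow> q' x * p' y)"
      by (intro AE_I2) (simp add: k_def indicator_def split: prod.split)
  qed
  have 1: "(\<integral>x. (\<integral>y. k x y \<partial>lborel) \<partial>lborel) = (LINT x:{s..t}|lborel. q x * (P x - P s))"
    unfolding set_lebesgue_integral_def
  proof (rule Bochner_Integration.integral_cong)
    fix x
    have "(\<integral>y. k x y \<partial>lborel) = q' x * (\<integral>y. p' y * indicator {z. z \<le> x} y \<partial>lborel)"
      by (simp add: k_def)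
    also have "\<dots> = indicator {s..t} x *\<^sub>R (q x * (P x - P s))"
      using Pi[of x] by (cases "x \<in> {s..t}") (simp_all add: q'_def)
    finally show "(\<integral>y. k x y \<partial>lborel) = \<dots>" .
  qed simp
  have 2: "(\<integral>y. (\<integral>x. k x y \<partial>lborel) \<partial>lborel) = (LINT y:{s..t}|lborel. p y * (Q t - Q y))"
    unfolding set_lebesgue_integral_def
  proof (rule Bochner_Integration.integral_cong)
    fix y
    have "(\<integral>x. k x y \<partial>lborel) = (\<integral>x. p' y * (q' x * indicator {x. y \<le> x} x) \<partial>lborel)"
      by (intro Bochner_Integration.integral_cong) (auto simp: k_def indicator_def)
    also have "\<dots> = p' y * (\<integral>x. q' x * indicator {x. y \<le> x} x \<partial>lborel)" by simp
    also have "\<dots> = indicator {s..t} y *\<^sub>R (p y * (Q t - Q y))"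
      using Qi[of y] by (cases "y \<in> {s..t}") (simp_all add: p'_def)
    finally show "(\<integral>x. k x y \<partial>lborel) = \<dots>" .
  qed simp
  have cP: "continuous_on UNIV P" and cQ: "continuous_on UNIV Q"
    using P Q by (auto intro: primitive_of_continuous)
  have i: "set_integrable lborel {s..t} p" "set_integrable lborel {s..t} q"
      "set_integrable lborel {s..t} (\<lambda>x. p x * Q x)" "set_integrable lborel {s..t} (\<lambda>x. P x * q x)"
    using locally_integrableD[OF primitive_ofD(1)[OF P]] locally_integrableD[OF primitive_ofD(1)[OF Q]]
      locally_integrableD[OF locally_integrable_scaleR_continuous[OF primitive_ofD(1)[OF P] cQ]]
      locally_integrableD[OF locally_integrable_scaleR_continuous[OF primitive_ofD(1)[OF Q] cP]]
    by (simp_all add: mult.commute)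
  have "(LINT x:{s..t}|lborel. q x * (P x - P s)) = (LINT x:{s..t}|lborel. P x * q x - P s * q x)"
    by (simp add: algebra_simps)
  also have "\<dots> = (LINT x:{s..t}|lborel. P x * q x) - P s * (Q t - Q s)"
    using i primitive_ofD(2)[OF Q st] by (subst set_integral_diff) auto
  finally have 3: "(LINT x:{s..t}|lborel. q x * (P x - P s)) = \<dots>" .
  have "(LINT x:{s..t}|lborel. p x * (Q t - Q x)) = (LINT x:{s..t}|lborel. Q t * p x - p x * Q x)"
    by (simp add: algebra_simps)
  also have "\<dots> = Q t * (P t - P s) - (LINT x:{s..t}|lborel. p x * Q x)"
    using i primitive_ofD(2)[OF P st] by (subst set_integral_diff) auto
  finally have 4: "(LINT x:{s..t}|lborel. p x * (Q t - Q x)) = \<dots>" .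
  have "(LINT x:{s..t}|lborel. p x * Q x + P x * q x)
      = (LINT x:{s..t}|lborel. p x * Q x) + (LINT x:{s..t}|lborel. P x * q x)"
    using i by (intro set_integral_add) auto
  then show ?thesis
    using lborel_pair.Fubini_integral[OF kint] 1 2 3 4 by (simp add: algebra_simps)
qed

lemma primitive_of_inner:
  assumes "primitive_of g f"
  shows "primitive_of (\<lambda>x. g x \<bullet> e) (\<lambda>x. f x \<bullet> e)"
  unfolding primitive_of_def locally_integrable_def
proof (intro conjI allI impI)
  fix s t :: real
  have i: "integrable lborel (\<lambda>x. indicator {s..t} x *\<^sub>R g x)"
    using locally_integrableD[OF primitive_ofD(1)[OF assms]] by (simp add: set_integrable_def)
  show "set_integrable lborel {s..t} (\<lambda>x. g x \<bullet> e)"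
    using integrable_inner_left[OF i, of e] by (simp add: set_integrable_def)
  assume "s \<le> t"
  then show "f t \<bullet> e - f s \<bullet> e = (LINT x:{s..t}|lborel. g x \<bullet> e)"
    using primitive_ofD(2)[OF assms, of s t] integral_inner_left[OF i, of e]
    by (simp add: set_lebesgue_integral_def inner_diff_left[symmetric])
qed

lemma primitive_of_C1:
  fixes f :: "real \<Rightarrow> 'a::euclidean_space"
  assumes d: "\<And>x. (f has_vector_derivative f' x) (at x)" and c: "continuous_on UNIV f'"
  shows "primitive_of f' f"
  unfolding primitive_of_def
proof (intro conjI allI impI)
  show "locally_integrable f'" using c by (rule continuous_locally_integrable)
  show "f t - f s = (LINT x:{s..t}|lborel. f' x)" if "s \<le> t" for s t
    unfolding set_lebesgue_integral_def
    using that d c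
    by (intro integral_FTC_atLeastAtMost[symmetric])
       (auto intro: has_vector_derivative_at_within continuous_on_subset)
qed

lemma set_integral_Icc_combine:
  fixes g :: "real \<Rightarrow> 'a::euclidean_space"
  assumes "locally_integrable g" "a \<le> b" "b \<le> c"
  shows "(LINT x:{a..c}|lborel. g x) = (LINT x:{a..b}|lborel. g x) + (LINT x:{b..c}|lborel. g x)"
  using set_borel_integral_eq_integral[OF locally_integrableD[OF assms(1)]]
    Henstock_Kurzweil_Integration.integral_combine[OF assms(2,3), of g]
  by simp

lemma primitive_exists:
  assumes "locally_integrable g"
  obtains f where "primitive_of g f" "f 0 = 0"
proof -
  define f where "f x = (if 0 \<le> x then (LINT y:{0..x}|lborel. g y) else - (LINT y:{x..0}|lborel. g y))" for x
  have "f t - f s = (LINT x:{s..t}|lborel. g x)" if "s \<le> t" for s t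
    using that set_integral_Icc_combine[OF assms, of 0 s t]
      set_integral_Icc_combine[OF assms, of s t 0] set_integral_Icc_combine[OF assms, of s 0 t]
    by (auto simp: f_def)
  moreover have "f 0 = 0"
    using set_integral_Icc_combine[OF assms, of 0 0 0] by (simp add: f_def)
  ultimately show ?thesis using assms that by (auto simp: primitive_of_def)
qed

lemma test_functionE:
  assumes "test_function \<phi>"
  obtains R where "R > 0" "\<And>x. (\<phi> has_real_derivative deriv \<phi> x) (at x)" "continuous_on UNIV (deriv \<phi>)"
    "\<And>x. x \<notin> {-R..R} \<Longrightarrow> \<phi> x = 0" "\<And>x. x \<notin> {-R..R} \<Longrightarrow> deriv \<phi> x = 0" "\<phi> R = 0" "\<phi> (-R) = 0"
proof -
  from assms have "Ck (Suc 0) \<phi>" by (simp add: test_function_def)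
  from Ck_SucD[OF this] obtain \<phi>' where d: "\<And>x. (\<phi> has_real_derivative \<phi>' x) (at x)"
    and c: "continuous_on UNIV \<phi>'" by auto
  have eq: "deriv \<phi> = \<phi>'" using DERIV_imp_deriv[OF d] by auto
  have "bounded {x. \<phi> x \<noteq> 0}"
    using assms compact_imp_bounded bounded_subset closure_subset by (metis test_function_def)
  then obtain B where B: "\<And>x. \<phi> x \<noteq> 0 \<Longrightarrow> \<bar>x\<bar> \<le> B" by (auto simp: bounded_iff)
  \<comment> \<open>The extra \<open>1\<close> makes \<open>\<phi>\<close> vanish also at the
    endpoints \<open>R\<close> and \<open>-R\<close>, where the boundary terms of the integration by
    parts are taken.\<close>
  define R where "R = \<bar>B\<bar> + 1"
  have z: "\<phi> x = 0" if "\<bar>x\<bar> \<ge> R" for x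
    using B[of x] that by (cases "\<phi> x = 0") (auto simp: R_def)
  have "\<phi>' x = 0" if "x \<notin> {-R..R}" for x
  proof -
    have "((\<lambda>_. 0) has_real_derivative \<phi>' x) (at x)"
      by (rule has_field_derivative_transform_within_open[OF d, of "- {-R..R}"])
         (use that z in \<open>auto simp: not_le\<close>)
    then show ?thesis using DERIV_unique[OF _ DERIV_const] by blast
  qed
  moreover have "R > 0" by (simp add: R_def)
  moreover from this have "\<phi> R = 0" "\<phi> (- R) = 0" "\<And>x. x \<notin> {-R..R} \<Longrightarrow> \<phi> x = 0"
    by (auto intro!: z)
  ultimately show ?thesis using that[of R] d c unfolding eq by blast
qed

lemma has_weak_derivative_if_primitive:
  fixes f :: "real \<Rightarrow> 'a::euclidean_space"
  assumes P: "primitive_of g f"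
  shows "has_weak_derivative f g"
  unfolding has_weak_derivative_def
proof (intro conjI allI impI)
  note cf = primitive_of_continuous[OF P]
  note ig = primitive_ofD(1)[OF P]
  show "set_integrable lborel {s..t} f" for s t
    using locally_integrableD[OF continuous_locally_integrable[OF cf]] .
  show "set_integrable lborel {s..t} g" for s t
    using locally_integrableD[OF ig] .
  fix \<phi> assume "test_function \<phi>"
  then obtain R where R: "R > 0" "\<And>x. (\<phi> has_real_derivative deriv \<phi> x) (at x)" "continuous_on UNIV (deriv \<phi>)"
    "\<And>x. x \<notin> {-R..R} \<Longrightarrow> \<phi> x = 0" "\<And>x. x \<notin> {-R..R} \<Longrightarrow> deriv \<phi> x = 0" "\<phi> R = 0" "\<phi> (-R) = 0"
    using test_functionE[of \<phi>] by metis
  have c\<phi>: "continuous_on UNIV \<phi>"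
    using DERIV_isCont[OF R(2)] by (simp add: continuous_on_eq_continuous_at)
  have P\<phi>: "primitive_of (deriv \<phi>) \<phi>"
    using R by (intro primitive_of_C1) (auto simp: has_real_derivative_iff_has_vector_derivative)
  have 1: "(\<integral>x. deriv \<phi> x *\<^sub>R f x \<partial>lborel) = (LINT x:{-R..R}|lborel. deriv \<phi> x *\<^sub>R f x)"
    unfolding set_lebesgue_integral_def
    by (rule Bochner_Integration.integral_cong) (use R(5) in \<open>auto simp: indicator_def\<close>)
  have 2: "(\<integral>x. \<phi> x *\<^sub>R g x \<partial>lborel) = (LINT x:{-R..R}|lborel. \<phi> x *\<^sub>R g x)"
    unfolding set_lebesgue_integral_def
    by (rule Bochner_Integration.integral_cong) (use R(4) in \<open>auto simp: indicator_def\<close>)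
  have i1: "set_integrable lborel {-R..R} (\<lambda>x. deriv \<phi> x *\<^sub>R f x)"
    by (intro locally_integrableD locally_integrable_scaleR_continuous continuous_locally_integrable cf R)
  have i2: "set_integrable lborel {-R..R} (\<lambda>x. \<phi> x *\<^sub>R g x)"
    by (intro locally_integrableD locally_integrable_scaleR_continuous ig c\<phi>)
  \<comment> \<open>Integration by parts was shown for scalar functions, so the vector identity is
    tested against each \<open>b\<close>.\<close>
  have "(LINT x:{-R..R}|lborel. deriv \<phi> x *\<^sub>R f x + \<phi> x *\<^sub>R g x) \<bullet> b = 0" for b
  proof -
    have "(LINT x:{-R..R}|lborel. deriv \<phi> x *\<^sub>R f x + \<phi> x *\<^sub>R g x) \<bullet> b
        = (LINT x:{-R..R}|lborel. (deriv \<phi> x *\<^sub>R f x + \<phi> x *\<^sub>R g x) \<bullet> b)"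
      using integral_inner_left[OF set_integral_add(1)[OF i1 i2, unfolded set_integrable_def], of b]
      by (simp add: set_lebesgue_integral_def)
    also have "\<dots> = (LINT x:{-R..R}|lborel. deriv \<phi> x * (f x \<bullet> b) + \<phi> x * (g x \<bullet> b))"
      by (simp add: inner_add_left)
    also have "\<dots> = 0"
      using primitive_of_by_parts[OF P\<phi> primitive_of_inner[OF P, of b], of "-R" R] R by simp
    finally show ?thesis .
  qed
  then have "(LINT x:{-R..R}|lborel. deriv \<phi> x *\<^sub>R f x + \<phi> x *\<^sub>R g x) = 0"
    using inner_eq_zero_iff by blast
  then show "(\<integral>x. deriv \<phi> x *\<^sub>R f x \<partial>lborel) = - (\<integral>x. \<phi> x *\<^sub>R g x \<partial>lborel)"
    using set_integral_add(2)[OF i1 i2] 1 2 by (simp add: eq_neg_iff_add_eq_0)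
qed

text \<open>The du Bois-Reymond lemma in contrapositive form. With \<open>c\<close> halfway between
  \<open>k s\<close> and \<open>k t\<close>, the test function has as derivative a bump at
  \<open>t\<close> minus the same bump at \<open>s\<close>. This derivative has integral
  \<open>0\<close>, so \<open>k\<close> may be replaced by \<open>k - c\<close>; then the integrand
  is nonnegative everywhere and positive at \<open>t\<close>.\<close>

lemma less_impossible_if_weak_derivative_0:
  fixes k :: "real \<Rightarrow> real"
  assumes k: "continuous_on UNIV k"
    and 0: "\<And>\<phi>. test_function \<phi> \<Longrightarrow> (\<integral>x. deriv \<phi> x * k x \<partial>lborel) = 0"
  shows "\<not> k s < k t"
proof
  assume less: "k s < k t"
  define c where "c = (k s + k t) / 2"
  have c: "k s < c" "c < k t" using less by (auto simp: c_def)
  have isc: "isCont k x" for x using k by (simp add: continuous_on_eq_continuous_at)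
  have "\<forall>\<^sub>F y in at s. k y < c" using isc[of s] c by (auto simp: isCont_def intro: order_tendstoD)
  then obtain r1 where r1: "r1 > 0" "\<And>y. \<bar>y - s\<bar> < r1 \<Longrightarrow> k y < c"
    using c by (auto simp: eventually_at dist_real_def) metis
  have "\<forall>\<^sub>F y in at t. k y > c" using isc[of t] c by (auto simp: isCont_def intro: order_tendstoD)
  then obtain r2 where r2: "r2 > 0" "\<And>y. \<bar>y - t\<bar> < r2 \<Longrightarrow> k y > c"
    using c by (auto simp: eventually_at dist_real_def) metis
  define r where "r = min r1 r2"
  have r: "r > 0" using r1 r2 by (simp add: r_def)
  have rs: "k y < c" if "\<bar>y - s\<bar> < r" for y using r1 that by (simp add: r_def)
  have rt: "k y > c" if "\<bar>y - t\<bar> < r" for y using r2 that by (simp add: r_def)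
  have st: "\<bar>t - s\<bar> \<ge> r" using rs[of t] c by force
  obtain P where P: "\<And>x. (P has_real_derivative bump x) (at x)"
    "\<And>x. x \<ge> 1 \<Longrightarrow> P x = P 1" "\<And>x. x \<le> -1 \<Longrightarrow> P x = P (-1)"
    using bump_antideriv by metis
  define \<eta> where "\<eta> z x = bump ((1 / r) * x + (- z / r))" for z x
  \<comment> \<open>The two bumps have the same mass, so this antiderivative of their difference
    vanishes outside a bounded interval.\<close>
  define \<phi> where "\<phi> x = P ((1 / r) * x + (- t / r)) - P ((1 / r) * x + (- s / r))" for x
  define \<phi>' where "\<phi>' x = (\<eta> t x - \<eta> s x) * (1 / r)" for x
  have arg: "(1 / r) * x + (- z / r) = (x - z) / r" for x z by (simp add: diff_divide_distrib)
  have \<eta>0: "\<eta> z x = 0" if "\<bar>x - z\<bar> \<ge> r" for z x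
    unfolding \<eta>_def arg using r that by (intro bump_eq_0) (simp add: pos_le_divide_eq)
  have \<eta>nn: "\<eta> z x \<ge> 0" for z x by (simp add: \<eta>_def bump_nonneg)
  have d: "(\<phi> has_real_derivative \<phi>' x) (at x)" for x
  proof -
    have "((\<lambda>x. P ((1 / r) * x + d)) has_real_derivative bump ((1 / r) * x + d) * (1 / r)) (at x)" for d
      by (rule DERIV_chain2[OF P(1)]) (use r in \<open>auto intro!: derivative_eq_intros\<close>)
    from DERIV_diff[OF this[of "- t / r"] this[of "- s / r"]] show ?thesis
      by (simp add: \<phi>_def[abs_def] \<phi>'_def \<eta>_def algebra_simps)
  qed
  have Ck': "Ck j \<phi>'" for j
    unfolding \<phi>'_def \<eta>_def by (intro Ck_mult_const Ck_diff Ck_affine Ck_bump)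
  have "Ck j \<phi>" for j using Ck_SucD'[OF Ck_SucI[OF d Ck']] .
  define lo hi where "lo = min s t - r" and "hi = max s t + r"
  have lohi: "lo < hi" "t \<in> {lo..hi}" using r by (auto simp: lo_def hi_def)
  have \<phi>0: "\<phi> x = 0" if "x \<le> lo \<or> x \<ge> hi" for x
  proof -
    have "(x - z) / r \<le> -1" if "x \<le> lo" "z \<in> {s, t}" for z
      using that r by (auto simp: lo_def field_simps)
    moreover have "(x - z) / r \<ge> 1" if "x \<ge> hi" "z \<in> {s, t}" for z
      using that r by (auto simp: hi_def field_simps)
    ultimately show ?thesis
      using that P(2)[of "(x - s) / r"] P(2)[of "(x - t) / r"] P(3)[of "(x - s) / r"] P(3)[of "(x - t) / r"]
      unfolding \<phi>_def arg by auto
  qed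
  have "{x. \<phi> x \<noteq> 0} \<subseteq> {lo..hi}" using \<phi>0 by (auto simp: not_le) (metis less_eq_real_def linorder_not_less)+
  then have "bounded {x. \<phi> x \<noteq> 0}" using bounded_closed_interval bounded_subset by metis
  then have "test_function \<phi>" using \<open>\<And>j. Ck j \<phi>\<close> by (simp add: test_function_def compact_closure)
  from 0[OF this] have "(\<integral>x. \<phi>' x * k x \<partial>lborel) = 0" using DERIV_imp_deriv[OF d] by simp
  moreover have "(\<integral>x. \<phi>' x * k x \<partial>lborel) = (LINT x:{lo..hi}|lborel. \<phi>' x * k x)"
    unfolding set_lebesgue_integral_def
  proof (rule Bochner_Integration.integral_cong)
    show "\<phi>' x * k x = indicator {lo..hi} x *\<^sub>R (\<phi>' x * k x)" for x
    proof (cases "x \<in> {lo..hi}")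
      case False
      then have "r \<le> \<bar>x - s\<bar>" "r \<le> \<bar>x - t\<bar>"
        using r unfolding lo_def hi_def atLeastAtMost_iff by linarith+
      then show ?thesis using False by (simp add: \<phi>'_def \<eta>0)
    qed simp
  qed simp
  moreover have c\<phi>': "continuous_on UNIV \<phi>'" using Ck'[of 0] by simp
  have cont: "continuous_on {lo..hi} (\<lambda>x. \<phi>' x * k x)" "continuous_on {lo..hi} (\<lambda>x. \<phi>' x * (k x - c))"
     "continuous_on {lo..hi} \<phi>'" "continuous_on {lo..hi} (\<lambda>x. \<phi>' x * c)"
    using c\<phi>' k by (auto intro!: continuous_intros intro: continuous_on_subset)
  ultimately have i0: "integral {lo..hi} (\<lambda>x. \<phi>' x * k x) = 0"
    using set_borel_integral_eq_integral(2)[OF borel_integrable_atLeastAtMost'[OF cont(1)]] by simp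
  have "(\<phi>' has_integral \<phi> hi - \<phi> lo) {lo..hi}"
    using lohi d by (intro fundamental_theorem_of_calculus)
      (auto simp: has_real_derivative_iff_has_vector_derivative[symmetric] intro: has_field_derivative_at_within)
  then have "integral {lo..hi} \<phi>' = 0" using \<phi>0 by (auto dest: integral_unique)
  then have "integral {lo..hi} (\<lambda>x. \<phi>' x * (k x - c)) = 0"
    using i0 integral_diff[OF integrable_continuous_real[OF cont(1)] integrable_continuous_real[OF cont(4)]]
    by (simp add: algebra_simps)
  moreover have "\<phi>' x * (k x - c) \<ge> 0" for x
  proof -
    consider "\<bar>x - t\<bar> < r" | "\<bar>x - s\<bar> < r" | "\<bar>x - s\<bar> \<ge> r" "\<bar>x - t\<bar> \<ge> r" by linarith
    then show ?thesis
    proof cases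
      case 1
      then have "\<eta> s x = 0" "k x - c > 0" using rt[of x] rs[of x] \<eta>0[of x s] by force+
      then show ?thesis using \<eta>nn r by (simp add: \<phi>'_def)
    next
      case 2
      then have "\<eta> t x = 0" "k x - c < 0" using rt[of x] rs[of x] \<eta>0[of x t] by force+
      then show ?thesis using \<eta>nn[of s x] r by (simp add: \<phi>'_def mult_nonneg_nonpos divide_nonpos_pos mult_nonpos_nonpos)
    qed (simp add: \<phi>'_def \<eta>0)
  qed
  ultimately have "\<phi>' t * (k t - c) = 0"
    using integral_eq_0_iff[OF cont(2) lohi(1)] lohi(2) by blast
  moreover have "\<phi>' t > 0"
    using \<eta>0[of t s] st bump_pos[of 0] r by (simp add: \<phi>'_def \<eta>_def)
  ultimately show False using c by simp
qed

lemma has_weak_derivative_integrable: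
  "has_weak_derivative f g \<Longrightarrow> locally_integrable f" "has_weak_derivative f g \<Longrightarrow> locally_integrable g"
  by (auto simp: has_weak_derivative_def locally_integrable_def)

text \<open>\<open>f\<close> and an explicit primitive \<open>G\<close> of \<open>g\<close> have the
  same weak derivative, so every component of \<open>f - G\<close> is constant. Continuity of
  \<open>f\<close> excludes changes on null sets, which weak derivatives do not see.\<close>

lemma primitive_if_has_weak_derivative:
  fixes f :: "real \<Rightarrow> 'a::euclidean_space"
  assumes w: "has_weak_derivative f g" and c: "continuous_on UNIV f"
  shows "primitive_of g f"
proof -
  note ig = has_weak_derivative_integrable(2)[OF w]
  obtain G where G: "primitive_of g G" using primitive_exists[OF ig] by blast
  note cG = primitive_of_continuous[OF G]
  define h where "h x = f x - G x" for x
  have hc: "h s = h t" for s t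
  proof -
    have lt: "\<not> h s \<bullet> b < h t \<bullet> b" for b s t
    proof (rule less_impossible_if_weak_derivative_0[of "\<lambda>x. h x \<bullet> b"])
      show "continuous_on UNIV (\<lambda>x. h x \<bullet> b)" unfolding h_def by (intro continuous_intros c cG)
      fix \<phi> assume t: "test_function \<phi>"
      then obtain R where R: "R > 0" "\<And>x. (\<phi> has_real_derivative deriv \<phi> x) (at x)" "continuous_on UNIV (deriv \<phi>)"
        "\<And>x. x \<notin> {-R..R} \<Longrightarrow> \<phi> x = 0" "\<And>x. x \<notin> {-R..R} \<Longrightarrow> deriv \<phi> x = 0" "\<phi> R = 0" "\<phi> (-R) = 0"
        using test_functionE[of \<phi>] by metis
      have int: "integrable lborel (\<lambda>x. deriv \<phi> x *\<^sub>R u x)" if "continuous_on UNIV u" for u :: "real \<Rightarrow> 'a"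
      proof -
        have "set_integrable lborel {-R..R} (\<lambda>x. deriv \<phi> x *\<^sub>R u x)"
          by (intro locally_integrableD locally_integrable_scaleR_continuous continuous_locally_integrable that R)
        moreover have "indicator {-R..R} x *\<^sub>R (deriv \<phi> x *\<^sub>R u x) = deriv \<phi> x *\<^sub>R u x" for x
          using R(5)[of x] by (auto simp: indicator_def)
        ultimately show ?thesis unfolding set_integrable_def by (simp only:)
      qed
      have "(\<integral>x. deriv \<phi> x *\<^sub>R h x \<partial>lborel) = (\<integral>x. deriv \<phi> x *\<^sub>R f x \<partial>lborel) - (\<integral>x. deriv \<phi> x *\<^sub>R G x \<partial>lborel)"
        using Bochner_Integration.integral_diff[OF int[OF c] int[OF cG]] by (simp add: h_def scaleR_diff_right)
      also have "\<dots> = 0"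
        using w has_weak_derivative_if_primitive[OF G] t by (simp add: has_weak_derivative_def)
      finally have "(\<integral>x. deriv \<phi> x *\<^sub>R h x \<partial>lborel) \<bullet> b = 0" by simp
      moreover have "continuous_on UNIV h" unfolding h_def by (intro continuous_intros c cG)
      ultimately show "(\<integral>x. deriv \<phi> x * (h x \<bullet> b) \<partial>lborel) = 0"
        using integral_inner_left[OF int[of h], of b] by simp
    qed
    then have "h s \<bullet> b = h t \<bullet> b" for b
      using lt[of s b t] lt[of t b s] by linarith
    then show ?thesis by (auto intro: euclidean_eqI)
  qed
  have "f t - f s = G t - G s" for s t
    using hc[of s t] unfolding h_def by (simp add: algebra_simps)
  then show ?thesis using G by (simp add: primitive_of_def)
qed

lemma L2_loc_locally_integrable:
  assumes "g \<in> L2_loc"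
  shows "locally_integrable g"
  unfolding locally_integrable_def
proof (intro allI)
  fix s t :: real
  have [measurable]: "g \<in> borel_measurable borel" using assms by (simp add: L2_loc_def)
  show "set_integrable lborel {s..t} g"
  proof (rule set_integrable_bound[of _ _ "\<lambda>x. 1 + (norm (g x))\<^sup>2"])
    show "set_integrable lborel {s..t} (\<lambda>x. 1 + (norm (g x))\<^sup>2)"
      using assms continuous_locally_integrable[of "\<lambda>_. 1::real"]
      by (intro set_integral_add) (auto simp: L2_loc_def locally_integrable_def)
    show "set_borel_measurable lborel {s..t} g" by (simp add: set_borel_measurable_def)
    have "norm v \<le> 1 + (norm v)\<^sup>2" for v :: 'a
      using zero_le_power2[of "norm v - 1"] zero_le_power2[of "norm v + 1"]
      unfolding power2_diff power2_sum one_power2 mult_1_right by linarith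
    then show "AE x in lborel. x \<in> {s..t} \<longrightarrow> norm (g x) \<le> norm (1 + (norm (g x))\<^sup>2)"
      by (intro AE_I2 impI) (simp add: abs_of_pos add_pos_nonneg)
  qed
qed

lemma continuous_L2_loc:
  assumes "continuous_on UNIV f"
  shows "f \<in> L2_loc"
proof -
  have "continuous_on UNIV (\<lambda>x. (norm (f x))\<^sup>2)" using assms by (intro continuous_intros)
  from continuous_locally_integrable[OF this] show ?thesis
    using borel_measurable_continuous_onI[OF assms] by (simp add: L2_loc_def locally_integrable_def)
qed

lemma H1_loc_iff: "f \<in> H1_loc \<longleftrightarrow> (\<exists>g\<in>L2_loc. primitive_of g f)"
  using has_weak_derivative_if_primitive primitive_if_has_weak_derivative continuous_L2_loc
    primitive_of_continuous by (fastforce simp: H1_loc_def)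

text \<open>The derivative picked by \<open>SOME\<close> agrees almost everywhere with any
  \<open>g\<close> at hand. This allows \<open>energy\<close> and \<open>rho_comp\<close> to be
  computed from a convenient derivative.\<close>

lemma primitive_of_weak_derivative:
  assumes "primitive_of g f"
  shows "primitive_of (weak_derivative f) f" "AE x in lborel. weak_derivative f x = g x"
proof -
  have "has_weak_derivative f (weak_derivative f)"
    unfolding weak_derivative_def
    using someI[of "has_weak_derivative f", OF has_weak_derivative_if_primitive[OF assms]] .
  then show "primitive_of (weak_derivative f) f"
    using primitive_of_continuous[OF assms] primitive_if_has_weak_derivative by blast
  then show "AE x in lborel. weak_derivative f x = g x" using assms by (rule primitive_of_unique)
qed

section \<open>Square-integrable derivatives\<close>

definition square_integrable :: "(real \<Rightarrow> 'a::euclidean_space) \<Rightarrow> bool" where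
  "square_integrable g \<longleftrightarrow> g \<in> borel_measurable borel \<and> integrable lborel (\<lambda>x. (norm (g x))\<^sup>2)"

definition sq_norm :: "(real \<Rightarrow> 'a::euclidean_space) \<Rightarrow> real" where
  "sq_norm g = (\<integral>x. (norm (g x))\<^sup>2 \<partial>lborel)"

lemma sq_norm_nonneg: "sq_norm g \<ge> 0"
  by (simp add: sq_norm_def)

lemma norm_add_square_le: "(norm (u + v))\<^sup>2 \<le> 2 * (norm u)\<^sup>2 + 2 * (norm (v::'a::real_inner))\<^sup>2"
proof -
  have "0 \<le> (norm (u - v))\<^sup>2" by simp
  then show ?thesis
    by (simp add: power2_norm_eq_inner inner_add_left inner_add_right inner_diff_left inner_diff_right inner_commute)
qed

lemma square_integrable_add:
  assumes "square_integrable g" "square_integrable h"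
  shows "square_integrable (\<lambda>x. g x + h x)"
proof -
  have [measurable]: "g \<in> borel_measurable borel" "h \<in> borel_measurable borel"
    using assms by (auto simp: square_integrable_def)
  have "integrable lborel (\<lambda>x. (norm (g x + h x))\<^sup>2)"
  proof (rule Bochner_Integration.integrable_bound)
    show "integrable lborel (\<lambda>x. 2 * (norm (g x))\<^sup>2 + 2 * (norm (h x))\<^sup>2)"
      using assms by (auto simp: square_integrable_def)
    show "AE x in lborel. norm ((norm (g x + h x))\<^sup>2) \<le> norm (2 * (norm (g x))\<^sup>2 + 2 * (norm (h x))\<^sup>2)"
      using norm_add_square_le by (intro AE_I2) (simp add: abs_of_nonneg)
  qed simp
  then show ?thesis by (simp add: square_integrable_def)
qed

lemma square_integrable_scaleR:
  assumes "square_integrable g"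
  shows "square_integrable (\<lambda>x. c *\<^sub>R g x)" "sq_norm (\<lambda>x. c *\<^sub>R g x) = c\<^sup>2 * sq_norm g"
  using assms by (auto simp: square_integrable_def sq_norm_def power_mult_distrib)

lemma square_integrable_diff:
  "square_integrable g \<Longrightarrow> square_integrable h \<Longrightarrow> square_integrable (\<lambda>x. g x - h x)"
  using square_integrable_add[of g "\<lambda>x. (-1) *\<^sub>R h x"] square_integrable_scaleR(1)[of h "-1"] by simp

text \<open>Solved for the difference because the applications control midpoints: a lower bound for
  the norm of the midpoint turns nearly equal norms into closeness.\<close>

lemma sq_norm_parallelogram:
  assumes "square_integrable g" "square_integrable h"
  shows "sq_norm (\<lambda>x. g x - h x) = 2 * sq_norm g + 2 * sq_norm h - 4 * sq_norm (\<lambda>x. (1/2) *\<^sub>R (g x + h x))"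
proof -
  have "sq_norm (\<lambda>x. g x - h x) + sq_norm (\<lambda>x. g x + h x)
      = (\<integral>x. (norm (g x - h x))\<^sup>2 + (norm (g x + h x))\<^sup>2 \<partial>lborel)"
    unfolding sq_norm_def
    using square_integrable_diff[OF assms] square_integrable_add[OF assms]
    by (intro Bochner_Integration.integral_add[symmetric]) (auto simp: square_integrable_def)
  also have "\<dots> = (\<integral>x. 2 * (norm (g x))\<^sup>2 + 2 * (norm (h x))\<^sup>2 \<partial>lborel)"
    by (rule Bochner_Integration.integral_cong)
       (simp_all add: power2_norm_eq_inner inner_add_left inner_add_right inner_diff_left inner_diff_right inner_commute)
  also have "\<dots> = 2 * sq_norm g + 2 * sq_norm h"
    using assms by (simp add: square_integrable_def sq_norm_def)
  finally show ?thesis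
    using square_integrable_scaleR(2)[OF square_integrable_add[OF assms], of "1/2"] by (simp add: power2_eq_square)
qed

lemma square_integrable_set_integrable:
  assumes "square_integrable g" "A \<in> sets borel"
  shows "set_integrable lborel A (\<lambda>x. (norm (g x))\<^sup>2)"
  using integrable_mult_indicator[of A lborel "\<lambda>x. (norm (g x))\<^sup>2"] assms
  by (simp add: square_integrable_def set_integrable_def)

lemma square_integrable_L2_loc: "square_integrable g \<Longrightarrow> g \<in> L2_loc"
  using square_integrable_set_integrable[of g] by (simp add: square_integrable_def L2_loc_def)

lemma square_integrable_locally_integrable: "square_integrable g \<Longrightarrow> locally_integrable g"
  using square_integrable_L2_loc L2_loc_locally_integrable by blast

lemma L2_loc_square: "g \<in> L2_loc \<Longrightarrow> set_integrable lborel {s..t} (\<lambda>x. (norm (g x))\<^sup>2)"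
  by (auto simp: L2_loc_def)

lemma set_integral_square_le_sq_norm:
  assumes "square_integrable g" "A \<in> sets borel"
  shows "(LINT x:A|lborel. (norm (g x))\<^sup>2) \<le> sq_norm g"
  unfolding sq_norm_def set_lebesgue_integral_def
  using assms square_integrable_set_integrable[OF assms, unfolded set_integrable_def]
  by (intro integral_mono) (auto simp: square_integrable_def indicator_def)

text \<open>Cauchy-Schwarz, from the nonnegativity of the integral of
  \<open>(norm (g x) - c)\<^sup>2\<close> for the mean value \<open>c\<close> of
  \<open>norm (g x)\<close> on the interval. The degenerate interval is split off because the mean
  divides by its length.\<close>

lemma norm_set_integral_square_le:
  fixes g :: "real \<Rightarrow> 'a::euclidean_space"
  assumes g: "g \<in> L2_loc" and st: "s \<le> t"
  shows "(norm (LINT x:{s..t}|lborel. g x))\<^sup>2 \<le> (t - s) * (LINT x:{s..t}|lborel. (norm (g x))\<^sup>2)"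
proof (cases "s = t")
  case True
  then have "(LINT x:{s..t}|lborel. g x) = 0"
    using set_integral_Icc_combine[OF L2_loc_locally_integrable[OF g], of s s s] by simp
  then show ?thesis using True by simp
next
  case False
  with st have lt: "s < t" by simp
  have ig: "set_integrable lborel {s..t} g" using locally_integrableD[OF L2_loc_locally_integrable[OF g]] .
  then have ng: "set_integrable lborel {s..t} (\<lambda>x. norm (g x))"
    using integrable_norm[OF ig[unfolded set_integrable_def]] by (simp add: set_integrable_def)
  define I where "I = (LINT x:{s..t}|lborel. norm (g x))"
  define c where "c = I / (t - s)"
  have cc: "(LINT x:{s..t}|lborel. c\<^sup>2) = c\<^sup>2 * (t - s)"
    using lt by (simp add: set_lebesgue_integral_def)
  have "0 \<le> (LINT x:{s..t}|lborel. (norm (g x) - c)\<^sup>2)"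
    by (simp add: set_lebesgue_integral_def)
  also have "\<dots> = (LINT x:{s..t}|lborel. (norm (g x))\<^sup>2 - 2 * c * norm (g x) + c\<^sup>2)"
    by (simp add: power2_diff algebra_simps)
  also have "\<dots> = (LINT x:{s..t}|lborel. (norm (g x))\<^sup>2) - 2 * c * I + c\<^sup>2 * (t - s)"
  proof -
    have 1: "set_integrable lborel {s..t} (\<lambda>x. 2 * c * norm (g x))" "set_integrable lborel {s..t} (\<lambda>x. c\<^sup>2)"
      using ng continuous_locally_integrable[of "\<lambda>_. c\<^sup>2"] by (auto simp: locally_integrable_def)
    have 2: "(LINT x:{s..t}|lborel. 2 * c * norm (g x)) = 2 * c * I"
      unfolding I_def by (rule set_integral_mult_right)
    show ?thesis
      using set_integral_add(2)[OF set_integral_diff(1)[OF L2_loc_square[OF g] 1(1)] 1(2)]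
        set_integral_diff(2)[OF L2_loc_square[OF g] 1(1)] 2 cc by simp
  qed
  finally have "0 \<le> (LINT x:{s..t}|lborel. (norm (g x))\<^sup>2) - 2 * c * I + c * (c * (t - s))"
    by (simp add: power2_eq_square algebra_simps)
  moreover have ct: "c * (t - s) = I" using lt by (simp add: c_def)
  ultimately have "c * I \<le> (LINT x:{s..t}|lborel. (norm (g x))\<^sup>2)" by (simp add: mult.commute)
  then have "(t - s) * (c * I) \<le> (t - s) * (LINT x:{s..t}|lborel. (norm (g x))\<^sup>2)"
    using lt by (intro mult_left_mono) auto
  moreover have "(t - s) * (c * I) = I\<^sup>2" using ct by (metis mult.assoc mult.commute power2_eq_square)
  ultimately have "I\<^sup>2 \<le> (t - s) * (LINT x:{s..t}|lborel. (norm (g x))\<^sup>2)" by simp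
  moreover have "norm (LINT x:{s..t}|lborel. g x) \<le> I"
    using integral_norm_bound[of lborel "\<lambda>x. indicator {s..t} x *\<^sub>R g x"]
    by (simp add: I_def set_lebesgue_integral_def)
  ultimately show ?thesis
    by (meson norm_ge_zero order_trans power_mono)
qed

lemma primitive_of_Hoelder:
  assumes "primitive_of g f" "g \<in> L2_loc" "s \<le> t"
  shows "(norm (f t - f s))\<^sup>2 \<le> (t - s) * (LINT x:{s..t}|lborel. (norm (g x))\<^sup>2)"
  using norm_set_integral_square_le[OF assms(2,3)] primitive_ofD(2)[OF assms(1,3)] by simp

section \<open>Fatou's lemma, completeness of L^2 and lower semicontinuity of the norm\<close>

lemma integral_le_if_tendsto:
  fixes u :: "nat \<Rightarrow> 'b \<Rightarrow> real"
  assumes int: "\<And>n. integrable M (u n)" and nn: "\<And>n x. u n x \<ge> 0" and le: "\<And>n. integral\<^sup>L M (u n) \<le> K"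
    and meas: "v \<in> borel_measurable M" and lim: "AE x in M. (\<lambda>n. u n x) \<longlonglongrightarrow> v x"
  shows "integrable M v" "integral\<^sup>L M v \<le> K"
proof -
  have K: "K \<ge> 0" using le[of 0] Bochner_Integration.integral_nonneg[of M "u 0"] nn by (meson order_trans)
  have vnn: "AE x in M. 0 \<le> v x"
    using lim by eventually_elim (auto intro: LIMSEQ_le_const nn)
  have "(\<integral>\<^sup>+x. ennreal (v x) \<partial>M) = (\<integral>\<^sup>+x. liminf (\<lambda>n. ennreal (u n x)) \<partial>M)"
    by (rule nn_integral_cong_AE, use lim in eventually_elim)
       (auto intro!: lim_imp_Liminf[symmetric] tendsto_ennrealI)
  also have "\<dots> \<le> liminf (\<lambda>n. \<integral>\<^sup>+x. ennreal (u n x) \<partial>M)"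
    using int by (intro nn_integral_liminf) (auto dest: borel_measurable_integrable)
  also have "\<dots> \<le> ennreal K"
    using nn_integral_eq_integral[OF int] nn le
    by (intro Liminf_le) (auto intro!: always_eventually simp: ennreal_leI)
  finally have *: "(\<integral>\<^sup>+x. ennreal (v x) \<partial>M) \<le> ennreal K" .
  show i: "integrable M v"
    by (rule integrableI_nonneg[OF meas vnn]) (use * in \<open>simp add: order.strict_trans1[OF _ ennreal_less_top]\<close>)
  show "integral\<^sup>L M v \<le> K"
    using * nn_integral_eq_integral[OF i vnn] K by (simp add: ennreal_le_iff)
qed

lemma square_integrable_complete:
  fixes G :: "nat \<Rightarrow> real \<Rightarrow> 'a::euclidean_space"
  assumes G: "\<And>n. square_integrable (G n)"
    and Cauchy: "\<And>e. e > 0 \<Longrightarrow> \<exists>N. \<forall>i\<ge>N. \<forall>j\<ge>N. sq_norm (\<lambda>x. G i x - G j x) < e"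
  obtains g r where "square_integrable g" "(\<lambda>n. sq_norm (\<lambda>x. G n x - g x)) \<longlonglongrightarrow> 0"
    "strict_mono (r :: nat \<Rightarrow> nat)" "AE x in lborel. (\<lambda>i. G (r i) x) \<longlonglongrightarrow> g x"
proof -
  \<comment> \<open>The weight \<open>w \<in> L^2\<close> turns square-integrable functions into integrable ones.\<close>
  define w where "w x = sqrt (std_normal_density x)" for x
  have w: "w x > 0" "(w x)\<^sup>2 = std_normal_density x" for x
    using normal_density_pos[of 1 0 x] by (auto simp: w_def)
  have [measurable]: "G n \<in> borel_measurable borel" for n using G by (simp add: square_integrable_def)
  have [measurable]: "w \<in> borel_measurable borel" unfolding w_def by measurable
  \<comment> \<open>Young's inequality with a free parameter \<open>e\<close>. Since
    \<open>w\<close> has L^2 norm \<open>1\<close>, the weighted L^1 norm of \<open>h\<close> is at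
    most \<open>(e + sq_norm h / e) / 2\<close>, which is below \<open>e\<close> as soon as
    \<open>sq_norm h\<close> is below \<open>e\<^sup>2\<close>.\<close>
  have young: "w x * norm v \<le> (e * (w x)\<^sup>2 + (norm v)\<^sup>2 / e) / 2" if "e > 0" for e x and v :: 'a
  proof -
    have "0 \<le> (e * w x - norm v)\<^sup>2 / e" using that by simp
    also have "\<dots> = e * (w x)\<^sup>2 + (norm v)\<^sup>2 / e - 2 * (w x * norm v)"
      using that by (simp add: power2_diff field_simps power2_eq_square)
    finally show ?thesis by simp
  qed
  have yint: "integrable lborel (\<lambda>x. (e * (w x)\<^sup>2 + (norm (h x))\<^sup>2 / e) / 2)"
    and yeq: "(\<integral>x. (e * (w x)\<^sup>2 + (norm (h x))\<^sup>2 / e) / 2 \<partial>lborel) = (e + sq_norm h / e) / 2"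
    if "square_integrable h" for e and h :: "real \<Rightarrow> 'a"
    using that unfolding w(2) by (auto simp: square_integrable_def sq_norm_def)
  have wint: "integrable lborel (\<lambda>x. w x *\<^sub>R h x)" if h: "square_integrable h" for h :: "real \<Rightarrow> 'a"
  proof (rule Bochner_Integration.integrable_bound[OF yint[OF h, of 1]])
    have [measurable]: "h \<in> borel_measurable borel" using h by (simp add: square_integrable_def)
    show "(\<lambda>x. w x *\<^sub>R h x) \<in> borel_measurable lborel" by simp
    show "AE x in lborel. norm (w x *\<^sub>R h x) \<le> norm ((1 * (w x)\<^sup>2 + (norm (h x))\<^sup>2 / 1) / 2)"
      using young[of 1] w by (intro AE_I2) (simp add: abs_of_pos abs_of_nonneg less_imp_le)
  qed
  have L1: "(\<integral>x. norm (w x *\<^sub>R h x) \<partial>lborel) \<le> (e + sq_norm h / e) / 2"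
    if "square_integrable h" "e > 0" for e and h :: "real \<Rightarrow> 'a"
    unfolding yeq[OF that(1), symmetric]
    using young[OF that(2)] w that yint
    by (intro integral_mono wint[THEN integrable_norm]) (auto simp: abs_of_pos less_imp_le)
  obtain r where r: "strict_mono r" "AE x in lborel. Cauchy (\<lambda>i. w x *\<^sub>R G (r i) x)"
  proof (rule cauchy_L1_AE_cauchy_subseq[of lborel "\<lambda>i x. w x *\<^sub>R G i x"])
    show "integrable lborel (\<lambda>x. w x *\<^sub>R G n x)" for n using G by (rule wint)
    fix e :: real assume e: "e > 0"
    then obtain N where N: "\<forall>i\<ge>N. \<forall>j\<ge>N. sq_norm (\<lambda>x. G i x - G j x) < e\<^sup>2"
      using Cauchy[of "e\<^sup>2"] by auto
    have "(\<integral>x. norm (w x *\<^sub>R G i x - w x *\<^sub>R G j x) \<partial>lborel) < e" if "i \<ge> N" "j \<ge> N" for i j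
    proof -
      have "(\<integral>x. norm (w x *\<^sub>R G i x - w x *\<^sub>R G j x) \<partial>lborel) \<le> (e + sq_norm (\<lambda>x. G i x - G j x) / e) / 2"
        using L1[OF square_integrable_diff[OF G G] e, of i j] by (simp add: scaleR_diff_right)
      also have "\<dots> < e" using N that e by (simp add: field_simps power2_eq_square)
      finally show ?thesis .
    qed
    then show "\<exists>N. \<forall>i\<ge>N. \<forall>j\<ge>N. (\<integral>x. norm (w x *\<^sub>R G i x - w x *\<^sub>R G j x) \<partial>lborel) < e" by blast
  qed
  define g where "g x = lim (\<lambda>i. G (r i) x)" for x
  have [measurable]: "g \<in> borel_measurable borel"
    unfolding g_def by (intro borel_measurable_lim_metric) simp
  have AEg: "AE x in lborel. (\<lambda>i. G (r i) x) \<longlonglongrightarrow> g x"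
    using r(2)
  proof eventually_elim
    case (elim x)
    then obtain l where "(\<lambda>i. w x *\<^sub>R G (r i) x) \<longlonglongrightarrow> l" using Cauchy_convergent convergentD by blast
    then have "(\<lambda>i. inverse (w x) *\<^sub>R (w x *\<^sub>R G (r i) x)) \<longlonglongrightarrow> inverse (w x) *\<^sub>R l"
      by (intro tendsto_intros)
    then have "(\<lambda>i. G (r i) x) \<longlonglongrightarrow> inverse (w x) *\<^sub>R l" using w(1)[of x] by simp
    then show ?case by (simp add: g_def limI)
  qed
  \<comment> \<open>The almost everywhere convergent subsequence only identifies the limit; Fatou
    along it bounds the distance of every late \<open>G n\<close> to \<open>g\<close>. The shift by
    \<open>N\<close> keeps the indices \<open>r (i + N)\<close> above \<open>N\<close>.\<close>
  have diff: "integrable lborel (\<lambda>x. (norm (G n x - g x))\<^sup>2)" "sq_norm (\<lambda>x. G n x - g x) \<le> e"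
    if N: "\<forall>i\<ge>N. \<forall>j\<ge>N. sq_norm (\<lambda>x. G i x - G j x) < e" and n: "n \<ge> N" for n e N
  proof -
    have le: "sq_norm (\<lambda>x. G n x - G (r (i + N)) x) \<le> e" for i
      using N n seq_suble[OF r(1), of "i + N"] by (simp add: less_imp_le)
    have lim: "AE x in lborel. (\<lambda>i. (norm (G n x - G (r (i + N)) x))\<^sup>2) \<longlonglongrightarrow> (norm (G n x - g x))\<^sup>2"
      using AEg by eventually_elim (intro tendsto_intros LIMSEQ_ignore_initial_segment)
    have int: "integrable lborel (\<lambda>x. (norm (G n x - G (r (i + N)) x))\<^sup>2)" for i
      using square_integrable_diff[OF G G] by (simp add: square_integrable_def)
    note * = integral_le_if_tendsto[OF int _ le[unfolded sq_norm_def] _ lim]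
    show "integrable lborel (\<lambda>x. (norm (G n x - g x))\<^sup>2)" by (rule *(1)) auto
    show "sq_norm (\<lambda>x. G n x - g x) \<le> e" unfolding sq_norm_def by (rule *(2)) auto
  qed
  obtain N1 where N1: "\<forall>i\<ge>N1. \<forall>j\<ge>N1. sq_norm (\<lambda>x. G i x - G j x) < 1" using Cauchy[of 1] by auto
  have "square_integrable (\<lambda>x. G N1 x - g x)"
    using diff(1)[OF N1, of N1] by (simp add: square_integrable_def)
  then have sg: "square_integrable g"
    using square_integrable_diff[OF G[of N1], of "\<lambda>x. G N1 x - g x"] by simp
  have "(\<lambda>n. sq_norm (\<lambda>x. G n x - g x)) \<longlonglongrightarrow> 0"
  proof (rule LIMSEQ_I)
    fix e :: real assume "e > 0"
    then obtain N where N: "\<forall>i\<ge>N. \<forall>j\<ge>N. sq_norm (\<lambda>x. G i x - G j x) < e / 2" using Cauchy[of "e / 2"] by auto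
    have "norm (sq_norm (\<lambda>x. G n x - g x) - 0) < e" if "n \<ge> N" for n
      using diff(2)[OF N that] sq_norm_nonneg[of "\<lambda>x. G n x - g x"] \<open>e > 0\<close> by simp
    then show "\<exists>N. \<forall>n\<ge>N. norm (sq_norm (\<lambda>x. G n x - g x) - 0) < e" by blast
  qed
  then show ?thesis using that sg r(1) AEg by blast
qed

lemma primitive_of_add:
  assumes "primitive_of g f" "primitive_of h k"
  shows "primitive_of (\<lambda>x. g x + h x) (\<lambda>x. f x + k x)"
  unfolding primitive_of_def locally_integrable_def
proof (intro conjI allI impI)
  note i = locally_integrableD[OF primitive_ofD(1)[OF assms(1)]] locally_integrableD[OF primitive_ofD(1)[OF assms(2)]]
  show "set_integrable lborel {s..t} (\<lambda>x. g x + h x)" for s t using i by (intro set_integral_add)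
  show "f t + k t - (f s + k s) = (LINT x:{s..t}|lborel. g x + h x)" if "s \<le> t" for s t
    using set_integral_add(2)[OF i, of s t] primitive_ofD(2)[OF assms(1) that] primitive_ofD(2)[OF assms(2) that]
    by (simp add: algebra_simps)
qed

lemma primitive_of_bounded_linear:
  assumes "primitive_of g f" "bounded_linear T"
  shows "primitive_of (\<lambda>x. T (g x)) (\<lambda>x. T (f x))"
  unfolding primitive_of_def locally_integrable_def
proof (intro conjI allI impI)
  interpret T: bounded_linear T by fact
  have i: "integrable lborel (\<lambda>x. indicator {s..t} x *\<^sub>R g x)" for s t
    using locally_integrableD[OF primitive_ofD(1)[OF assms(1)]] by (simp add: set_integrable_def)
  show "set_integrable lborel {s..t} (\<lambda>x. T (g x))" for s t
    using integrable_bounded_linear[OF assms(2) i, of s t] by (simp add: set_integrable_def T.scaleR)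
  show "T (f t) - T (f s) = (LINT x:{s..t}|lborel. T (g x))" if "s \<le> t" for s t
    using integral_bounded_linear[OF assms(2) i, of s t] primitive_ofD(2)[OF assms(1) that]
    by (simp add: set_lebesgue_integral_def T.scaleR T.diff[symmetric])
qed

lemma primitive_of_scaleR:
  "primitive_of g f \<Longrightarrow> primitive_of (\<lambda>x. c *\<^sub>R g x) (\<lambda>x. c *\<^sub>R f x)"
  by (rule primitive_of_bounded_linear) (auto intro: bounded_linear_scaleR_right)

lemma primitive_of_const: "primitive_of (\<lambda>_. 0) (\<lambda>_. c)"
  by (simp add: primitive_of_def locally_integrable_def set_integrable_def set_lebesgue_integral_def)

lemma square_integrable_linear:
  fixes T :: "'a::euclidean_space \<Rightarrow> 'b::euclidean_space"
  assumes g: "square_integrable g" and T: "bounded_linear T" "\<And>z. norm (T z) \<le> norm z"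
  shows "square_integrable (\<lambda>x. T (g x))"
  unfolding square_integrable_def
proof (intro conjI)
  have [measurable]: "T \<in> borel_measurable borel"
    using linear_continuous_on[OF T(1)] by (rule borel_measurable_continuous_onI)
  have [measurable]: "g \<in> borel_measurable borel" using g by (simp add: square_integrable_def)
  show "(\<lambda>x. T (g x)) \<in> borel_measurable borel" by measurable
  show "integrable lborel (\<lambda>x. (norm (T (g x)))\<^sup>2)"
  proof (rule Bochner_Integration.integrable_bound)
    show "integrable lborel (\<lambda>x. (norm (g x))\<^sup>2)" using g by (simp add: square_integrable_def)
    show "AE x in lborel. norm ((norm (T (g x)))\<^sup>2) \<le> norm ((norm (g x))\<^sup>2)"
      using T(2) by (intro AE_I2) (simp add: power_mono)
  qed measurable
qed

lemma uniform_limit_subseq: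
  "uniform_limit S F f sequentially \<Longrightarrow> strict_mono r \<Longrightarrow> uniform_limit S (\<lambda>n. F (r n)) f sequentially"
  unfolding uniform_limit_iff using eventually_subseq by blast

text \<open>This plays the role of weak compactness of balls in L^2 together with lower
  semicontinuity of the norm: \<open>f\<close> is only known as a locally uniform limit, and its
  derivative has to be produced.\<close>

lemma weak_lower_semicontinuity:
  fixes f :: "real \<Rightarrow> 'a::euclidean_space"
  assumes P: "\<And>n. primitive_of (g n) (F n)" and S: "\<And>n. square_integrable (g n)"
    and K: "\<And>n. sq_norm (g n) \<le> K"
    and u: "\<And>R. uniform_limit {-R..R} F f sequentially"
  obtains h where "primitive_of h f" "square_integrable h" "sq_norm h \<le> K"
proof -
  \<comment> \<open>The sets \<open>C N\<close> of approximate derivatives of \<open>f\<close> are convex and decreasing, so their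
    almost-minimal elements form a Cauchy sequence by the parallelogram law.\<close>
  define C where "C N = {G. square_integrable G \<and>
    (\<forall>s t. - real N \<le> s \<and> s \<le> t \<and> t \<le> real N \<longrightarrow>
      norm ((LINT x:{s..t}|lborel. G x) - (f t - f s)) \<le> 1 / real (Suc N))}" for N
  have ne: "\<exists>G\<in>C N. sq_norm G \<le> K" for N
  proof -
    have "\<forall>\<^sub>F n in sequentially. \<forall>x\<in>{-real N..real N}. dist (F n x) (f x) < 1 / real (Suc N) / 2"
      by (rule uniform_limitD[OF u]) simp
    then obtain n where n: "\<And>x. x\<in>{-real N..real N} \<Longrightarrow> norm (F n x - f x) < 1 / real (Suc N) / 2"
      using eventually_happens'[OF sequentially_bot] unfolding dist_norm by blast
    have "norm ((LINT x:{s..t}|lborel. g n x) - (f t - f s)) \<le> 1 / real (Suc N)"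
      if "- real N \<le> s \<and> s \<le> t \<and> t \<le> real N" for s t
    proof -
      have "(LINT x:{s..t}|lborel. g n x) - (f t - f s) = (F n t - f t) - (F n s - f s)"
        using primitive_ofD(2)[OF P[of n], of s t] that by (simp add: algebra_simps)
      also have "norm \<dots> \<le> norm (F n t - f t) + norm (F n s - f s)" by (rule norm_triangle_ineq4)
      also have "\<dots> \<le> 1 / real (Suc N)"
      proof -
        have "s \<in> {- real N..real N}" "t \<in> {- real N..real N}" using that by auto
        from n[OF this(1)] n[OF this(2)] show ?thesis by linarith
      qed
      finally show ?thesis .
    qed
    then have "g n \<in> C N" using S by (simp add: C_def)
    then show ?thesis using K by blast
  qed
  have sub: "C M \<subseteq> C N" if "N \<le> M" for N M
  proof -
    have "1 / real (Suc M) \<le> 1 / real (Suc N)" using that by (simp add: frac_le)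
    moreover have "real N \<le> real M" using that by simp
    ultimately show ?thesis unfolding C_def by (smt (verit) mem_Collect_eq subsetI)
  qed
  have conv: "(\<lambda>x. (1/2) *\<^sub>R (G x + H x)) \<in> C N" if G: "G \<in> C N" and H: "H \<in> C N" for G H N
  proof -
    have sG: "square_integrable G" and sH: "square_integrable H" using G H by (auto simp: C_def)
    note iG = locally_integrableD[OF square_integrable_locally_integrable[OF sG]]
      and iH = locally_integrableD[OF square_integrable_locally_integrable[OF sH]]
    have "norm ((LINT x:{s..t}|lborel. (1/2) *\<^sub>R (G x + H x)) - (f t - f s)) \<le> 1 / real (Suc N)"
      if st: "- real N \<le> s \<and> s \<le> t \<and> t \<le> real N" for s t
    proof -
      have "(LINT x:{s..t}|lborel. (1/2) *\<^sub>R (G x + H x)) - (f t - f s)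
        = (1/2) *\<^sub>R (((LINT x:{s..t}|lborel. G x) - (f t - f s)) + ((LINT x:{s..t}|lborel. H x) - (f t - f s)))"
        using set_integral_add(2)[OF iG iH, of s t]
        by (simp add: scaleR_add_right[symmetric] del: scaleR_add_right) (simp add: algebra_simps scaleR_left_distrib[symmetric])
      also have "norm \<dots> \<le> (1/2) * (norm ((LINT x:{s..t}|lborel. G x) - (f t - f s)) + norm ((LINT x:{s..t}|lborel. H x) - (f t - f s)))"
        by (simp add: norm_triangle_ineq)
      also have "\<dots> \<le> 1 / real (Suc N)"
      proof -
        have "norm ((LINT x:{s..t}|lborel. G x) - (f t - f s)) \<le> 1 / real (Suc N)"
          "norm ((LINT x:{s..t}|lborel. H x) - (f t - f s)) \<le> 1 / real (Suc N)"
          using G H st unfolding C_def by auto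
        moreover have "(1/2) * (p + q) \<le> c" if "p \<le> c" "q \<le> c" for p q c :: real
          using that by simp
        ultimately show ?thesis by blast
      qed
      finally show ?thesis .
    qed
    then show ?thesis using square_integrable_scaleR(1)[OF square_integrable_add[OF sG sH]] by (simp add: C_def)
  qed
  \<comment> \<open>The sets shrink as \<open>N\<close> grows, so \<open>d\<close> is increasing,
    and it stays below \<open>K\<close> because every \<open>C N\<close> contains some
    \<open>g n\<close>. Hence \<open>d\<close> converges.\<close>
  define d where "d N = (INF G\<in>C N. sq_norm G)" for N
  have bdd: "bdd_below (sq_norm ` C N)" for N by (rule bdd_belowI[of _ 0]) (auto simp: sq_norm_nonneg)
  have dle: "d N \<le> sq_norm G" if "G \<in> C N" for N G unfolding d_def using that bdd by (rule cINF_lower[rotated])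
  have dK: "d N \<le> K" for N using ne[of N] dle by (meson order_trans)
  have dmono: "d N \<le> d M" if "N \<le> M" for N M
    unfolding d_def using ne[of M] sub[OF that] bdd by (intro cINF_superset_mono) auto
  have "\<exists>G\<in>C N. sq_norm G < d N + 1 / real (Suc N)" for N
    using cINF_less_iff[of "C N" sq_norm "d N + 1 / real (Suc N)"] ne[of N] bdd[of N] unfolding d_def by auto
  then obtain G where G: "\<And>N. G N \<in> C N" "\<And>N. sq_norm (G N) < d N + 1 / real (Suc N)" by metis
  have sG: "square_integrable (G N)" for N using G(1)[of N] by (simp add: C_def)
  have "d N \<ge> 0" for N unfolding d_def using ne[of N] sq_norm_nonneg by (intro cINF_greatest) auto
  then have "Bseq d" using dK by (intro BseqI'[of _ K]) (simp add: abs_of_nonneg)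
  then have "convergent d" using dmono by (intro Bseq_mono_convergent) blast+
  then have "Cauchy d" by (simp add: Cauchy_convergent_iff)
  \<comment> \<open>For \<open>i \<le> j\<close> the midpoint lies in \<open>C i\<close>, so its
    squared norm is at least \<open>d i\<close>; the parallelogram law leaves only
    \<open>d j - d i\<close> and the slack in the choice of \<open>G i\<close> and
    \<open>G j\<close>.\<close>
  have close: "sq_norm (\<lambda>x. G i x - G j x) \<le> 2 * \<bar>d i - d j\<bar> + 4 / real (Suc N)" if "N \<le> i" "i \<le> j" for i j N
  proof -
    have "d i \<le> sq_norm (\<lambda>x. (1/2) *\<^sub>R (G i x + G j x))"
      using G(1)[of i] G(1)[of j] sub[OF that(2)] by (intro dle conv) auto
    moreover have "1 / real (Suc i) \<le> 1 / real (Suc N)" "1 / real (Suc j) \<le> 1 / real (Suc N)" using that by (auto simp: frac_le)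
    ultimately show ?thesis
      using sq_norm_parallelogram[OF sG[of i] sG[of j]] G(2)[of i] G(2)[of j] dmono[OF that(2)] by simp
  qed
  obtain h r where h: "square_integrable h" "(\<lambda>n. sq_norm (\<lambda>x. G n x - h x)) \<longlonglongrightarrow> 0"
    "strict_mono (r :: nat \<Rightarrow> nat)" "AE x in lborel. (\<lambda>i. G (r i) x) \<longlonglongrightarrow> h x"
  proof (rule square_integrable_complete[OF sG])
    fix e :: real assume e: "e > 0"
    obtain N1 where N1: "\<And>i j. i \<ge> N1 \<Longrightarrow> j \<ge> N1 \<Longrightarrow> \<bar>d i - d j\<bar> < e / 4"
      using \<open>Cauchy d\<close> e unfolding Cauchy_def dist_real_def by (metis divide_pos_pos zero_less_numeral)
    obtain N2 :: nat where N2: "8 / e < real N2" using reals_Archimedean2 by blast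
    define N where "N = max N1 N2"
    have "8 / e < real (Suc N)" using N2 by (simp add: N_def)
    then have N: "4 / real (Suc N) < e / 2" using e by (simp add: field_simps)
    have le: "sq_norm (\<lambda>x. G i x - G j x) < e" if "i \<ge> N" "i \<le> j" for i j
      using close[OF that] N1[of i j] that N by (simp add: N_def)
    have sym: "sq_norm (\<lambda>x. G i x - G j x) = sq_norm (\<lambda>x. G j x - G i x)" for i j
      by (simp add: sq_norm_def norm_minus_commute)
    have "sq_norm (\<lambda>x. G i x - G j x) < e" if "i \<ge> N" "j \<ge> N" for i j
      using le[of i j] le[of j i] sym[of i j] that by (cases "i \<le> j") auto
    then show "\<exists>N. \<forall>i\<ge>N. \<forall>j\<ge>N. sq_norm (\<lambda>x. G i x - G j x) < e" by blast
  qed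
  have "sq_norm h \<le> K"
  proof (rule field_le_epsilon)
    fix e :: real assume e: "e > 0"
    obtain I :: nat where I: "1 / e < real I" using reals_Archimedean2 by blast
    have "sq_norm (G (r (i + I))) \<le> K + e" for i
    proof -
      have "1 / e < real (Suc (r (i + I)))"
        using I seq_suble[OF h(3), of "i + I"] by (smt (verit) le_add2 of_nat_mono of_nat_Suc order_trans)
      then have "1 / real (Suc (r (i + I))) < e" using e by (simp add: field_simps)
      then show ?thesis using G(2)[of "r (i + I)"] dK[of "r (i + I)"] by linarith
    qed
    note le = this
    have lim: "AE x in lborel. (\<lambda>i. (norm (G (r (i + I)) x))\<^sup>2) \<longlonglongrightarrow> (norm (h x))\<^sup>2"
      using h(4) by eventually_elim (intro tendsto_intros LIMSEQ_ignore_initial_segment)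
    have int: "integrable lborel (\<lambda>x. (norm (G (r (i + I)) x))\<^sup>2)" for i
      using sG by (simp add: square_integrable_def)
    have "(\<lambda>x. (norm (h x))\<^sup>2) \<in> borel_measurable lborel"
      using h(1) borel_measurable_integrable unfolding square_integrable_def by blast
    then show "sq_norm h \<le> K + e"
      unfolding sq_norm_def
      by (rule integral_le_if_tendsto(2)[OF int zero_le_power2 le[unfolded sq_norm_def] _ lim])
  qed
  moreover have "primitive_of h f"
    unfolding primitive_of_def
  proof (intro conjI allI impI)
    show "locally_integrable h" using h(1) by (rule square_integrable_locally_integrable)
    fix s t :: real assume st: "s \<le> t"
    note ih = locally_integrableD[OF square_integrable_locally_integrable[OF h(1)]]
      and iG = locally_integrableD[OF square_integrable_locally_integrable[OF sG]]
    have 1: "(\<lambda>n. (LINT x:{s..t}|lborel. G n x) - (LINT x:{s..t}|lborel. h x)) \<longlonglongrightarrow> 0"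
    proof (rule Lim_null_comparison)
      show "(\<lambda>n. sqrt ((t - s) * sq_norm (\<lambda>x. G n x - h x))) \<longlonglongrightarrow> 0"
        using tendsto_real_sqrt[OF tendsto_mult_right_zero[OF h(2), of "t - s"]] by simp
      have "norm ((LINT x:{s..t}|lborel. G n x) - (LINT x:{s..t}|lborel. h x)) \<le> sqrt ((t - s) * sq_norm (\<lambda>x. G n x - h x))" for n
      proof (rule real_le_rsqrt)
        have sd: "square_integrable (\<lambda>x. G n x - h x)" using sG h(1) by (rule square_integrable_diff)
        have "(norm (LINT x:{s..t}|lborel. G n x - h x))\<^sup>2 \<le> (t - s) * (LINT x:{s..t}|lborel. (norm (G n x - h x))\<^sup>2)"
          by (intro norm_set_integral_square_le square_integrable_L2_loc sd st)
        also have "\<dots> \<le> (t - s) * sq_norm (\<lambda>x. G n x - h x)"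
          using st by (intro mult_left_mono set_integral_square_le_sq_norm sd) auto
        finally show "(norm ((LINT x:{s..t}|lborel. G n x) - (LINT x:{s..t}|lborel. h x)))\<^sup>2 \<le> (t - s) * sq_norm (\<lambda>x. G n x - h x)"
          using set_integral_diff(2)[OF iG ih] by simp
      qed
      then show "\<forall>\<^sub>F n in sequentially. norm ((LINT x:{s..t}|lborel. G n x) - (LINT x:{s..t}|lborel. h x))
          \<le> sqrt ((t - s) * sq_norm (\<lambda>x. G n x - h x))" by (simp add: always_eventually)
    qed
    obtain N0 :: nat where N0: "\<bar>s\<bar> + \<bar>t\<bar> \<le> real N0" using real_arch_simple by blast
    have 2: "(\<lambda>n. (LINT x:{s..t}|lborel. G n x) - (f t - f s)) \<longlonglongrightarrow> 0"
    proof (rule Lim_null_comparison)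
      show "(\<lambda>n. 1 / real (Suc n)) \<longlonglongrightarrow> 0" using LIMSEQ_inverse_real_of_nat by (simp add: inverse_eq_divide)
      show "\<forall>\<^sub>F n in sequentially. norm ((LINT x:{s..t}|lborel. G n x) - (f t - f s)) \<le> 1 / real (Suc n)"
      proof (rule eventually_sequentiallyI)
        fix n assume "N0 \<le> n"
        then have "real N0 \<le> real n" by simp
        with N0 st have "- real n \<le> s \<and> s \<le> t \<and> t \<le> real n" by linarith
        then show "norm ((LINT x:{s..t}|lborel. G n x) - (f t - f s)) \<le> 1 / real (Suc n)"
          using G(1)[of n] unfolding C_def by blast
      qed
    qed
    show "f t - f s = (LINT x:{s..t}|lborel. h x)"
      by (rule LIMSEQ_unique[OF LIM_zero_cancel[OF 2] LIM_zero_cancel[OF 1]])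
  qed
  ultimately show ?thesis using that h(1) by blast
qed

lemma sq_norm_cong_AE:
  "AE x in lborel. g x = h x \<Longrightarrow> g \<in> borel_measurable borel \<Longrightarrow> h \<in> borel_measurable borel \<Longrightarrow> sq_norm g = sq_norm h"
  unfolding sq_norm_def by (rule integral_cong_AE) auto

text \<open>Otherwise a subsequence has squared norms at most \<open>sq_norm h - e\<close>, and
  \<open>weak_lower_semicontinuity\<close> yields a derivative of \<open>f\<close> with smaller norm
  than \<open>h\<close>, although derivatives are unique almost everywhere.\<close>

lemma sq_norm_liminf:
  fixes f :: "real \<Rightarrow> 'a::euclidean_space"
  assumes P: "\<And>n. primitive_of (g n) (F n)" and S: "\<And>n. square_integrable (g n)"
    and u: "\<And>R. uniform_limit {-R..R} F f sequentially"
    and h: "primitive_of h f" "square_integrable h" and e: "e > 0"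
  shows "\<forall>\<^sub>F n in sequentially. sq_norm (g n) > sq_norm h - e"
proof (rule ccontr)
  assume "\<not> ?thesis"
  from not_eventually_sequentiallyD[OF this] obtain r :: "nat \<Rightarrow> nat"
    where r: "strict_mono r" "\<And>n. sq_norm (g (r n)) \<le> sq_norm h - e"
    unfolding not_less by blast
  obtain h' where h': "primitive_of h' f" "square_integrable h'" "sq_norm h' \<le> sq_norm h - e"
  proof (rule weak_lower_semicontinuity)
    show "primitive_of (g (r n)) (F (r n))" "square_integrable (g (r n))" "sq_norm (g (r n)) \<le> sq_norm h - e" for n
      using P S r(2) by auto
    show "uniform_limit {-R..R} (\<lambda>n. F (r n)) f sequentially" for R
      using u r(1) by (rule uniform_limit_subseq)
  qed
  have "sq_norm h' = sq_norm h"
    using primitive_of_unique[OF h'(1) h(1)] h'(2) h(2) by (intro sq_norm_cong_AE) (auto simp: square_integrable_def)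
  then show False using h'(3) e by simp
qed

text \<open>The midpoints of \<open>g n\<close> and \<open>h\<close> have primitives that converge
  to \<open>f\<close> as well, so lower semicontinuity bounds their norms from below by that of
  \<open>h\<close>. Together with the convergence of the norms, the parallelogram law makes the
  differences small.\<close>

lemma strong_convergence:
  fixes f :: "real \<Rightarrow> 'a::euclidean_space"
  assumes P: "\<And>n. primitive_of (g n) (F n)" and S: "\<And>n. square_integrable (g n)"
    and u: "\<And>R. uniform_limit {-R..R} F f sequentially"
    and h: "primitive_of h f" "square_integrable h" and lim: "(\<lambda>n. sq_norm (g n)) \<longlonglongrightarrow> sq_norm h"
  shows "(\<lambda>n. sq_norm (\<lambda>x. g n x - h x)) \<longlonglongrightarrow> 0"
proof (rule LIMSEQ_I)
  fix e :: real assume e: "e > 0"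
  \<comment> \<open>With \<open>e / 8\<close> here and in the upper bound below, the parallelogram
    law leaves at most \<open>2 * (e / 8) + 4 * (e / 8)\<close>, which is less than
    \<open>e\<close>.\<close>
  have "\<forall>\<^sub>F n in sequentially. sq_norm (\<lambda>x. (1/2) *\<^sub>R (g n x + h x)) > sq_norm h - e / 8"
  proof (rule sq_norm_liminf[where F="\<lambda>n x. (1/2) *\<^sub>R (F n x + f x)" and f=f])
    show "primitive_of (\<lambda>x. (1/2) *\<^sub>R (g n x + h x)) (\<lambda>x. (1/2) *\<^sub>R (F n x + f x))" for n
      by (intro primitive_of_scaleR primitive_of_add P h)
    show "square_integrable (\<lambda>x. (1/2) *\<^sub>R (g n x + h x))" for n
      by (intro square_integrable_scaleR(1) square_integrable_add S h)
    show "uniform_limit {-R..R} (\<lambda>n x. (1/2) *\<^sub>R (F n x + f x)) f sequentially" for R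
      unfolding uniform_limit_iff
    proof (intro allI impI)
      fix e :: real assume "e > 0"
      from uniform_limitD[OF u this, of R]
      show "\<forall>\<^sub>F n in sequentially. \<forall>x\<in>{-R..R}. dist ((1/2) *\<^sub>R (F n x + f x)) (f x) < e"
      proof eventually_elim
        case (elim n)
        have "(1/2) *\<^sub>R (F n x + f x) - f x = (1/2) *\<^sub>R (F n x - f x)" for x
          by (simp add: algebra_simps) (simp flip: scaleR_left_distrib)
        then have "dist ((1/2) *\<^sub>R (F n x + f x)) (f x) \<le> dist (F n x) (f x)" for x
          by (simp add: dist_norm)
        then show ?case using elim by (meson le_less_trans)
      qed
    qed
    show "primitive_of h f" "square_integrable h" "0 < e / 8" using h e by auto
  qed
  moreover have "\<forall>\<^sub>F n in sequentially. sq_norm (g n) < sq_norm h + e / 8"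
    using lim e by (intro order_tendstoD) auto
  ultimately have "\<forall>\<^sub>F n in sequentially. norm (sq_norm (\<lambda>x. g n x - h x) - 0) < e"
  proof eventually_elim
    case (elim n)
    then show ?case
      using sq_norm_parallelogram[OF S[of n] h(2)] sq_norm_nonneg[of "\<lambda>x. g n x - h x"] e by simp
  qed
  then show "\<exists>N. \<forall>n\<ge>N. norm (sq_norm (\<lambda>x. g n x - h x) - 0) < e" by (simp add: eventually_sequentially)
qed

section \<open>Potentials with two wells\<close>

lemma primitive_of_translate:
  fixes f :: "real \<Rightarrow> 'a::euclidean_space"
  assumes "primitive_of g f"
  shows "primitive_of (\<lambda>x. g (x + \<tau>)) (\<lambda>x. f (x + \<tau>))"
  unfolding primitive_of_def locally_integrable_def
proof (intro conjI allI impI)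
  have eq: "indicator {s + \<tau>..t + \<tau>} (\<tau> + 1 * x) *\<^sub>R g (\<tau> + 1 * x) = indicator {s..t} x *\<^sub>R g (x + \<tau>)" for s t x
    by (auto simp: indicator_def add.commute)
  show "set_integrable lborel {s..t} (\<lambda>x. g (x + \<tau>))" for s t
    using lborel_integrable_real_affine[OF locally_integrableD[OF primitive_ofD(1)[OF assms], of "s + \<tau>" "t + \<tau>", unfolded set_integrable_def], of 1 \<tau>]
    unfolding eq by (simp add: set_integrable_def)
  show "f (t + \<tau>) - f (s + \<tau>) = (LINT x:{s..t}|lborel. g (x + \<tau>))" if "s \<le> t" for s t
    using primitive_ofD(2)[OF assms, of "s + \<tau>" "t + \<tau>"] that
      lborel_integral_real_affine[of 1 "\<lambda>x. indicator {s + \<tau>..t + \<tau>} x *\<^sub>R g x" \<tau>]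
    unfolding eq by (simp add: set_lebesgue_integral_def)
qed

lemma primitive_of_reflect:
  fixes f :: "real \<Rightarrow> 'a::euclidean_space"
  assumes "primitive_of g f"
  shows "primitive_of (\<lambda>x. - g (- x)) (\<lambda>x. f (- x))"
  unfolding primitive_of_def locally_integrable_def
proof (intro conjI allI impI)
  have eq: "indicator {- t..- s} (0 + (-1) * x) *\<^sub>R g (0 + (-1) * x) = indicator {s..t} x *\<^sub>R g (- x)" for s t x
    by (auto simp: indicator_def)
  have i: "set_integrable lborel {s..t} (\<lambda>x. g (- x))" for s t
    using lborel_integrable_real_affine[OF locally_integrableD[OF primitive_ofD(1)[OF assms], of "- t" "- s", unfolded set_integrable_def], of "-1" 0]
    unfolding eq by (simp add: set_integrable_def)
  then show "set_integrable lborel {s..t} (\<lambda>x. - g (- x))" for s t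
    by (simp add: set_integrable_def)
  show "f (- t) - f (- s) = (LINT x:{s..t}|lborel. - g (- x))" if "s \<le> t" for s t
    using primitive_ofD(2)[OF assms, of "- t" "- s"] that set_integral_uminus[OF i, of s t]
      lborel_integral_real_affine[of "-1" "\<lambda>x. indicator {- t..- s} x *\<^sub>R g x" 0]
    unfolding eq by (simp add: set_lebesgue_integral_def algebra_simps)
qed

lemma integral_translate:
  fixes u :: "real \<Rightarrow> real"
  shows "(\<integral>x. u (x + \<tau>) \<partial>lborel) = (\<integral>x. u x \<partial>lborel)"
    "integrable lborel (\<lambda>x. u (x + \<tau>)) \<longleftrightarrow> integrable lborel u"
  using lborel_integral_real_affine[of 1 u \<tau>] lborel_integrable_real_affine_iff[of 1 u \<tau>]
  by (simp_all add: add.commute)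

lemma integral_reflect:
  fixes u :: "real \<Rightarrow> real"
  shows "(\<integral>x. u (- x) \<partial>lborel) = (\<integral>x. u x \<partial>lborel)"
    "integrable lborel (\<lambda>x. u (- x)) \<longleftrightarrow> integrable lborel u"
  using lborel_integral_real_affine[of "-1" u 0] lborel_integrable_real_affine_iff[of "-1" u 0]
  by simp_all

lemma square_integrable_translate:
  assumes "square_integrable g"
  shows "square_integrable (\<lambda>x. g (x + \<tau>))" "sq_norm (\<lambda>x. g (x + \<tau>)) = sq_norm g"
  using assms integral_translate[of "\<lambda>x. (norm (g x))\<^sup>2" \<tau>]
  by (auto simp: square_integrable_def sq_norm_def)

lemma square_integrable_reflect:
  assumes "square_integrable g"
  shows "square_integrable (\<lambda>x. - g (- x))"
  using assms integral_reflect[of "\<lambda>x. (norm (g x))\<^sup>2"]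
  by (auto simp: square_integrable_def sq_norm_def)

lemma locally_integrable_restrict:
  fixes g :: "real \<Rightarrow> 'a::euclidean_space"
  assumes "locally_integrable g" "A \<in> sets borel"
  shows "locally_integrable (\<lambda>x. indicator A x *\<^sub>R g x)"
  unfolding locally_integrable_def set_integrable_def
proof (intro allI)
  fix s t :: real
  have "integrable lborel (\<lambda>x. indicator A x *\<^sub>R (indicator {s..t} x *\<^sub>R g x))"
    using integrable_mult_indicator[OF _ locally_integrableD[OF assms(1), of s t, unfolded set_integrable_def], of A] assms(2)
    by simp
  then show "integrable lborel (\<lambda>x. indicator {s..t} x *\<^sub>R (indicator A x *\<^sub>R g x))"
    by (simp add: mult.commute)
qed

text \<open>The curve is frozen at its value at time \<open>c\<close>. Sums of stopped and started
  curves are how the piecewise competitors below are assembled, so that no gluing of derivatives is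
  required.\<close>

lemma primitive_of_stop:
  fixes f :: "real \<Rightarrow> 'a::euclidean_space"
  assumes "primitive_of g f"
  shows "primitive_of (\<lambda>x. indicator {..c} x *\<^sub>R g x) (\<lambda>x. f (min x c))"
  unfolding primitive_of_def
proof (intro conjI allI impI)
  show "locally_integrable (\<lambda>x. indicator {..c} x *\<^sub>R g x)"
    using primitive_ofD(1)[OF assms] by (rule locally_integrable_restrict) simp
  show "f (min t c) - f (min s c) = (LINT x:{s..t}|lborel. indicator {..c} x *\<^sub>R g x)" if "s \<le> t" for s t
  proof (cases "s \<le> c")
    case True
    have "(LINT x:{s..t}|lborel. indicator {..c} x *\<^sub>R g x) = (LINT x:{s..min t c}|lborel. g x)"
      unfolding set_lebesgue_integral_def
      by (rule Bochner_Integration.integral_cong) (auto simp: indicator_def)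
    then show ?thesis using primitive_ofD(2)[OF assms, of s "min t c"] True that by (simp add: min_absorb1)
  next
    case False
    then have "(LINT x:{s..t}|lborel. indicator {..c} x *\<^sub>R g x) = (LINT x:{s..t}|lborel. 0)"
      unfolding set_lebesgue_integral_def
      by (intro Bochner_Integration.integral_cong) (auto simp: indicator_def)
    then show ?thesis using False that by (simp add: min_absorb2)
  qed
qed

lemma primitive_of_start:
  fixes f :: "real \<Rightarrow> 'a::euclidean_space"
  assumes "primitive_of g f"
  shows "primitive_of (\<lambda>x. indicator {c..} x *\<^sub>R g x) (\<lambda>x. f (max x c))"
proof -
  have "primitive_of (\<lambda>x. - (indicator {..-c} (- x) *\<^sub>R (- g (- (- x))))) (\<lambda>x. f (- (min (- x) (- c))))"
    by (intro primitive_of_reflect primitive_of_stop assms)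
  moreover have "(\<lambda>x. f (- (min (- x) (- c)))) = (\<lambda>x. f (max x c))"
    by (intro ext arg_cong[of _ _ f]) simp
  moreover have "(\<lambda>x. - (indicator {..-c} (- x) *\<^sub>R (- g (- (- x))))) = (\<lambda>x. indicator {c..} x *\<^sub>R g x)"
    by (auto simp: indicator_def fun_eq_iff)
  ultimately show ?thesis by (simp only:)
qed

lemma integrable_tail_small:
  fixes u :: "real \<Rightarrow> real"
  assumes u: "integrable lborel u" and nn: "\<And>x. u x \<ge> 0" and e: "e > 0"
  obtains L where "L \<ge> x0" "(LINT x:{L..}|lborel. u x) < e"
proof -
  have "((\<lambda>y. LINT x:{..y}|lborel. u x) \<longlongrightarrow> (\<integral>x. u x \<partial>lborel)) at_top"
    unfolding set_lebesgue_integral_def using u by (intro tendsto_integral_at_top) auto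
  then have "\<forall>\<^sub>F y in at_top. (LINT x:{..y}|lborel. u x) > (\<integral>x. u x \<partial>lborel) - e"
    using e by (intro order_tendstoD) auto
  with eventually_ge_at_top[of x0] have "\<forall>\<^sub>F y in at_top. (LINT x:{..y}|lborel. u x) > (\<integral>x. u x \<partial>lborel) - e \<and> x0 \<le> y"
    by eventually_elim auto
  then obtain y where y: "(LINT x:{..y}|lborel. u x) > (\<integral>x. u x \<partial>lborel) - e" "y \<ge> x0"
    by (auto dest: eventually_happens)
  have si: "integrable lborel (\<lambda>x. indicator A x *\<^sub>R u x)" if "A \<in> sets borel" for A
    using integrable_mult_indicator[OF _ u, of A] that by simp
  \<comment> \<open>The second ray starts at \<open>y + 1\<close>, which makes it disjoint from the
    first.\<close>
  have "(LINT x:{..y}|lborel. u x) + (LINT x:{y + 1..}|lborel. u x) = (\<integral>x. indicator {..y} x *\<^sub>R u x + indicator {y + 1..} x *\<^sub>R u x \<partial>lborel)"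
    unfolding set_lebesgue_integral_def by (intro Bochner_Integration.integral_add[symmetric] si) auto
  also have "\<dots> \<le> (\<integral>x. u x \<partial>lborel)"
    using u nn by (intro integral_mono Bochner_Integration.integrable_add si) (auto simp: indicator_def)
  finally show ?thesis using that[of "y + 1"] y by simp
qed

lemma set_integral_le_if_subset:
  fixes u :: "real \<Rightarrow> real"
  assumes "set_integrable lborel B u" "A \<in> sets borel" "A \<subseteq> B" "\<And>x. u x \<ge> 0"
  shows "(LINT x:A|lborel. u x) \<le> (LINT x:B|lborel. u x)"
proof -
  have "set_integrable lborel A u"
    using assms set_integrable_subset by fastforce
  then show ?thesis
    using assms unfolding set_lebesgue_integral_def set_integrable_def
    by (intro integral_mono) (auto simp: indicator_def)
qed

section \<open>The wells, the energy density and the cost of leaving a well\<close>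

definition moduli :: "complex \<times> complex \<Rightarrow> real \<times> real" where
  "moduli z = (cmod (fst z), cmod (snd z))"

lemma norm_moduli: "norm (moduli z) = norm z"
  by (cases z) (simp add: moduli_def norm_Pair)

lemma dist_moduli_le: "dist (moduli z) (moduli w) \<le> norm (z - w)"
proof -
  have "\<bar>cmod u - cmod v\<bar>\<^sup>2 \<le> (cmod (u - v))\<^sup>2" for u v :: complex
    by (intro power_mono norm_triangle_ineq3) simp
  then show ?thesis
    by (cases z; cases w) (simp add: moduli_def dist_prod_def norm_Pair dist_real_def add_mono)
qed

lemma continuous_on_moduli [continuous_intros]:
  "continuous_on S f \<Longrightarrow> continuous_on S (\<lambda>x. moduli (f x))"
  unfolding moduli_def by (intro continuous_intros)

text \<open>What the variational argument uses of the potential. \<open>small\<close> combines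
  coercivity with compactness: away from the wells, and also at infinity, \<open>W\<close> has a
  positive lower bound. \<open>quadratic\<close> is the form in which non-degeneracy is used; it
  bounds the squared distance to a well by the potential energy.\<close>

locale double_well =
  fixes W :: "complex \<times> complex \<Rightarrow> real" and a b :: real
  assumes ab: "a > 0" "b > 0"
    and cont: "continuous_on UNIV W"
    and nonneg: "W z \<ge> 0"
    and phase: "moduli z = moduli w \<Longrightarrow> W z = W w"
    and zero: "moduli z = (a, 0) \<or> moduli z = (0, b) \<Longrightarrow> W z = 0"
    and small: "e > 0 \<Longrightarrow> \<exists>\<delta>>0. \<forall>z. W z < \<delta> \<longrightarrow> dist (moduli z) (a, 0) < e \<or> dist (moduli z) (0, b) < e"
    and quadratic: "\<exists>r>0. \<exists>c>0. \<forall>z. \<forall>p\<in>{(a, 0), (0, b)}. dist (moduli z) p \<le> r \<longrightarrow> c * (dist (moduli z) p)\<^sup>2 \<le> W z"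
begin

text \<open>The factor \<open>1 / 2\<close> of the energy is left out here and in
  \<open>total\<close>; it returns in \<open>competitor_space_Y\<close>.\<close>

definition density :: "(real \<Rightarrow> complex \<times> complex) \<Rightarrow> (real \<Rightarrow> complex \<times> complex) \<Rightarrow> real \<Rightarrow> real" where
  "density \<Psi> g x = (norm (g x))\<^sup>2 + W (\<Psi> x)"

definition gap :: real where "gap = dist (a, 0) (0, b)"

lemma gap_pos: "gap > 0"
  using ab by (simp add: gap_def)

lemma density_nonneg: "density \<Psi> g x \<ge> 0"
  by (simp add: density_def nonneg)

lemma continuous_W: "continuous_on S f \<Longrightarrow> continuous_on S (\<lambda>x. W (f x))"
  using continuous_on_compose2[OF cont] by blast

lemma density_set_integrable:
  assumes "primitive_of g \<Psi>" "g \<in> L2_loc"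
  shows "set_integrable lborel {s..t} (density \<Psi> g)"
  unfolding density_def
  using locally_integrableD[OF continuous_locally_integrable[OF continuous_W[OF primitive_of_continuous[OF assms(1)]]]]
  by (intro set_integral_add L2_loc_square assms)

text \<open>A low value of \<open>W\<close> forces the moduli to within \<open>e / 2\<close> of some
  well. The annulus excludes \<open>p\<close> itself, and \<open>e \<le> gap / 2\<close> keeps the
  annulus away from the other well.\<close>

lemma annulus:
  assumes e: "0 < e" "e \<le> gap / 2" and p: "p \<in> {(a, 0), (0, b)}"
  obtains \<delta> where "\<delta> > 0" "\<And>z. e / 2 \<le> dist (moduli z) p \<Longrightarrow> dist (moduli z) p \<le> e \<Longrightarrow> \<delta> \<le> W z"
proof -
  obtain \<delta> where \<delta>: "\<delta> > 0" "\<And>z. W z < \<delta> \<Longrightarrow> dist (moduli z) (a, 0) < e / 2 \<or> dist (moduli z) (0, b) < e / 2"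
    using small[of "e / 2"] e by auto
  have tri: "gap \<le> dist (moduli z) (a, 0) + dist (moduli z) (0, b)" for z
    unfolding gap_def by (rule dist_triangle3)
  have "\<delta> \<le> W z" if "e / 2 \<le> dist (moduli z) p" "dist (moduli z) p \<le> e" for z
  proof (rule ccontr)
    assume "\<not> \<delta> \<le> W z"
    then show False using \<delta>(2)[of z] tri[of z] that p e by auto
  qed
  then show ?thesis using that \<delta>(1) by blast
qed

text \<open>The exponent 1/2 comes from Cauchy-Schwarz for the derivative. The first estimate
  follows from the second because \<open>moduli\<close> and the distance to a point are Lipschitz
  with constant \<open>1\<close>.\<close>

lemma dist_moduli_Hoelder:
  assumes P: "primitive_of g \<Psi>" "g \<in> L2_loc" and xy: "x \<in> {s..t}" "y \<in> {s..t}"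
  shows "\<bar>dist (moduli (\<Psi> x)) p - dist (moduli (\<Psi> y)) p\<bar>\<^sup>2 \<le> \<bar>x - y\<bar> * (LINT u:{s..t}|lborel. density \<Psi> g u)"
    "(norm (\<Psi> x - \<Psi> y))\<^sup>2 \<le> \<bar>x - y\<bar> * (LINT u:{s..t}|lborel. density \<Psi> g u)"
proof -
  have *: "(norm (\<Psi> y - \<Psi> x))\<^sup>2 \<le> (y - x) * (LINT u:{s..t}|lborel. density \<Psi> g u)"
    if "x \<le> y" "x \<in> {s..t}" "y \<in> {s..t}" for x y
  proof -
    have "(LINT u:{x..y}|lborel. (norm (g u))\<^sup>2) \<le> (LINT u:{s..t}|lborel. (norm (g u))\<^sup>2)"
      using that by (intro set_integral_le_if_subset L2_loc_square P) auto
    also have "\<dots> \<le> (LINT u:{s..t}|lborel. density \<Psi> g u)"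
      by (intro set_integral_mono L2_loc_square P density_set_integrable) (simp add: density_def nonneg)
    finally show ?thesis
      using primitive_of_Hoelder[OF P that(1)] that(1) by (meson diff_ge_0_iff_ge mult_left_mono order_trans)
  qed
  show 1: "(norm (\<Psi> x - \<Psi> y))\<^sup>2 \<le> \<bar>x - y\<bar> * (LINT u:{s..t}|lborel. density \<Psi> g u)"
    using *[of x y] *[of y x] xy by (cases "x \<le> y") (simp_all add: norm_minus_commute abs_minus_commute)
  have "\<bar>dist (moduli (\<Psi> x)) p - dist (moduli (\<Psi> y)) p\<bar> \<le> norm (\<Psi> x - \<Psi> y)"
    using dist_moduli_le[of "\<Psi> x" "\<Psi> y"] abs_dist_diff_le[of "moduli (\<Psi> x)" p "moduli (\<Psi> y)"] by (simp add: dist_commute)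
  then show "\<bar>dist (moduli (\<Psi> x)) p - dist (moduli (\<Psi> y)) p\<bar>\<^sup>2 \<le> \<bar>x - y\<bar> * (LINT u:{s..t}|lborel. density \<Psi> g u)"
    using 1 power_mono[of _ "norm (\<Psi> x - \<Psi> y)" 2] by (meson abs_ge_zero order_trans)
qed

lemma W_integral_lower:
  assumes P: "primitive_of g \<Psi>" "g \<in> L2_loc" and le: "s \<le> t" and lower: "\<And>x. x \<in> {s..t} \<Longrightarrow> \<delta> \<le> W (\<Psi> x)"
  shows "\<delta> * (t - s) \<le> (LINT u:{s..t}|lborel. density \<Psi> g u)"
proof -
  have "\<delta> * (t - s) = (LINT u:{s..t}|lborel. \<delta>)" using le by (simp add: set_lebesgue_integral_def)
  also have "\<dots> \<le> (LINT u:{s..t}|lborel. density \<Psi> g u)"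
    using continuous_locally_integrable[of "\<lambda>_. \<delta>"]
    by (intro set_integral_mono density_set_integrable P)
       (auto simp: locally_integrable_def density_def intro: order_trans[OF lower])
  finally show ?thesis .
qed

text \<open>A curve of small energy is slow: having reached distance \<open>3 * e / 4\<close> from
  \<open>p\<close>, it spends some time in the annulus around \<open>p\<close>, where
  \<open>W\<close> is bounded below. So crossing the annulus costs a fixed amount, in either
  direction.\<close>

lemma crossing_cost:
  assumes e: "0 < e" "e \<le> gap / 2" and p: "p \<in> {(a, 0), (0, b)}"
  obtains \<kappa> where "\<kappa> > 0" "\<And>\<Psi> g s t. primitive_of g \<Psi> \<Longrightarrow> g \<in> L2_loc \<Longrightarrow> s \<le> t \<Longrightarrow>
    dist (moduli (\<Psi> s)) p \<le> e / 2 \<and> e \<le> dist (moduli (\<Psi> t)) p \<or>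
    dist (moduli (\<Psi> t)) p \<le> e / 2 \<and> e \<le> dist (moduli (\<Psi> s)) p \<Longrightarrow>
    \<kappa> \<le> (LINT x:{s..t}|lborel. density \<Psi> g x)"
proof -
  obtain \<delta> where \<delta>: "\<delta> > 0" "\<And>z. e / 2 \<le> dist (moduli z) p \<Longrightarrow> dist (moduli z) p \<le> e \<Longrightarrow> \<delta> \<le> W z"
    using annulus[OF e p] by blast
  \<comment> \<open>The constant balances two effects: energy below \<open>\<kappa>\<close> keeps
    the distance between \<open>e / 2\<close> and \<open>e\<close> for a time \<open>l\<close> with
    \<open>l * \<kappa> = (e / 4)\<^sup>2\<close>, and staying there that long costs
    \<open>\<delta> * l = \<kappa>\<close>.\<close>
  define \<kappa> where "\<kappa> = sqrt \<delta> * e / 4"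
  have \<kappa>: "\<kappa> > 0" "\<kappa> * \<kappa> = \<delta> * e\<^sup>2 / 16" using \<delta> e by (auto simp: \<kappa>_def power2_eq_square field_simps)
  have "\<kappa> \<le> (LINT x:{s..t}|lborel. density \<Psi> g x)"
    if P: "primitive_of g \<Psi>" "g \<in> L2_loc" and st: "s \<le> t" and
      c: "dist (moduli (\<Psi> s)) p \<le> e / 2 \<and> e \<le> dist (moduli (\<Psi> t)) p \<or>
        dist (moduli (\<Psi> t)) p \<le> e / 2 \<and> e \<le> dist (moduli (\<Psi> s)) p" for \<Psi> g s t
  proof (rule ccontr)
    assume contr: "\<not> ?thesis"
    define K where "K = (LINT x:{s..t}|lborel. density \<Psi> g x)"
    have K: "K < \<kappa>" using contr by (simp add: K_def)
    define D where "D x = dist (moduli (\<Psi> x)) p" for x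
    have "continuous_on {s..t} D"
      unfolding D_def using primitive_of_continuous[OF P(1)]
      by (intro continuous_intros) (auto intro: continuous_on_subset)
    then obtain x where x: "x \<in> {s..t}" "D x = 3 * e / 4"
      using IVT'[of D s "3 * e / 4" t] IVT2'[of D t "3 * e / 4" s] c st e unfolding D_def[symmetric]
      by (auto simp: field_simps)
    define l where "l = e\<^sup>2 / (16 * \<kappa>)"
    have l: "l > 0" "l * \<kappa> = (e / 4)\<^sup>2" using \<kappa> e by (auto simp: l_def power2_eq_square)
    have near: "e / 2 < D y \<and> D y < e" if "y \<in> {s..t}" "\<bar>y - x\<bar> \<le> l" for y
    proof -
      have "\<bar>D y - D x\<bar>\<^sup>2 \<le> \<bar>y - x\<bar> * K"
        unfolding D_def K_def by (intro dist_moduli_Hoelder P that x)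
      also have "\<dots> \<le> l * K" using that density_nonneg by (intro mult_right_mono) (auto simp: K_def set_lebesgue_integral_def)
      also have "\<dots> < l * \<kappa>" using K l(1) by (rule mult_strict_left_mono)
      finally have "\<bar>D y - D x\<bar>\<^sup>2 < (e / 4)\<^sup>2" unfolding l(2) .
      then have "\<bar>D y - D x\<bar> < e / 4" by (rule power2_less_imp_less) (use e in simp)
      then show ?thesis using x(2) by linarith
    qed
    \<comment> \<open>At \<open>s\<close> the distance is at most \<open>e / 2\<close> or at least
      \<open>e\<close>, so \<open>s\<close> cannot lie within \<open>l\<close> of
      \<open>x\<close>.\<close>
    have "x - l > s"
    proof (rule ccontr)
      assume "\<not> x - l > s"
      then show False using near[of s] x(1) st c by (auto simp: D_def)
    qed
    have "\<delta> * (x - (x - l)) \<le> (LINT u:{x - l..x}|lborel. density \<Psi> g u)"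
    proof (intro W_integral_lower P)
      fix y assume "y \<in> {x - l..x}"
      then show "\<delta> \<le> W (\<Psi> y)" using near[of y] \<open>x - l > s\<close> x(1) \<delta>(2)[of "\<Psi> y"] by (auto simp: D_def)
    qed (use l in simp)
    also have "\<dots> \<le> K"
      unfolding K_def using \<open>x - l > s\<close> x(1)
      by (intro set_integral_le_if_subset density_set_integrable P density_nonneg) auto
    finally have "\<delta> * l * \<kappa> < \<kappa> * \<kappa>" using K \<kappa> by simp
    moreover have "\<delta> * l * \<kappa> = \<kappa> * \<kappa>"
      unfolding mult.assoc l(2) \<kappa>(2) by (simp add: power2_eq_square)
    ultimately show False by simp
  qed
  then show ?thesis using that \<kappa>(1) by blast
qed

text \<open>By the energy bound, \<open>W (\<Psi> y) < \<delta>\<close> for some \<open>y\<close> in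
  every interval of length \<open>T\<close>. There the moduli are within \<open>1\<close> of a well,
  and the Hoelder estimate controls the way from \<open>y\<close> back to \<open>x\<close>. The
  bound depends on \<open>K\<close> only and not on the curve.\<close>

lemma uniform_bound:
  obtains M where "\<And>\<Psi> g x. primitive_of g \<Psi> \<Longrightarrow> g \<in> L2_loc \<Longrightarrow>
    (\<And>s t. (LINT u:{s..t}|lborel. density \<Psi> g u) \<le> K) \<Longrightarrow> norm (\<Psi> x) \<le> M"
proof -
  obtain \<delta> where \<delta>: "\<delta> > 0" "\<And>z. W z < \<delta> \<Longrightarrow> dist (moduli z) (a, 0) < 1 \<or> dist (moduli z) (0, b) < 1"
    using small[of 1] by auto
  define T where "T = \<bar>K\<bar> / \<delta> + 1"
  have "\<delta> * T = \<bar>K\<bar> + \<delta>" using \<delta>(1) by (simp add: T_def distrib_left)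
  then have T: "T > 0" "\<delta> * T > K" using \<delta>(1) by (auto simp: T_def add_nonneg_pos)
  have "norm (\<Psi> x) \<le> a + b + 1 + sqrt (T * \<bar>K\<bar>)"
    if P: "primitive_of g \<Psi>" "g \<in> L2_loc" and K: "\<And>s t. (LINT u:{s..t}|lborel. density \<Psi> g u) \<le> K" for \<Psi> g x
  proof -
    have "\<exists>y\<in>{x..x + T}. W (\<Psi> y) < \<delta>"
    proof (rule ccontr)
      assume "\<not> ?thesis"
      then have "\<delta> * (x + T - x) \<le> (LINT u:{x..x + T}|lborel. density \<Psi> g u)"
        using T by (intro W_integral_lower P) (auto simp: not_less)
      then show False using K[of x "x + T"] T by simp
    qed
    then obtain y where y: "y \<in> {x..x + T}" "W (\<Psi> y) < \<delta>" by blast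
    have "norm (moduli (\<Psi> y)) \<le> a + b + 1"
      using \<delta>(2)[OF y(2)] norm_triangle_sub[of "moduli (\<Psi> y)" "(a, 0)"] norm_triangle_sub[of "moduli (\<Psi> y)" "(0, b)"] ab
      by (auto simp: dist_norm norm_Pair)
    then have 1: "norm (\<Psi> y) \<le> a + b + 1" by (simp add: norm_moduli)
    have "(norm (\<Psi> x - \<Psi> y))\<^sup>2 \<le> \<bar>x - y\<bar> * (LINT u:{x..x + T}|lborel. density \<Psi> g u)"
      using y T by (intro dist_moduli_Hoelder P) auto
    also have "\<dots> \<le> T * \<bar>K\<bar>"
      using y K[of x "x + T"] density_nonneg by (intro mult_mono) (auto simp: set_lebesgue_integral_def)
    finally have "norm (\<Psi> x - \<Psi> y) \<le> sqrt (T * \<bar>K\<bar>)" by (rule real_le_rsqrt)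
    then show ?thesis using 1 norm_triangle_sub[of "\<Psi> x" "\<Psi> y"] by linarith
  qed
  then show ?thesis using that by blast
qed

text \<open>Finite energy brings the curve, arbitrarily far out, to within \<open>e / 2\<close> of
  some well, and \<open>away\<close> rules out \<open>q\<close>. Once it is near \<open>p\<close> at
  a time after which less than \<open>\<kappa>\<close> of the energy remains, it cannot cross the
  annulus around \<open>p\<close> any more.\<close>

lemma tail_limit:
  assumes P: "primitive_of g \<Psi>" "square_integrable g" and Wi: "integrable lborel (\<lambda>x. W (\<Psi> x))"
    and pq: "(p, q) \<in> {((a, 0), (0, b)), ((0, b), (a, 0))}"
    and e': "e' > 0" and away: "\<And>x. x \<ge> x0 \<Longrightarrow> dist (moduli (\<Psi> x)) q \<ge> e'"
  shows "((\<lambda>x. dist (moduli (\<Psi> x)) p) \<longlongrightarrow> 0) at_top"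
proof (rule tendstoI)
  fix \<epsilon> :: real assume \<epsilon>: "\<epsilon> > 0"
  define e where "e = min \<epsilon> (min (gap / 2) e')"
  have e: "0 < e" "e \<le> gap / 2" "e \<le> \<epsilon>" "e \<le> e'" using \<epsilon> gap_pos e' by (auto simp: e_def)
  have p: "p \<in> {(a, 0), (0, b)}" using pq by auto
  have gL: "g \<in> L2_loc" using P(2) by (rule square_integrable_L2_loc)
  obtain \<kappa> where \<kappa>: "\<kappa> > 0" "\<And>\<Psi> g s t. primitive_of g \<Psi> \<Longrightarrow> g \<in> L2_loc \<Longrightarrow> s \<le> t \<Longrightarrow>
    dist (moduli (\<Psi> s)) p \<le> e / 2 \<and> e \<le> dist (moduli (\<Psi> t)) p \<or>
    dist (moduli (\<Psi> t)) p \<le> e / 2 \<and> e \<le> dist (moduli (\<Psi> s)) p \<Longrightarrow>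
    \<kappa> \<le> (LINT x:{s..t}|lborel. density \<Psi> g x)"
    using crossing_cost[OF e(1,2) p] by blast
  obtain \<delta> where \<delta>: "\<delta> > 0" "\<And>z. W z < \<delta> \<Longrightarrow> dist (moduli z) (a, 0) < e / 2 \<or> dist (moduli z) (0, b) < e / 2"
    using small[of "e / 2"] e by auto
  have int: "integrable lborel (density \<Psi> g)"
    using P(2) Wi unfolding density_def[abs_def] square_integrable_def by auto
  obtain L where L: "L \<ge> x0" "(LINT x:{L..}|lborel. density \<Psi> g x) < \<kappa>"
    using integrable_tail_small[OF int density_nonneg \<kappa>(1)] by blast
  have less: "(LINT x:{s..t}|lborel. density \<Psi> g x) < \<kappa>" if "s \<ge> L" for s t
  proof -
    have "set_integrable lborel {L..} (density \<Psi> g)"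
      using integrable_mult_indicator[OF _ int, of "{L..}"] by (simp add: set_integrable_def)
    then have "(LINT x:{s..t}|lborel. density \<Psi> g x) \<le> (LINT x:{L..}|lborel. density \<Psi> g x)"
      using that by (intro set_integral_le_if_subset density_nonneg) auto
    then show ?thesis using L by simp
  qed
  \<comment> \<open>Staying above the level \<open>\<delta>\<close> for a time
    \<open>\<kappa> / \<delta>\<close> would already use up the energy
    \<open>\<kappa>\<close>.\<close>
  have "\<exists>y\<in>{L..L + \<kappa> / \<delta>}. W (\<Psi> y) < \<delta>"
  proof (rule ccontr)
    assume "\<not> ?thesis"
    then have "\<delta> * (L + \<kappa> / \<delta> - L) \<le> (LINT u:{L..L + \<kappa> / \<delta>}|lborel. density \<Psi> g u)"
      using \<delta> \<kappa> by (intro W_integral_lower P gL) (auto simp: not_less)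
    then show False using less[of L "L + \<kappa> / \<delta>"] \<delta> by simp
  qed
  then obtain y where y: "y \<ge> L" "W (\<Psi> y) < \<delta>" by auto
  have "dist (moduli (\<Psi> y)) p < e / 2"
    using \<delta>(2)[OF y(2)] away[of y] y(1) L(1) pq e by auto
  then have "dist (moduli (\<Psi> t)) p < e" if "t \<ge> y" for t
    using \<kappa>(2)[OF P(1) gL that] less[of y t] y(1) by force
  then show "\<forall>\<^sub>F x in at_top. dist (dist (moduli (\<Psi> x)) p) 0 < \<epsilon>"
    using e(3) by (auto simp: eventually_at_top_linorder intro!: exI[of _ y] intro: less_le_trans)
qed

end

lemma integral_liminf:
  fixes u :: "nat \<Rightarrow> real \<Rightarrow> real"
  assumes int: "\<And>n. integrable lborel (u n)" and nn: "\<And>n x. u n x \<ge> 0"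
    and v: "integrable lborel v" and lim: "AE x in lborel. (\<lambda>n. u n x) \<longlonglongrightarrow> v x" and e: "e > 0"
  shows "\<forall>\<^sub>F n in sequentially. (\<integral>x. u n x \<partial>lborel) > (\<integral>x. v x \<partial>lborel) - e"
proof (rule ccontr)
  assume "\<not> ?thesis"
  from not_eventually_sequentiallyD[OF this] obtain r :: "nat \<Rightarrow> nat"
    where r: "strict_mono r" "\<And>n. (\<integral>x. u (r n) x \<partial>lborel) \<le> (\<integral>x. v x \<partial>lborel) - e"
    unfolding not_less by blast
  have "AE x in lborel. (\<lambda>n. u (r n) x) \<longlonglongrightarrow> v x"
    using lim by eventually_elim (use LIMSEQ_subseq_LIMSEQ[OF _ r(1)] in \<open>auto simp: o_def\<close>)
  from integral_le_if_tendsto(2)[OF int nn r(2) borel_measurable_integrable[OF v] this] e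
  show False by simp
qed

lemma set_integral_liminf:
  fixes u :: "nat \<Rightarrow> real \<Rightarrow> real"
  assumes int: "\<And>n. integrable lborel (u n)" and nn: "\<And>n x. u n x \<ge> 0"
    and v: "integrable lborel v" and lim: "\<And>x. (\<lambda>n. u n x) \<longlonglongrightarrow> v x" and e: "e > 0"
    and A: "A \<in> sets borel"
  shows "\<forall>\<^sub>F n in sequentially. (LINT x:A|lborel. u n x) > (LINT x:A|lborel. v x) - e"
  unfolding set_lebesgue_integral_def
proof (rule integral_liminf)
  show "integrable lborel (\<lambda>x. indicator A x *\<^sub>R u n x)" for n
    using integrable_mult_indicator[OF _ int] A by simp
  show "integrable lborel (\<lambda>x. indicator A x *\<^sub>R v x)"
    using integrable_mult_indicator[OF _ v] A by simp
  show "AE x in lborel. (\<lambda>n. indicator A x *\<^sub>R u n x) \<longlonglongrightarrow> indicator A x *\<^sub>R v x"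
    by (intro AE_I2 tendsto_intros lim)
qed (use nn e in auto)

lemma integrable_set_integrable:
  fixes u :: "real \<Rightarrow> real"
  shows "integrable lborel u \<Longrightarrow> A \<in> sets borel \<Longrightarrow> set_integrable lborel A u"
  using integrable_mult_indicator[of A lborel u] by (simp add: set_integrable_def)

lemma set_integral_le_integral:
  fixes u :: "real \<Rightarrow> real"
  assumes "integrable lborel u" "A \<in> sets borel" "\<And>x. u x \<ge> 0"
  shows "(LINT x:A|lborel. u x) \<le> (\<integral>x. u x \<partial>lborel)"
  using set_integral_le_if_subset[of UNIV u A] assms integrable_set_integrable[OF assms(1), of UNIV]
  by (simp add: set_lebesgue_integral_def)

lemma set_integral_add_compl:
  fixes u :: "real \<Rightarrow> real"
  assumes "integrable lborel u" "A \<in> sets borel"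
  shows "(LINT x:A|lborel. u x) + (LINT x:-A|lborel. u x) = (\<integral>x. u x \<partial>lborel)"
  using set_integral_Un[of A "-A" lborel u] integrable_set_integrable[OF assms] integrable_set_integrable[OF assms(1), of "-A"] assms
  by (simp add: set_lebesgue_integral_def)

lemma set_integral_ray_interval_le:
  fixes u :: "real \<Rightarrow> real"
  assumes u: "integrable lborel u" "\<And>x. u x \<ge> 0"
  shows "(LINT x:{..c}|lborel. u x) + (LINT x:{c..d}|lborel. u x) \<le> (\<integral>x. u x \<partial>lborel)"
proof -
  have si: "integrable lborel (\<lambda>x. indicator A x *\<^sub>R u x)" if "A \<in> sets borel" for A
    using integrable_mult_indicator[OF _ u(1), of A] that by simp
  have "(LINT x:{..c}|lborel. u x) + (LINT x:{c..d}|lborel. u x)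
      = (\<integral>x. indicator {..c} x *\<^sub>R u x + indicator {c..d} x *\<^sub>R u x \<partial>lborel)"
    unfolding set_lebesgue_integral_def by (intro Bochner_Integration.integral_add[symmetric] si) auto
  also have "\<dots> \<le> (\<integral>x. u x \<partial>lborel)"
  proof (rule integral_mono_AE)
    show "AE x in lborel. indicator {..c} x *\<^sub>R u x + indicator {c..d} x *\<^sub>R u x \<le> u x"
      using AE_lborel_singleton[of c] by eventually_elim (use u in \<open>auto simp: indicator_def\<close>)
    show "integrable lborel (\<lambda>x. indicator {..c} x *\<^sub>R u x + indicator {c..d} x *\<^sub>R u x)"
      by (intro Bochner_Integration.integrable_add si) auto
  qed (rule u)
  finally show ?thesis .
qed

lemma last_time_below:
  fixes u :: "real \<Rightarrow> real"
  assumes c: "continuous_on UNIV u" and bot: "\<forall>\<^sub>F x in at_bot. u x < c" and top: "\<forall>\<^sub>F x in at_top. u x > c"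
  obtains \<tau> where "u \<tau> \<le> c" "\<And>x. x > \<tau> \<Longrightarrow> u x > c"
proof -
  define S where "S = {x. u x \<le> c}"
  have "closed S" unfolding S_def using c by (intro closed_Collect_le continuous_intros)
  obtain x1 where "\<And>x. x \<le> x1 \<Longrightarrow> u x < c" using bot by (auto simp: eventually_at_bot_linorder)
  then have ne: "S \<noteq> {}" by (auto simp: S_def intro!: exI[of _ x1] less_imp_le)
  obtain x2 where x2: "\<And>x. x \<ge> x2 \<Longrightarrow> u x > c" using top by (auto simp: eventually_at_top_linorder)
  then have bdd: "bdd_above S" by (intro bdd_aboveI[of _ x2]) (metis S_def less_imp_le mem_Collect_eq not_le)
  have "Sup S \<in> S" using ne bdd \<open>closed S\<close> by (rule closed_contains_Sup)
  moreover have "u x > c" if "x > Sup S" for x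
    using cSup_upper[OF _ bdd, of x] that by (force simp: S_def)
  ultimately show ?thesis using that by (auto simp: S_def)
qed

section \<open>Competitors, joining to a well, and uniform control of the tails\<close>

context double_well
begin

text \<open>The finite-energy members of \<open>space_Y a b\<close> together with a derivative. The
  boundary conditions are written with the distances of the moduli to the wells, the quantities that
  \<open>crossing_cost\<close> controls.\<close>

definition competitor :: "(real \<Rightarrow> complex \<times> complex) \<Rightarrow> (real \<Rightarrow> complex \<times> complex) \<Rightarrow> bool" where
  "competitor \<Phi> h \<longleftrightarrow> primitive_of h \<Phi> \<and> square_integrable h \<and> integrable lborel (\<lambda>x. W (\<Phi> x)) \<and>
     ((\<lambda>x. dist (moduli (\<Phi> x)) (a, 0)) \<longlongrightarrow> 0) at_top \<and> ((\<lambda>x. dist (moduli (\<Phi> x)) (0, b)) \<longlongrightarrow> 0) at_bot"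

definition total :: "(real \<Rightarrow> complex \<times> complex) \<Rightarrow> (real \<Rightarrow> complex \<times> complex) \<Rightarrow> real" where
  "total \<Phi> h = sq_norm h + (\<integral>x. W (\<Phi> x) \<partial>lborel)"

lemma density_integrable:
  assumes "square_integrable g" "integrable lborel (\<lambda>x. W (\<Psi> x))"
  shows "integrable lborel (density \<Psi> g)" "total \<Psi> g = (\<integral>x. density \<Psi> g x \<partial>lborel)"
  using assms unfolding density_def[abs_def] square_integrable_def total_def sq_norm_def by auto

lemma tail_limit_bot:
  assumes P: "primitive_of g \<Psi>" "square_integrable g" and Wi: "integrable lborel (\<lambda>x. W (\<Psi> x))"
    and pq: "(p, q) \<in> {((a, 0), (0, b)), ((0, b), (a, 0))}"
    and e': "e' > 0" and away: "\<And>x. x \<le> x0 \<Longrightarrow> dist (moduli (\<Psi> x)) q \<ge> e'"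
  shows "((\<lambda>x. dist (moduli (\<Psi> x)) p) \<longlongrightarrow> 0) at_bot"
  unfolding filterlim_at_bot_mirror
proof (rule tail_limit)
  show "primitive_of (\<lambda>x. - g (- x)) (\<lambda>x. \<Psi> (- x))" using P(1) by (rule primitive_of_reflect)
  show "square_integrable (\<lambda>x. - g (- x))" using P(2) by (rule square_integrable_reflect)
  show "integrable lborel (\<lambda>x. W (\<Psi> (- x)))" using Wi integral_reflect(2)[of "\<lambda>x. W (\<Psi> x)"] by simp
  show "e' \<le> dist (moduli (\<Psi> (- x))) q" if "x \<ge> - x0" for x using away that by simp
qed fact+

text \<open>After time \<open>c\<close> the curve is replaced by a straight segment of unit duration
  to a nearby zero of \<open>W\<close> with moduli \<open>(a, 0)\<close>, followed by rest. The
  segment is short, hence cheap in kinetic energy, and stays near the well, hence cheap in potential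
  energy.\<close>

lemma connection:
  assumes \<eta>: "\<eta> > 0"
  obtains \<epsilon> where "\<epsilon> > 0" "\<And>\<Psi> g c. primitive_of g \<Psi> \<Longrightarrow> square_integrable g \<Longrightarrow> integrable lborel (\<lambda>x. W (\<Psi> x)) \<Longrightarrow>
    ((\<lambda>x. dist (moduli (\<Psi> x)) (0, b)) \<longlongrightarrow> 0) at_bot \<Longrightarrow> dist (moduli (\<Psi> c)) (a, 0) \<le> \<epsilon> \<Longrightarrow>
    \<exists>\<Phi> h. competitor \<Phi> h \<and> total \<Phi> h \<le> (LINT x:{..c}|lborel. density \<Psi> g x) + \<eta>"
proof -
  define A :: "complex \<times> complex" where "A = (of_real a, 0)"
  have WA: "W A = 0" using ab by (intro zero) (simp add: A_def moduli_def)
  have "isCont W A" using continuous_on_interior[OF cont, of A] by simp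
  then obtain \<epsilon>1 where "\<epsilon>1 > 0" "\<And>z. dist z A < \<epsilon>1 \<Longrightarrow> dist (W z) (W A) < \<eta> / 2"
    using \<eta> by (metis continuous_at_eps_delta half_gt_zero)
  then have \<epsilon>1: "\<epsilon>1 > 0" "\<And>z. dist z A < \<epsilon>1 \<Longrightarrow> W z < \<eta> / 2"
    using WA nonneg by (auto simp: dist_real_def abs_of_nonneg)
  have Wsmall: "W z < \<eta> / 2" if "dist (moduli z) (a, 0) < \<epsilon>1" for z
  proof -
    \<comment> \<open>Phase invariance allows the components to be rotated to real nonnegative ones,
      where the distance to \<open>A\<close> is the distance of the moduli to
      \<open>(a, 0)\<close>.\<close>
    define y :: "complex \<times> complex" where "y = (of_real (cmod (fst z)), of_real (cmod (snd z)))"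
    have "dist y A = dist (moduli z) (a, 0)"
      by (simp add: y_def A_def moduli_def dist_prod_def dist_norm flip: of_real_diff)
    moreover have "W z = W y" by (rule phase) (simp add: y_def moduli_def)
    ultimately show ?thesis using \<epsilon>1(2)[of y] that by simp
  qed
  \<comment> \<open>Over unit time, \<open>\<epsilon> < \<epsilon>1\<close> bounds the potential
    cost of the segment by \<open>\<eta> / 2\<close>, and
    \<open>\<epsilon>\<^sup>2 \<le> \<eta> / 2\<close> bounds its kinetic cost.\<close>
  define \<epsilon> where "\<epsilon> = min (\<epsilon>1 / 2) (sqrt (\<eta> / 2))"
  have \<epsilon>: "\<epsilon> > 0" "\<epsilon> < \<epsilon>1" "\<epsilon> \<le> sqrt (\<eta> / 2)" using \<epsilon>1 \<eta> by (auto simp: \<epsilon>_def)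
  have "\<epsilon>\<^sup>2 \<le> (sqrt (\<eta> / 2))\<^sup>2" using \<epsilon> by (intro power_mono) auto
  then have \<epsilon>2: "\<epsilon>\<^sup>2 \<le> \<eta> / 2" using \<eta> by simp
  have "\<exists>\<Phi> h. competitor \<Phi> h \<and> total \<Phi> h \<le> (LINT x:{..c}|lborel. density \<Psi> g x) + \<eta>"
    if P: "primitive_of g \<Psi>" "square_integrable g" and Wi: "integrable lborel (\<lambda>x. W (\<Psi> x))"
    and bot: "((\<lambda>x. dist (moduli (\<Psi> x)) (0, b)) \<longlongrightarrow> 0) at_bot" and c: "dist (moduli (\<Psi> c)) (a, 0) \<le> \<epsilon>" for \<Psi> g c
  proof -
    define z1 where "z1 = fst (\<Psi> c)"
    \<comment> \<open>A point nearest to \<open>z1\<close> on the circle of radius \<open>a\<close>;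
      for \<open>z1 = 0\<close> all points of the circle are equally near.\<close>
    define p1 where "p1 = (if z1 = 0 then of_real a else of_real a * sgn z1)"
    have p1: "cmod p1 = a" "cmod (p1 - z1) = \<bar>cmod z1 - a\<bar>"
    proof -
      show "cmod p1 = a" using ab by (simp add: p1_def norm_mult norm_sgn)
      show "cmod (p1 - z1) = \<bar>cmod z1 - a\<bar>"
      proof (cases "z1 = 0")
        case False
        have "z1 = of_real (cmod z1) * sgn z1" using False by (simp add: sgn_div_norm scaleR_conv_of_real)
        then have "p1 - z1 = of_real (a - cmod z1) * sgn z1" using False by (simp add: p1_def algebra_simps)
        then show ?thesis using False by (simp add: norm_mult norm_sgn abs_minus_commute del: of_real_diff)
      qed (use ab in \<open>simp add: p1_def\<close>)
    qed
    define p :: "complex \<times> complex" where "p = (p1, 0)"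
    define v where "v = p - \<Psi> c"
    have modp: "moduli p = (a, 0)" by (simp add: p_def moduli_def p1)
    have nv: "norm v \<le> \<epsilon>"
    proof -
      have "norm v = dist (moduli (\<Psi> c)) (a, 0)"
        unfolding v_def p_def by (cases "\<Psi> c") (use p1 z1_def in \<open>simp add: moduli_def dist_prod_def norm_Pair dist_norm\<close>)
      then show ?thesis using c by simp
    qed
    have Wp: "W p = 0" using modp by (intro zero) simp
    define \<Phi> where "\<Phi> y = \<Psi> (min y c) + (max (min y (c + 1)) c - c) *\<^sub>R v" for y
    define h where "h y = indicator {..c} y *\<^sub>R g y + indicator {..c + 1} y *\<^sub>R (indicator {c..} y *\<^sub>R v)" for y
    have "primitive_of (\<lambda>_. v) (\<lambda>y. (y - c) *\<^sub>R v)"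
      by (rule primitive_of_C1) (auto intro!: derivative_eq_intros continuous_intros)
    note Pv = primitive_of_stop[OF primitive_of_start[OF this, of c], of "c + 1"]
    have Ph: "primitive_of h \<Phi>"
      unfolding h_def[abs_def] \<Phi>_def[abs_def]
      by (rule primitive_of_add[OF primitive_of_stop[OF P(1)] Pv])
    have \<Phi>_left: "\<Phi> y = \<Psi> y" if "y \<le> c" for y using that by (simp add: \<Phi>_def)
    have \<Phi>_right: "\<Phi> y = p" if "y \<ge> c + 1" for y using that by (simp add: \<Phi>_def v_def)
    have h_left: "h y = g y" if "y < c" for y using that by (simp add: h_def)
    have h_mid: "norm (h y) \<le> \<epsilon>" if "y > c" for y
      using that nv \<epsilon> by (auto simp: h_def indicator_def)
    have h_right: "h y = 0" if "y > c + 1" for y using that by (simp add: h_def)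
    have \<Phi>_mid: "W (\<Phi> y) < \<eta> / 2" if "c \<le> y" "y \<le> c + 1" for y
    proof -
      have "\<Phi> y - p = - ((1 - (y - c)) *\<^sub>R v)" using that by (simp add: \<Phi>_def v_def algebra_simps)
      then have "norm (\<Phi> y - p) \<le> norm v"
        using that by (simp add: mult_left_le_one_le)
      then have "dist (moduli (\<Phi> y)) (a, 0) \<le> \<epsilon>"
        using dist_moduli_le[of "\<Phi> y" p] nv modp by simp
      then show ?thesis using \<epsilon> by (intro Wsmall) simp
    qed
    \<comment> \<open>An integrable majorant of the density of the new curve. At \<open>c\<close>
      itself \<open>h\<close> adds the contributions of both sides, so the comparison is made off
      this one point.\<close>
    define U where "U y = indicator {..c} y *\<^sub>R density \<Psi> g y + indicator {c..c + 1} y *\<^sub>R \<eta>" for y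
    have dI: "integrable lborel (density \<Psi> g)" using P(2) Wi by (rule density_integrable)
    have Ui: "integrable lborel U" unfolding U_def
      using integrable_mult_indicator[OF _ dI, of "{..c}"] by (intro Bochner_Integration.integrable_add) auto
    have le: "density \<Phi> h y \<le> U y" if yc: "y \<noteq> c" for y
    proof -
      consider "y < c" | "c < y" "y \<le> c + 1" | "y > c + 1" using yc by linarith
      then show ?thesis
      proof cases
        case 1
        then show ?thesis by (simp add: U_def density_def \<Phi>_left h_left)
      next
        case 2
        have "(norm (h y))\<^sup>2 \<le> \<epsilon>\<^sup>2" using h_mid[OF 2(1)] by (intro power_mono) auto
        then show ?thesis using 2 \<Phi>_mid[of y] \<epsilon>2 by (simp add: U_def density_def)
      next
        case 3
        then show ?thesis by (simp add: U_def density_def \<Phi>_right h_right Wp)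
      qed
    qed
    have AEle: "AE y in lborel. density \<Phi> h y \<le> U y"
      using AE_lborel_singleton[of c] by eventually_elim (rule le)
    have [measurable]: "h \<in> borel_measurable borel" by (rule locally_integrable_measurable[OF primitive_ofD(1)[OF Ph]])
    have [measurable]: "(\<lambda>x. W (\<Phi> x)) \<in> borel_measurable borel"
      using primitive_of_continuous[OF Ph] by (intro borel_measurable_continuous_onI continuous_W)
    have bound: "integrable lborel u" if "u \<in> borel_measurable borel" "\<And>y. 0 \<le> u y" "\<And>y. u y \<le> density \<Phi> h y" for u :: "real \<Rightarrow> real"
    proof (rule Bochner_Integration.integrable_bound[OF Ui])
      show "AE x in lborel. norm (u x) \<le> norm (U x)"
        using AEle
      proof eventually_elim
        case (elim y)
        then show ?case using that(2,3)[of y] by simp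
      qed
    qed (use that in simp)
    have sh: "square_integrable h"
      unfolding square_integrable_def by (intro conjI bound) (auto simp: density_def nonneg)
    have Wh: "integrable lborel (\<lambda>x. W (\<Phi> x))"
      by (intro bound) (auto simp: density_def nonneg)
    have "((\<lambda>x. dist (moduli (\<Phi> x)) (a, 0)) \<longlongrightarrow> 0) at_top"
      by (rule tendsto_eventually, rule eventually_mono[OF eventually_ge_at_top[of "c + 1"]])
         (simp add: \<Phi>_right modp)
    moreover have "((\<lambda>x. dist (moduli (\<Phi> x)) (0, b)) \<longlongrightarrow> 0) at_bot"
      by (rule Lim_transform_eventually[OF bot], rule eventually_mono[OF eventually_le_at_bot[of c]])
         (simp add: \<Phi>_left)
    ultimately have comp: "competitor \<Phi> h" using Ph sh Wh by (simp add: competitor_def)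
    have "total \<Phi> h \<le> (\<integral>x. U x \<partial>lborel)"
      unfolding density_integrable(2)[OF sh Wh]
      by (intro integral_mono_AE density_integrable sh Wh Ui AEle)
    also have "\<dots> = (LINT x:{..c}|lborel. density \<Psi> g x) + \<eta>"
      unfolding U_def using integrable_mult_indicator[OF _ dI, of "{..c}"]
      by (subst Bochner_Integration.integral_add) (auto simp: set_lebesgue_integral_def)
    finally show ?thesis using comp by blast
  qed
  then show ?thesis using that \<epsilon>(1) by blast
qed

text \<open>Beyond \<open>L\<close> the kinetic energy of \<open>\<Theta> n\<close> is small by
  strong convergence. So is its potential energy, because the total converges and by Fatou the part
  off \<open>{L..}\<close> does not drop in the limit. Starting near \<open>p\<close> at time
  \<open>L\<close>, the curve then has too little energy to leave. The claim holds for all large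
  \<open>L\<close> so that one \<open>L\<close> serves both ends of the line.\<close>

lemma tail_close:
  assumes p: "p \<in> {(a, 0), (0, b)}"
    and \<Theta>: "\<And>n. primitive_of (\<gamma> n) (\<Theta> n)" "\<And>n. square_integrable (\<gamma> n)" "\<And>n. integrable lborel (\<lambda>x. W (\<Theta> n x))"
    and \<Phi>: "primitive_of h \<Phi>" "square_integrable h" "integrable lborel (\<lambda>x. W (\<Phi> x))"
    and sq: "(\<lambda>n. sq_norm (\<lambda>x. \<gamma> n x - h x)) \<longlonglongrightarrow> 0"
    and Wl: "(\<lambda>n. \<integral>x. W (\<Theta> n x) \<partial>lborel) \<longlonglongrightarrow> (\<integral>x. W (\<Phi> x) \<partial>lborel)"
    and pw: "\<And>x. (\<lambda>n. \<Theta> n x) \<longlonglongrightarrow> \<Phi> x"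
    and lim: "((\<lambda>x. dist (moduli (\<Phi> x)) p) \<longlongrightarrow> 0) at_top"
    and e: "0 < e" "e \<le> gap / 2" and \<eta>: "\<eta> > 0"
  shows "\<exists>L0. \<forall>L\<ge>L0. (\<forall>x\<ge>L. dist (moduli (\<Phi> x)) p < e) \<and>
    (\<forall>\<^sub>F n in sequentially. (\<forall>x\<ge>L. dist (moduli (\<Theta> n x)) p < e) \<and>
      (LINT x:{L..}|lborel. W (\<Theta> n x)) + (LINT x:{L..}|lborel. W (\<Phi> x)) < \<eta>)"
proof -
  obtain \<kappa> where \<kappa>: "\<kappa> > 0" "\<And>\<Psi> g s t. primitive_of g \<Psi> \<Longrightarrow> g \<in> L2_loc \<Longrightarrow> s \<le> t \<Longrightarrow>
    dist (moduli (\<Psi> s)) p \<le> e / 2 \<and> e \<le> dist (moduli (\<Psi> t)) p \<or>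
    dist (moduli (\<Psi> t)) p \<le> e / 2 \<and> e \<le> dist (moduli (\<Psi> s)) p \<Longrightarrow>
    \<kappa> \<le> (LINT x:{s..t}|lborel. density \<Psi> g x)"
    using crossing_cost[OF e p] by blast
  \<comment> \<open>The tail of \<open>\<Theta> n\<close> costs less than \<open>6 * \<mu>\<close>:
    twice the tail of the limit, which is below \<open>\<mu>\<close>, plus \<open>2 * \<mu>\<close>
    each for the kinetic and the potential error.\<close>
  define \<mu> where "\<mu> = min \<kappa> \<eta> / 8"
  have \<mu>: "\<mu> > 0" "8 * \<mu> \<le> \<kappa>" "8 * \<mu> \<le> \<eta>" using \<kappa> \<eta> by (auto simp: \<mu>_def)
  note dI = density_integrable(1)[OF \<Phi>(2,3)]
  have "\<forall>\<^sub>F x in at_top. dist (moduli (\<Phi> x)) p < e / 2" using lim e by (intro order_tendstoD) auto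
  then obtain x0 where x0: "\<And>x. x \<ge> x0 \<Longrightarrow> dist (moduli (\<Phi> x)) p < e / 2" by (auto simp: eventually_at_top_linorder)
  obtain L0 where L0: "L0 \<ge> x0" "(LINT x:{L0..}|lborel. density \<Phi> h x) < \<mu>"
    using integrable_tail_small[OF dI density_nonneg \<mu>(1)] by blast
  have "(\<forall>x\<ge>L. dist (moduli (\<Phi> x)) p < e) \<and>
    (\<forall>\<^sub>F n in sequentially. (\<forall>x\<ge>L. dist (moduli (\<Theta> n x)) p < e) \<and>
      (LINT x:{L..}|lborel. W (\<Theta> n x)) + (LINT x:{L..}|lborel. W (\<Phi> x)) < \<eta>)" if L: "L \<ge> L0" for L
  proof (intro conjI allI impI)
    show "dist (moduli (\<Phi> x)) p < e" if "L \<le> x" for x using x0[of x] L L0 that e by force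
    have sP: "set_integrable lborel {L..} (\<lambda>x. (norm (h x))\<^sup>2)" "set_integrable lborel {L..} (\<lambda>x. W (\<Phi> x))"
      using \<Phi> by (auto intro!: integrable_set_integrable simp: square_integrable_def)
    have "(LINT x:{L..}|lborel. density \<Phi> h x) < \<mu>"
      using set_integral_le_if_subset[OF integrable_set_integrable[OF dI, of "{L0..}"], of "{L..}"] L L0 density_nonneg by force
    then have tP: "(LINT x:{L..}|lborel. (norm (h x))\<^sup>2) + (LINT x:{L..}|lborel. W (\<Phi> x)) < \<mu>"
      unfolding density_def using set_integral_add(2)[OF sP] by simp
    have tP0: "0 \<le> (LINT x:{L..}|lborel. (norm (h x))\<^sup>2)" "0 \<le> (LINT x:{L..}|lborel. W (\<Phi> x))"
      by (auto simp: set_lebesgue_integral_def nonneg)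
    have "\<forall>\<^sub>F n in sequentially. sq_norm (\<lambda>x. \<gamma> n x - h x) < \<mu>"
      using sq \<mu> by (intro order_tendstoD) auto
    moreover have "\<forall>\<^sub>F n in sequentially. (\<integral>x. W (\<Theta> n x) \<partial>lborel) < (\<integral>x. W (\<Phi> x) \<partial>lborel) + \<mu>"
      using Wl \<mu> by (intro order_tendstoD) auto
    moreover have "\<forall>\<^sub>F n in sequentially. (LINT x:-{L..}|lborel. W (\<Theta> n x)) > (LINT x:-{L..}|lborel. W (\<Phi> x)) - \<mu>"
    proof (rule set_integral_liminf)
      show "(\<lambda>n. W (\<Theta> n x)) \<longlonglongrightarrow> W (\<Phi> x)" for x
        using cont pw[of x] by (auto intro: continuous_on_tendsto_compose[of UNIV W])
    qed (use \<Theta> \<Phi> \<mu> nonneg in auto)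
    moreover have "\<forall>\<^sub>F n in sequentially. dist (moduli (\<Theta> n L)) p < e / 2"
    proof (rule order_tendstoD(2))
      have "continuous_on UNIV (\<lambda>z. dist (moduli z) p)" by (intro continuous_intros)
      then show "(\<lambda>n. dist (moduli (\<Theta> n L)) p) \<longlonglongrightarrow> dist (moduli (\<Phi> L)) p"
        using pw[of L] by (auto intro: continuous_on_tendsto_compose[of UNIV "\<lambda>z. dist (moduli z) p"])
      show "dist (moduli (\<Phi> L)) p < e / 2" using x0[of L] L L0 by simp
    qed
    ultimately show "\<forall>\<^sub>F n in sequentially. (\<forall>x\<ge>L. dist (moduli (\<Theta> n x)) p < e) \<and>
      (LINT x:{L..}|lborel. W (\<Theta> n x)) + (LINT x:{L..}|lborel. W (\<Phi> x)) < \<eta>"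
    proof eventually_elim
      case (elim n)
      have W2: "(LINT x:{L..}|lborel. W (\<Theta> n x)) < (LINT x:{L..}|lborel. W (\<Phi> x)) + 2 * \<mu>"
        using set_integral_add_compl[OF \<Theta>(3)[of n], of "{L..}"] set_integral_add_compl[OF \<Phi>(3), of "{L..}"] elim(2,3) by simp
      have si: "set_integrable lborel {L..} (\<lambda>x. (norm (\<gamma> n x))\<^sup>2)" "set_integrable lborel {L..} (\<lambda>x. (norm (\<gamma> n x - h x))\<^sup>2)"
        "set_integrable lborel {L..} (\<lambda>x. W (\<Theta> n x))"
        using \<Theta> square_integrable_diff[OF \<Theta>(2) \<Phi>(2), of n]
        by (auto intro!: integrable_set_integrable simp: square_integrable_def)
      have "(LINT x:{L..}|lborel. (norm (\<gamma> n x))\<^sup>2) \<le> (LINT x:{L..}|lborel. 2 * (norm (\<gamma> n x - h x))\<^sup>2 + 2 * (norm (h x))\<^sup>2)"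
      proof (intro set_integral_mono set_integral_add set_integrable_mult_right)
        show "(norm (\<gamma> n x))\<^sup>2 \<le> 2 * (norm (\<gamma> n x - h x))\<^sup>2 + 2 * (norm (h x))\<^sup>2" for x
          using norm_add_square_le[of "\<gamma> n x - h x" "h x"] by simp
      qed (use si sP in simp_all)
      also have "\<dots> = 2 * (LINT x:{L..}|lborel. (norm (\<gamma> n x - h x))\<^sup>2) + 2 * (LINT x:{L..}|lborel. (norm (h x))\<^sup>2)"
        using si sP by (subst set_integral_add) auto
      also have "\<dots> \<le> 2 * \<mu> + 2 * (LINT x:{L..}|lborel. (norm (h x))\<^sup>2)"
        using set_integral_square_le_sq_norm[OF square_integrable_diff[OF \<Theta>(2) \<Phi>(2)], of "{L..}" n] elim(1) by simp
      finally have tot: "(LINT x:{L..}|lborel. density (\<Theta> n) (\<gamma> n) x) < 8 * \<mu>"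
        unfolding density_def using set_integral_add(2)[OF si(1,3)] W2 tP tP0 by simp
      have "dist (moduli (\<Theta> n x)) p < e" if "x \<ge> L" for x
      proof (rule ccontr)
        assume "\<not> dist (moduli (\<Theta> n x)) p < e"
        then have "\<kappa> \<le> (LINT x:{L..x}|lborel. density (\<Theta> n) (\<gamma> n) x)"
          using elim(4) that by (intro \<kappa>(2) \<Theta> square_integrable_L2_loc) auto
        also have "\<dots> \<le> (LINT x:{L..}|lborel. density (\<Theta> n) (\<gamma> n) x)"
          by (intro set_integral_le_if_subset integrable_set_integrable density_integrable \<Theta> density_nonneg) auto
        finally show False using tot \<mu> by simp
      qed
      moreover have "(LINT x:{L..}|lborel. W (\<Theta> n x)) + (LINT x:{L..}|lborel. W (\<Phi> x)) < \<eta>"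
        using W2 tP tP0 \<mu> by simp
      ultimately show ?case by blast
    qed
  qed
  then show ?thesis by blast
qed

end

section \<open>Compactness of minimizing sequences\<close>

text \<open>Arzela-Ascoli on each interval \<open>{- real i..real i}\<close>, with equicontinuity
  from the common Hoelder bound, followed by a diagonal sequence.\<close>

lemma locally_uniform_subsequence:
  fixes F :: "nat \<Rightarrow> real \<Rightarrow> 'a::euclidean_space"
  assumes bd: "\<And>n x. norm (F n x) \<le> M"
    and eq: "\<And>n x y. (norm (F n x - F n y))\<^sup>2 \<le> \<bar>x - y\<bar> * K"
  obtains f k where "strict_mono (k :: nat \<Rightarrow> nat)" "\<And>R. uniform_limit {-R..R} (\<lambda>n. F (k n)) f sequentially"
proof -
  define P where "P i r \<longleftrightarrow> (\<exists>g. uniform_limit {- real i..real i} (\<lambda>n. F (r n)) g sequentially)" for i and r :: "nat \<Rightarrow> nat"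
  obtain k where k: "strict_mono (k :: nat \<Rightarrow> nat)" "\<And>i. P i (id \<circ> k)"
  proof (rule subsequence_diagonalization_lemma[of P id])
    fix i and r :: "nat \<Rightarrow> nat"
    let ?S = "{- real i..real i}"
    obtain g k where gk: "continuous_on ?S g" "strict_mono (k :: nat \<Rightarrow> nat)"
      "\<And>e. 0 < e \<Longrightarrow> \<exists>N. \<forall>n x. n \<ge> N \<and> x \<in> ?S \<longrightarrow> norm (F (r (k n)) x - g x) < e"
    proof (rule Arzela_Ascoli[of ?S "\<lambda>n. F (r n)" M])
      fix x e :: real assume "0 < e"
      \<comment> \<open>Solves \<open>d * (\<bar>K\<bar> + 1) = e\<^sup>2\<close> for the Hoelder
        modulus of continuity; the summand \<open>1\<close> covers \<open>K = 0\<close>.\<close>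
      define d where "d = e\<^sup>2 / (\<bar>K\<bar> + 1)"
      have "norm (F (r n) x - F (r n) y) < e" if "norm (x - y) < d" for n y
      proof (rule power2_less_imp_less)
        have "(norm (F (r n) x - F (r n) y))\<^sup>2 \<le> \<bar>x - y\<bar> * K" by (rule eq)
        also have "\<dots> \<le> \<bar>x - y\<bar> * (\<bar>K\<bar> + 1)" by (intro mult_left_mono) auto
        also have "\<dots> < d * (\<bar>K\<bar> + 1)" using that by (intro mult_strict_right_mono) auto
        also have "\<dots> = e\<^sup>2" by (simp add: d_def add_pos_nonneg)
        finally show "(norm (F (r n) x - F (r n) y))\<^sup>2 < e\<^sup>2" .
      qed (use \<open>0 < e\<close> in simp)
      moreover have "d > 0" using \<open>0 < e\<close> by (simp add: d_def add_nonneg_pos)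
      ultimately show "\<exists>d>0. \<forall>n y. y \<in> ?S \<and> norm (x - y) < d \<longrightarrow> norm (F (r n) x - F (r n) y) < e" by blast
    qed (use bd in auto)
    have "P i (r \<circ> k)"
      unfolding P_def uniform_limit_iff eventually_sequentially dist_norm o_def using gk(3) by blast
    then show "\<exists>k. strict_mono k \<and> P i (r \<circ> k)" using gk(2) by blast
  next
    fix i and r k1 k2 :: "nat \<Rightarrow> nat" and N
    assume "P i (r \<circ> k1)" and k2: "\<And>j. N \<le> j \<Longrightarrow> \<exists>j'\<ge>j. k2 j = k1 j'"
    then obtain g where g: "\<And>e. e > 0 \<Longrightarrow> \<exists>N. \<forall>n\<ge>N. \<forall>x\<in>{- real i..real i}. dist (F (r (k1 n)) x) (g x) < e"
      unfolding P_def uniform_limit_iff eventually_sequentially o_def by blast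
    have "\<exists>N. \<forall>n\<ge>N. \<forall>x\<in>{- real i..real i}. dist (F (r (k2 n)) x) (g x) < e" if e: "e > 0" for e
    proof -
      obtain N1 where "\<forall>n\<ge>N1. \<forall>x\<in>{- real i..real i}. dist (F (r (k1 n)) x) (g x) < e" using g[OF e] by blast
      then have "\<forall>n\<ge>max N N1. \<forall>x\<in>{- real i..real i}. dist (F (r (k2 n)) x) (g x) < e"
        using k2 by (metis (no_types, lifting) max.bounded_iff order_trans)
      then show ?thesis by blast
    qed
    then show "P i (r \<circ> k2)" unfolding P_def uniform_limit_iff eventually_sequentially o_def by blast
  qed (rule that)
  \<comment> \<open>The pointwise limit agrees with the uniform limits on the different intervals
    and merges them into one function.\<close>
  define f where "f x = lim (\<lambda>n. F (k n) x)" for x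
  have "uniform_limit {-R..R} (\<lambda>n. F (k n)) f sequentially" for R
  proof -
    obtain i :: nat where i: "R \<le> real i" using real_arch_simple by blast
    obtain g where g: "uniform_limit {- real i..real i} (\<lambda>n. F (k n)) g sequentially"
      using k(2)[of i] by (auto simp: P_def)
    have "g x = f x" if "x \<in> {- real i..real i}" for x
      using tendsto_uniform_limitI[OF g that] by (simp add: f_def limI)
    then have "uniform_limit {- real i..real i} (\<lambda>n. F (k n)) f sequentially"
      using g uniform_limit_cong'[of "{- real i..real i}" "\<lambda>n. F (k n)" "\<lambda>n. F (k n)" g f] by simp
    then show ?thesis by (rule uniform_limit_on_subset) (use i in auto)
  qed
  then show ?thesis using that k(1) by blast
qed

context double_well
begin

lemma competitor_translate:
  assumes "competitor \<Psi> g"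
  shows "competitor (\<lambda>x. \<Psi> (x + \<tau>)) (\<lambda>x. g (x + \<tau>))" "total (\<lambda>x. \<Psi> (x + \<tau>)) (\<lambda>x. g (x + \<tau>)) = total \<Psi> g"
proof -
  have top: "LIM x at_top. x + \<tau> :> (at_top :: real filter)"
    unfolding filterlim_at_top
    by (intro allI eventually_mono[OF eventually_ge_at_top[of "_ - \<tau>"]]) (simp add: diff_le_eq)
  have bot: "LIM x at_bot. x + \<tau> :> (at_bot :: real filter)"
    unfolding filterlim_at_bot
    by (intro allI eventually_mono[OF eventually_le_at_bot[of "_ - \<tau>"]]) (simp add: le_diff_eq)
  show "competitor (\<lambda>x. \<Psi> (x + \<tau>)) (\<lambda>x. g (x + \<tau>))"
    unfolding competitor_def
  proof (intro conjI)
    note c = assms[unfolded competitor_def]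
    show "primitive_of (\<lambda>x. g (x + \<tau>)) (\<lambda>x. \<Psi> (x + \<tau>))" using c primitive_of_translate by blast
    show "square_integrable (\<lambda>x. g (x + \<tau>))" using c square_integrable_translate(1) by blast
    show "integrable lborel (\<lambda>x. W (\<Psi> (x + \<tau>)))"
      using c integral_translate(2)[of "\<lambda>x. W (\<Psi> x)" \<tau>] by simp
    show "((\<lambda>x. dist (moduli (\<Psi> (x + \<tau>))) (a, 0)) \<longlongrightarrow> 0) at_top"
      using filterlim_compose[OF _ top, of "\<lambda>x. dist (moduli (\<Psi> x)) (a, 0)"] c by blast
    show "((\<lambda>x. dist (moduli (\<Psi> (x + \<tau>))) (0, b)) \<longlongrightarrow> 0) at_bot"
      using filterlim_compose[OF _ bot, of "\<lambda>x. dist (moduli (\<Psi> x)) (0, b)"] c by blast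
  qed
  show "total (\<lambda>x. \<Psi> (x + \<tau>)) (\<lambda>x. g (x + \<tau>)) = total \<Psi> g"
    using assms square_integrable_translate(2)[of g \<tau>] integral_translate(1)[of "\<lambda>x. W (\<Psi> x)" \<tau>]
    by (simp add: competitor_def total_def)
qed

lemma dist_moduli_tendsto:
  assumes "(\<lambda>n. \<Theta> n) \<longlonglongrightarrow> z"
  shows "(\<lambda>n. dist (moduli (\<Theta> n)) p) \<longlonglongrightarrow> dist (moduli z) p"
proof -
  have "continuous_on UNIV (\<lambda>z. dist (moduli z) p)" by (intro continuous_intros)
  then show ?thesis using assms by (auto intro: continuous_on_tendsto_compose[of UNIV "\<lambda>z. dist (moduli z) p"])
qed

lemma limit_competitor:
  assumes \<Theta>: "\<And>n. competitor (\<Theta> n) (\<gamma> n)" and lim: "(\<lambda>n. total (\<Theta> n) (\<gamma> n)) \<longlonglongrightarrow> M"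
    and lower: "\<And>\<Phi> h. competitor \<Phi> h \<Longrightarrow> M \<le> total \<Phi> h"
    and pw: "\<And>x. (\<lambda>n. \<Theta> n x) \<longlonglongrightarrow> \<Phi> x"
    and \<Phi>: "primitive_of h \<Phi>" "square_integrable h" "integrable lborel (\<lambda>x. W (\<Phi> x))"
    and at0: "\<And>n. cmod (fst (\<Theta> n 0)) \<le> a / 2" and pos: "\<And>n x. x > 0 \<Longrightarrow> cmod (fst (\<Theta> n x)) \<ge> a / 2"
  shows "competitor \<Phi> h"
proof -
  have pw1: "(\<lambda>n. cmod (fst (\<Theta> n x))) \<longlonglongrightarrow> cmod (fst (\<Phi> x))" for x
    by (intro tendsto_intros pw)
  have "((\<lambda>x. dist (moduli (\<Phi> x)) (a, 0)) \<longlongrightarrow> 0) at_top"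
  proof (rule tail_limit[OF \<Phi>])
    show "a / 2 \<le> dist (moduli (\<Phi> x)) (0, b)" if "x \<ge> 1" for x
    proof -
      have "a / 2 \<le> cmod (fst (\<Phi> x))"
        using that pos[of x] by (intro LIMSEQ_le_const[OF pw1]) auto
      also have "\<dots> \<le> dist (moduli (\<Phi> x)) (0, b)"
        using dist_fst_le[of "moduli (\<Phi> x)" "(0, b)"] by (simp add: moduli_def dist_real_def)
      finally show ?thesis .
    qed
  qed (use ab in auto)
  moreover have "((\<lambda>x. dist (moduli (\<Phi> x)) (0, b)) \<longlongrightarrow> 0) at_bot"
  proof (rule ccontr)
    assume contr: "\<not> ?thesis"
    \<comment> \<open>If the limit kept a distance from \<open>(a, 0)\<close> on the left,
      \<open>tail_limit_bot\<close> would make it converge to \<open>(0, b)\<close> there.\<close>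
    have near: "\<exists>x\<le>0. dist (moduli (\<Phi> x)) (a, 0) < e'" if "e' > 0" for e'
      using tail_limit_bot[OF \<Phi>, of "(0, b)" "(a, 0)" e' 0] contr that by force
    \<comment> \<open>At time \<open>0\<close> the first modulus is at most \<open>a / 2\<close>, so
      the distance to \<open>(a, 0)\<close> is at least \<open>a / 2\<close>; with
      \<open>e \<le> a / 2\<close> the curve has left the annulus around \<open>(a, 0)\<close> by
      then.\<close>
    define e where "e = min (gap / 2) (a / 2)"
    have e: "0 < e" "e \<le> gap / 2" "e \<le> a / 2" using gap_pos ab by (auto simp: e_def)
    obtain \<kappa> where \<kappa>: "\<kappa> > 0" "\<And>\<Psi> g s t. primitive_of g \<Psi> \<Longrightarrow> g \<in> L2_loc \<Longrightarrow> s \<le> t \<Longrightarrow>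
      dist (moduli (\<Psi> s)) (a, 0) \<le> e / 2 \<and> e \<le> dist (moduli (\<Psi> t)) (a, 0) \<or>
      dist (moduli (\<Psi> t)) (a, 0) \<le> e / 2 \<and> e \<le> dist (moduli (\<Psi> s)) (a, 0) \<Longrightarrow>
      \<kappa> \<le> (LINT x:{s..t}|lborel. density \<Psi> g x)"
      using crossing_cost[OF e(1,2), of "(a, 0)"] by auto
    obtain \<epsilon> where \<epsilon>: "\<epsilon> > 0" "\<And>\<Psi> g c. primitive_of g \<Psi> \<Longrightarrow> square_integrable g \<Longrightarrow> integrable lborel (\<lambda>x. W (\<Psi> x)) \<Longrightarrow>
      ((\<lambda>x. dist (moduli (\<Psi> x)) (0, b)) \<longlongrightarrow> 0) at_bot \<Longrightarrow> dist (moduli (\<Psi> c)) (a, 0) \<le> \<epsilon> \<Longrightarrow>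
      \<exists>\<Phi> h. competitor \<Phi> h \<and> total \<Phi> h \<le> (LINT x:{..c}|lborel. density \<Psi> g x) + \<kappa> / 2"
      using connection[of "\<kappa> / 2"] \<kappa>(1) by auto
    define e' where "e' = min \<epsilon> (e / 2)"
    have "e' > 0" using \<epsilon>(1) e(1) by (simp add: e'_def)
    from near[OF this] obtain x where x: "x \<le> 0" "dist (moduli (\<Phi> x)) (a, 0) < e'" by blast
    have "\<forall>\<^sub>F n in sequentially. dist (moduli (\<Theta> n x)) (a, 0) < e'"
      using dist_moduli_tendsto[OF pw] x(2) by (intro order_tendstoD) auto
    moreover have "\<forall>\<^sub>F n in sequentially. total (\<Theta> n) (\<gamma> n) < M + \<kappa> / 2"
      using lim \<kappa>(1) by (intro order_tendstoD) auto
    ultimately have "\<forall>\<^sub>F n in sequentially. False"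
    proof eventually_elim
      case (elim n)
      note c = \<Theta>[of n, unfolded competitor_def]
      have dI: "integrable lborel (density (\<Theta> n) (\<gamma> n))" "total (\<Theta> n) (\<gamma> n) = (\<integral>x. density (\<Theta> n) (\<gamma> n) x \<partial>lborel)"
        using c by (auto intro: density_integrable)
      have "a / 2 \<le> dist (moduli (\<Theta> n 0)) (a, 0)"
        using dist_fst_le[of "moduli (\<Theta> n 0)" "(a, 0)"] at0[of n] by (simp add: moduli_def dist_real_def)
      then have "\<kappa> \<le> (LINT x:{x..0}|lborel. density (\<Theta> n) (\<gamma> n) x)"
        using c x elim(1) e by (intro \<kappa>(2)) (auto intro: square_integrable_L2_loc simp: e'_def)
      moreover obtain \<Phi>' h' where "competitor \<Phi>' h'"
        "total \<Phi>' h' \<le> (LINT x:{..x}|lborel. density (\<Theta> n) (\<gamma> n) x) + \<kappa> / 2"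
        using \<epsilon>(2)[of "\<gamma> n" "\<Theta> n" x] c elim(1) by (auto simp: e'_def)
      \<comment> \<open>Cutting at \<open>x\<close> drops a part of cost at least
        \<open>\<kappa>\<close> and adds at most \<open>\<kappa> / 2\<close>, so the new competitor
        has total below \<open>(M + \<kappa> / 2) - \<kappa> + \<kappa> / 2 = M\<close>.\<close>
      ultimately show False
        using set_integral_ray_interval_le[OF dI(1) density_nonneg, of x 0] lower[of \<Phi>' h'] dI(2) elim(2) by linarith
    qed
    then show False by simp
  qed
  ultimately show ?thesis using \<Phi> by (simp add: competitor_def)
qed

lemma exists_translation:
  assumes "competitor \<Psi> g"
  obtains \<tau> where "cmod (fst (\<Psi> \<tau>)) \<le> a / 2" "\<And>x. x > \<tau> \<Longrightarrow> cmod (fst (\<Psi> x)) > a / 2"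
proof (rule last_time_below[of "\<lambda>x. cmod (fst (\<Psi> x))" "a / 2"])
  note c = assms[unfolded competitor_def]
  show "continuous_on UNIV (\<lambda>x. cmod (fst (\<Psi> x)))"
    using c primitive_of_continuous by (intro continuous_intros) blast
  have "\<forall>\<^sub>F x in at_top. dist (moduli (\<Psi> x)) (a, 0) < a / 2"
    using c ab by (intro order_tendstoD) auto
  then show "\<forall>\<^sub>F x in at_top. a / 2 < cmod (fst (\<Psi> x))"
  proof eventually_elim
    case (elim x)
    then show ?case using dist_fst_le[of "moduli (\<Psi> x)" "(a, 0)"] by (simp add: moduli_def dist_real_def abs_less_iff)
  qed
  have "\<forall>\<^sub>F x in at_bot. dist (moduli (\<Psi> x)) (0, b) < a / 2"
    using c ab by (intro order_tendstoD) auto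
  then show "\<forall>\<^sub>F x in at_bot. cmod (fst (\<Psi> x)) < a / 2"
  proof eventually_elim
    case (elim x)
    then show ?case using dist_fst_le[of "moduli (\<Psi> x)" "(0, b)"] by (simp add: moduli_def dist_real_def)
  qed
qed (use that in blast)

text \<open>Neither part of the energy can drop in the limit from below its limiting value, and
  their sum converges to \<open>M\<close>, which is a lower bound for the total of the limit. So
  each part converges separately; for the kinetic part this is the norm convergence required by
  \<open>strong_convergence\<close>.\<close>

lemma minimizing_limit:
  assumes comp: "\<And>n. competitor (\<Psi> n) (g n)"
    and lower: "\<And>\<Phi> h. competitor \<Phi> h \<Longrightarrow> M \<le> total \<Phi> h"
    and lim: "(\<lambda>n. total (\<Psi> n) (g n)) \<longlonglongrightarrow> M"
  obtains \<Phi> h \<tau> k where "competitor \<Phi> h" "total \<Phi> h = M" "strict_mono (k :: nat \<Rightarrow> nat)"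
    "\<And>R. uniform_limit {-R..R} (\<lambda>n x. \<Psi> (k n) (x + \<tau> (k n))) \<Phi> sequentially"
    "(\<lambda>n. sq_norm (\<lambda>x. g (k n) (x + \<tau> (k n)) - h x)) \<longlonglongrightarrow> 0"
    "(\<lambda>n. \<integral>x. W (\<Psi> (k n) (x + \<tau> (k n))) \<partial>lborel) \<longlonglongrightarrow> (\<integral>x. W (\<Phi> x) \<partial>lborel)"
proof -
  have "\<exists>\<tau>. cmod (fst (\<Psi> n \<tau>)) \<le> a / 2 \<and> (\<forall>x>\<tau>. cmod (fst (\<Psi> n x)) > a / 2)" for n
    using exists_translation[OF comp] by metis
  then obtain \<tau> where \<tau>: "\<And>n. cmod (fst (\<Psi> n (\<tau> n))) \<le> a / 2" "\<And>n x. x > \<tau> n \<Longrightarrow> cmod (fst (\<Psi> n x)) > a / 2"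
    by metis
  obtain K where K: "\<And>n. total (\<Psi> n) (g n) \<le> K"
    using Bseq_eq_bounded[of "\<lambda>n. total (\<Psi> n) (g n)"] convergent_imp_Bseq[OF convergentI[OF lim]]
    by (metis BseqD abs_le_D1 real_norm_def)
  define \<Theta>0 \<gamma>0 where "\<Theta>0 n x = \<Psi> n (x + \<tau> n)" and "\<gamma>0 n x = g n (x + \<tau> n)" for n x
  have c0: "competitor (\<Theta>0 n) (\<gamma>0 n)" and t0: "total (\<Theta>0 n) (\<gamma>0 n) = total (\<Psi> n) (g n)" for n
    unfolding \<Theta>0_def[abs_def] \<gamma>0_def[abs_def] by (auto intro: competitor_translate comp)
  have dK: "(LINT u:{s..t}|lborel. density (\<Theta>0 n) (\<gamma>0 n) u) \<le> K" for s t n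
  proof -
    have "(LINT u:{s..t}|lborel. density (\<Theta>0 n) (\<gamma>0 n) u) \<le> total (\<Theta>0 n) (\<gamma>0 n)"
      using c0[of n] density_nonneg unfolding competitor_def
      by (subst density_integrable(2)) (auto intro!: set_integral_le_integral density_integrable)
    then show ?thesis using K[of n] t0[of n] by simp
  qed
  obtain B where B: "\<And>\<Psi> g x. primitive_of g \<Psi> \<Longrightarrow> g \<in> L2_loc \<Longrightarrow>
    (\<And>s t. (LINT u:{s..t}|lborel. density \<Psi> g u) \<le> K) \<Longrightarrow> norm (\<Psi> x) \<le> B"
    using uniform_bound[of K] by blast
  have P0: "primitive_of (\<gamma>0 n) (\<Theta>0 n)" "square_integrable (\<gamma>0 n)" "integrable lborel (\<lambda>x. W (\<Theta>0 n x))" for n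
    using c0[of n] by (auto simp: competitor_def)
  obtain \<Phi> k where k: "strict_mono (k :: nat \<Rightarrow> nat)" "\<And>R. uniform_limit {-R..R} (\<lambda>n. \<Theta>0 (k n)) \<Phi> sequentially"
  proof (rule locally_uniform_subsequence[of \<Theta>0 B K])
    show "norm (\<Theta>0 n x) \<le> B" for n x
      using P0[of n] dK by (intro B square_integrable_L2_loc) auto
    show "(norm (\<Theta>0 n x - \<Theta>0 n y))\<^sup>2 \<le> \<bar>x - y\<bar> * K" for n x y
    proof -
      have "(norm (\<Theta>0 n x - \<Theta>0 n y))\<^sup>2 \<le> \<bar>x - y\<bar> * (LINT u:{min x y..max x y}|lborel. density (\<Theta>0 n) (\<gamma>0 n) u)"
        using P0[of n] by (intro dist_moduli_Hoelder square_integrable_L2_loc) auto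
      also have "\<dots> \<le> \<bar>x - y\<bar> * K" by (intro mult_left_mono dK) auto
      finally show ?thesis .
    qed
  qed (rule that)
  define \<Theta> \<gamma> where "\<Theta> n = \<Theta>0 (k n)" and "\<gamma> n = \<gamma>0 (k n)" for n
  have u: "uniform_limit {-R..R} \<Theta> \<Phi> sequentially" for R using k(2)[of R] by (simp add: \<Theta>_def[abs_def])
  have P: "primitive_of (\<gamma> n) (\<Theta> n)" "square_integrable (\<gamma> n)" "integrable lborel (\<lambda>x. W (\<Theta> n x))" for n
    using P0 by (auto simp: \<Theta>_def \<gamma>_def)
  have pw: "(\<lambda>n. \<Theta> n x) \<longlonglongrightarrow> \<Phi> x" for x
    by (rule tendsto_uniform_limitI[OF u[of "\<bar>x\<bar>"]]) auto
  then have pwW: "(\<lambda>n. W (\<Theta> n x)) \<longlonglongrightarrow> W (\<Phi> x)" for x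
    using cont by (auto intro: continuous_on_tendsto_compose[of UNIV W])
  have tl: "(\<lambda>n. total (\<Theta> n) (\<gamma> n)) \<longlonglongrightarrow> M"
    using LIMSEQ_subseq_LIMSEQ[OF lim k(1)] by (simp add: o_def \<Theta>_def \<gamma>_def t0)
  have tK: "sq_norm (\<gamma> n) \<le> K" "(\<integral>x. W (\<Theta> n x) \<partial>lborel) \<le> K" for n
  proof -
    have "total (\<Theta> n) (\<gamma> n) \<le> K" using K[of "k n"] t0 by (simp add: \<Theta>_def \<gamma>_def)
    moreover have "(\<integral>x. W (\<Theta> n x) \<partial>lborel) \<ge> 0" by (simp add: nonneg)
    ultimately show "sq_norm (\<gamma> n) \<le> K" "(\<integral>x. W (\<Theta> n x) \<partial>lborel) \<le> K"
      using sq_norm_nonneg[of "\<gamma> n"] by (auto simp: total_def)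
  qed
  obtain h where h: "primitive_of h \<Phi>" "square_integrable h"
    using weak_lower_semicontinuity[OF P(1,2) tK(1) u] by blast
  have "(\<lambda>x. W (\<Phi> x)) \<in> borel_measurable lborel"
    using primitive_of_continuous[OF h(1)] borel_measurable_continuous_onI[OF continuous_W] by auto
  then have Wi: "integrable lborel (\<lambda>x. W (\<Phi> x))"
    by (rule integral_le_if_tendsto(1)[where u = "\<lambda>n x. W (\<Theta> n x)", OF P(3) nonneg tK(2)]) (intro AE_I2 pwW)
  have comp\<Phi>: "competitor \<Phi> h"
  proof (rule limit_competitor[OF _ tl lower pw h Wi])
    show "competitor (\<Theta> n) (\<gamma> n)" for n using c0 by (simp add: \<Theta>_def \<gamma>_def)
    show "cmod (fst (\<Theta> n 0)) \<le> a / 2" for n using \<tau>(1) by (simp add: \<Theta>_def \<Theta>0_def)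
    show "a / 2 \<le> cmod (fst (\<Theta> n x))" if "x > 0" for n x
      using \<tau>(2)[of "k n" "x + \<tau> (k n)"] that by (simp add: \<Theta>_def \<Theta>0_def)
  qed
  \<comment> \<open>Once \<open>total \<Phi> h = M\<close> is known, two lower bounds with error
    \<open>e\<close> and one upper bound for the sum confine each part to within
    \<open>2 * e\<close> of its limit; hence the later use with \<open>e / 2\<close>.\<close>
  have ev: "\<forall>\<^sub>F n in sequentially. sq_norm (\<gamma> n) > sq_norm h - e \<and> (\<integral>x. W (\<Theta> n x) \<partial>lborel) > (\<integral>x. W (\<Phi> x) \<partial>lborel) - e
      \<and> total (\<Theta> n) (\<gamma> n) < M + e" if "e > 0" for e
  proof (intro eventually_conj)
    show "\<forall>\<^sub>F n in sequentially. sq_norm (\<gamma> n) > sq_norm h - e" by (rule sq_norm_liminf[OF P(1,2) u h that])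
    show "\<forall>\<^sub>F n in sequentially. (\<integral>x. W (\<Theta> n x) \<partial>lborel) > (\<integral>x. W (\<Phi> x) \<partial>lborel) - e"
      by (rule integral_liminf[OF P(3) nonneg Wi AE_I2[OF pwW] that])
    show "\<forall>\<^sub>F n in sequentially. total (\<Theta> n) (\<gamma> n) < M + e" using tl that by (intro order_tendstoD) auto
  qed
  have le: "total \<Phi> h \<le> M"
  proof (rule field_le_epsilon)
    fix e :: real assume "e > 0"
    then have "e / 3 > 0" by simp
    from eventually_happens'[OF sequentially_bot ev[OF this]]
    show "total \<Phi> h \<le> M + e" by (auto simp: total_def)
  qed
  then have tot: "total \<Phi> h = M" using lower[OF comp\<Phi>] by simp
  have "(\<lambda>n. sq_norm (\<gamma> n)) \<longlonglongrightarrow> sq_norm h"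
  proof (rule tendstoI)
    fix e :: real assume "e > 0"
    then have "e / 2 > 0" by simp
    from ev[OF this] show "\<forall>\<^sub>F n in sequentially. dist (sq_norm (\<gamma> n)) (sq_norm h) < e"
      by eventually_elim (use tot \<open>e > 0\<close> in \<open>auto simp: total_def dist_real_def abs_less_iff\<close>)
  qed
  from strong_convergence[OF P(1,2) u h this] have sc: "(\<lambda>n. sq_norm (\<lambda>x. \<gamma> n x - h x)) \<longlonglongrightarrow> 0" .
  have Wc: "(\<lambda>n. \<integral>x. W (\<Theta> n x) \<partial>lborel) \<longlonglongrightarrow> (\<integral>x. W (\<Phi> x) \<partial>lborel)"
  proof (rule tendstoI)
    fix e :: real assume "e > 0"
    then have "e / 2 > 0" by simp
    from ev[OF this] show "\<forall>\<^sub>F n in sequentially. dist (\<integral>x. W (\<Theta> n x) \<partial>lborel) (\<integral>x. W (\<Phi> x) \<partial>lborel) < e"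
      by eventually_elim (use tot \<open>e > 0\<close> in \<open>auto simp: total_def dist_real_def abs_less_iff\<close>)
  qed
  show ?thesis
    using that[OF comp\<Phi> tot k(1), of \<tau>] u sc Wc
    by (simp add: \<Theta>_def[abs_def] \<gamma>_def[abs_def] \<Theta>0_def[abs_def] \<gamma>0_def[abs_def])
qed

end

section \<open>L^2 convergence of the moduli\<close>

context double_well
begin

text \<open>On \<open>{-L..L}\<close> the convergence is uniform. Outside, both curves are close to
  the same well, so the quadratic growth of \<open>W\<close> bounds the squared difference of the
  moduli by \<open>(2 / c)\<close> times the sum of their potentials, whose tail integrals are small
  by \<open>tail_close\<close>.\<close>

lemma moduli_convergence:
  assumes \<Theta>: "\<And>n. competitor (\<Theta> n) (\<gamma> n)" and \<Phi>: "competitor \<Phi> h"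
    and u: "\<And>R. uniform_limit {-R..R} \<Theta> \<Phi> sequentially"
    and sq: "(\<lambda>n. sq_norm (\<lambda>x. \<gamma> n x - h x)) \<longlonglongrightarrow> 0"
    and Wl: "(\<lambda>n. \<integral>x. W (\<Theta> n x) \<partial>lborel) \<longlonglongrightarrow> (\<integral>x. W (\<Phi> x) \<partial>lborel)"
    and e: "e > 0"
  shows "\<forall>\<^sub>F n in sequentially. square_integrable (\<lambda>x. moduli (\<Theta> n x) - moduli (\<Phi> x)) \<and>
    sq_norm (\<lambda>x. moduli (\<Theta> n x) - moduli (\<Phi> x)) < e"
proof -
  obtain r c where rc: "r > 0" "c > 0"
    "\<And>z p. p \<in> {(a, 0), (0, b)} \<Longrightarrow> dist (moduli z) p \<le> r \<Longrightarrow> c * (dist (moduli z) p)\<^sup>2 \<le> W z"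
    using quadratic by blast
  define e0 where "e0 = min r (gap / 2)"
  have e0: "0 < e0" "e0 \<le> gap / 2" "e0 \<le> r" using rc gap_pos by (auto simp: e0_def)
  \<comment> \<open>The two tails together contribute less than
    \<open>(2 / c) * (\<eta> + \<eta>) = e / 4\<close>, and the middle part is allotted
    \<open>e / 2\<close>.\<close>
  define \<eta> where "\<eta> = c * e / 16"
  have \<eta>: "\<eta> > 0" using rc e by (simp add: \<eta>_def)
  have P: "primitive_of (\<gamma> n) (\<Theta> n)" "square_integrable (\<gamma> n)" "integrable lborel (\<lambda>x. W (\<Theta> n x))" for n
    using \<Theta> by (auto simp: competitor_def)
  have Q: "primitive_of h \<Phi>" "square_integrable h" "integrable lborel (\<lambda>x. W (\<Phi> x))"
    "((\<lambda>x. dist (moduli (\<Phi> x)) (a, 0)) \<longlongrightarrow> 0) at_top" "((\<lambda>x. dist (moduli (\<Phi> x)) (0, b)) \<longlongrightarrow> 0) at_bot"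
    using \<Phi> by (auto simp: competitor_def)
  have pw: "(\<lambda>n. \<Theta> n x) \<longlonglongrightarrow> \<Phi> x" for x
    by (rule tendsto_uniform_limitI[OF u[of "\<bar>x\<bar>"]]) auto
  have "\<exists>L0. \<forall>L\<ge>L0. (\<forall>x\<ge>L. dist (moduli (\<Phi> x)) (a, 0) < e0) \<and>
    (\<forall>\<^sub>F n in sequentially. (\<forall>x\<ge>L. dist (moduli (\<Theta> n x)) (a, 0) < e0) \<and>
      (LINT x:{L..}|lborel. W (\<Theta> n x)) + (LINT x:{L..}|lborel. W (\<Phi> x)) < \<eta>)"
    by (rule tail_close[OF _ P Q(1-3) sq Wl pw Q(4) e0(1,2) \<eta>]) simp
  then obtain L1 where L1: "\<And>L. L \<ge> L1 \<Longrightarrow> (\<forall>x\<ge>L. dist (moduli (\<Phi> x)) (a, 0) < e0) \<and>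
    (\<forall>\<^sub>F n in sequentially. (\<forall>x\<ge>L. dist (moduli (\<Theta> n x)) (a, 0) < e0) \<and>
      (LINT x:{L..}|lborel. W (\<Theta> n x)) + (LINT x:{L..}|lborel. W (\<Phi> x)) < \<eta>)" by blast
  \<comment> \<open>The left tail is the right tail of the reflected curves, now at the well
    \<open>(0, b)\<close>.\<close>
  have "\<exists>L0. \<forall>L\<ge>L0. (\<forall>x\<ge>L. dist (moduli (\<Phi> (- x))) (0, b) < e0) \<and>
    (\<forall>\<^sub>F n in sequentially. (\<forall>x\<ge>L. dist (moduli (\<Theta> n (- x))) (0, b) < e0) \<and>
      (LINT x:{L..}|lborel. W (\<Theta> n (- x))) + (LINT x:{L..}|lborel. W (\<Phi> (- x))) < \<eta>)"
  proof (rule tail_close[where \<gamma> = "\<lambda>n x. - \<gamma> n (- x)" and h = "\<lambda>x. - h (- x)"])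
    show "primitive_of (\<lambda>x. - \<gamma> n (- x)) (\<lambda>x. \<Theta> n (- x))" for n by (intro primitive_of_reflect P)
    show "primitive_of (\<lambda>x. - h (- x)) (\<lambda>x. \<Phi> (- x))" by (intro primitive_of_reflect Q)
    show "square_integrable (\<lambda>x. - \<gamma> n (- x))" for n by (intro square_integrable_reflect P)
    show "square_integrable (\<lambda>x. - h (- x))" by (intro square_integrable_reflect Q)
    show "integrable lborel (\<lambda>x. W (\<Theta> n (- x)))" for n using P(3) integral_reflect(2)[of "\<lambda>x. W (\<Theta> n x)"] by simp
    show "integrable lborel (\<lambda>x. W (\<Phi> (- x)))" using Q(3) integral_reflect(2)[of "\<lambda>x. W (\<Phi> x)"] by simp
    have "sq_norm (\<lambda>x. - \<gamma> n (- x) - - h (- x)) = sq_norm (\<lambda>x. \<gamma> n x - h x)" for n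
      using integral_reflect(1)[of "\<lambda>x. (norm (\<gamma> n x - h x))\<^sup>2"] by (simp add: sq_norm_def norm_minus_commute)
    then show "(\<lambda>n. sq_norm (\<lambda>x. - \<gamma> n (- x) - - h (- x))) \<longlonglongrightarrow> 0" using sq by simp
    show "(\<lambda>n. \<integral>x. W (\<Theta> n (- x)) \<partial>lborel) \<longlonglongrightarrow> (\<integral>x. W (\<Phi> (- x)) \<partial>lborel)"
      using Wl integral_reflect(1)[of "\<lambda>x. W (\<Phi> x)"] integral_reflect(1)[of "\<lambda>x. W (\<Theta> _ x)"] by simp
    show "(\<lambda>n. \<Theta> n (- x)) \<longlonglongrightarrow> \<Phi> (- x)" for x by (rule pw)
    show "((\<lambda>x. dist (moduli (\<Phi> (- x))) (0, b)) \<longlongrightarrow> 0) at_top" using Q(5) unfolding filterlim_at_bot_mirror .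
  qed (use e0 \<eta> in auto)
  then obtain L2 where L2: "\<And>L. L \<ge> L2 \<Longrightarrow> (\<forall>x\<ge>L. dist (moduli (\<Phi> (- x))) (0, b) < e0) \<and>
    (\<forall>\<^sub>F n in sequentially. (\<forall>x\<ge>L. dist (moduli (\<Theta> n (- x))) (0, b) < e0) \<and>
      (LINT x:{L..}|lborel. W (\<Theta> n (- x))) + (LINT x:{L..}|lborel. W (\<Phi> (- x))) < \<eta>)" by blast
  define L where "L = max 1 (max L1 L2)"
  have L: "L > 0" "L \<ge> L1" "L \<ge> L2" by (auto simp: L_def)
  define s where "s = sqrt (e / (4 * L))"
  have s: "s > 0" "s\<^sup>2 * (2 * L) = e / 2" using e L by (auto simp: s_def)
  have sum_sq: "(norm (v - w))\<^sup>2 \<le> (2 / c) * (W z + W z')"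
    if "v = moduli z" "w = moduli z'" "p \<in> {(a, 0), (0, b)}" "dist v p < e0" "dist w p < e0" for v w p z z'
  proof -
    have "(norm (v - w))\<^sup>2 = (norm ((v - p) + (p - w)))\<^sup>2" by simp
    also have "\<dots> \<le> 2 * (norm (v - p))\<^sup>2 + 2 * (norm (p - w))\<^sup>2" by (rule norm_add_square_le)
    also have "\<dots> = (2 / c) * (c * (dist v p)\<^sup>2 + c * (dist w p)\<^sup>2)"
      using rc by (simp add: dist_norm norm_minus_commute field_simps)
    also have "\<dots> \<le> (2 / c) * (W z + W z')"
      using rc(3)[OF that(3), of z] rc(3)[OF that(3), of z'] rc(2) that e0(3)
      by (intro mult_left_mono add_mono) auto
    finally show ?thesis .
  qed
  have "\<forall>\<^sub>F n in sequentially. \<forall>x\<in>{-L..L}. dist (\<Theta> n x) (\<Phi> x) < s"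
    using s by (intro uniform_limitD[OF u])
  then show ?thesis
    using L1[OF L(2), THEN conjunct2] L2[OF L(3), THEN conjunct2]
  proof eventually_elim
    case (elim n)
    define V where "V x = W (\<Theta> n x) + W (\<Phi> x)" for x
    have V: "integrable lborel V" "V x \<ge> 0" for x
      unfolding V_def using P(3) Q(3) nonneg by (auto intro: add_nonneg_nonneg)
    have V': "integrable lborel (\<lambda>x. V (- x))" using V(1) integral_reflect(2) by blast
    define D where "D x = moduli (\<Theta> n x) - moduli (\<Phi> x)" for x
    define B where "B x = indicator {-L..L} x *\<^sub>R s\<^sup>2 + (2 / c) * (indicator {L..} x *\<^sub>R V x + indicator {L..} (- x) *\<^sub>R V x)" for x
    have i2: "integrable lborel (\<lambda>x. indicator {L..} x *\<^sub>R V x)"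
      using integrable_mult_indicator[OF _ V(1), of "{L..}"] by simp
    have i3': "integrable lborel (\<lambda>x. indicator {L..} x *\<^sub>R V (- x))"
      using integrable_mult_indicator[OF _ V', of "{L..}"] by simp
    then have i3: "integrable lborel (\<lambda>x. indicator {L..} (- x) *\<^sub>R V x)"
      using integral_reflect(2)[of "\<lambda>x. indicator {L..} x *\<^sub>R V (- x)"] by simp
    have "(\<integral>x. indicator {L..} (- x) *\<^sub>R V x \<partial>lborel) = (LINT x:{L..}|lborel. V (- x))"
      using integral_reflect(1)[of "\<lambda>x. indicator {L..} x *\<^sub>R V (- x)"] by (simp add: set_lebesgue_integral_def)
    also have "\<dots> < \<eta>"
      unfolding V_def using elim(3) P(3) Q(3) integral_reflect(2)[of "\<lambda>x. W (\<Theta> n x)"] integral_reflect(2)[of "\<lambda>x. W (\<Phi> x)"]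
      by (subst set_integral_add) (auto intro!: integrable_set_integrable)
    finally have I3: "(\<integral>x. indicator {L..} (- x) *\<^sub>R V x \<partial>lborel) < \<eta>" .
    have "(\<integral>x. indicator {L..} x *\<^sub>R V x \<partial>lborel) = (LINT x:{L..}|lborel. V x)"
      by (simp add: set_lebesgue_integral_def)
    also have "\<dots> < \<eta>"
      unfolding V_def using elim(2) P(3) Q(3)
      by (subst set_integral_add) (auto intro!: integrable_set_integrable)
    finally have I2: "(\<integral>x. indicator {L..} x *\<^sub>R V x \<partial>lborel) < \<eta>" .
    have i1: "integrable lborel (\<lambda>x. indicator {-L..L} x *\<^sub>R s\<^sup>2)"
      by (intro integrable_scaleR_left integrable_real_indicator) (simp_all add: emeasure_lborel_Icc_eq)
    have I1: "(\<integral>x. indicator {-L..L} x *\<^sub>R s\<^sup>2 \<partial>lborel) = e / 2"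
      using L s by (simp add: mult.commute)
    have Bi: "integrable lborel B"
      unfolding B_def by (intro Bochner_Integration.integrable_add integrable_mult_right i1 i2 i3)
    have "(\<integral>x. B x \<partial>lborel) = e / 2 + (2 / c) * ((\<integral>x. indicator {L..} x *\<^sub>R V x \<partial>lborel) + (\<integral>x. indicator {L..} (- x) *\<^sub>R V x \<partial>lborel))"
      unfolding B_def using I1 i1 i2 i3 by (simp add: distrib_left)
    also have "\<dots> < e / 2 + (2 / c) * (\<eta> + \<eta>)"
      using I2 I3 rc(2) by (intro add_strict_left_mono mult_strict_left_mono add_strict_mono) auto
    also have "\<dots> < e" using rc(2) e by (simp add: \<eta>_def)
    finally have BI: "(\<integral>x. B x \<partial>lborel) < e" .
    have DB: "(norm (D x))\<^sup>2 \<le> B x" for x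
    proof -
      have nn: "0 \<le> (2 / c) * (indicator {L..} x *\<^sub>R V x)" "0 \<le> (2 / c) * (indicator {L..} (- x) *\<^sub>R V x)"
        using rc(2) V(2) by (auto intro!: mult_nonneg_nonneg)
      consider "x \<in> {-L..L}" | "x > L" | "- x > L" by force
      then show ?thesis
      proof cases
        case 1
        have "norm (D x) \<le> s"
          using dist_moduli_le[of "\<Theta> n x" "\<Phi> x"] elim(1) 1 by (force simp: D_def dist_norm)
        then have "(norm (D x))\<^sup>2 \<le> s\<^sup>2" by (intro power_mono) auto
        then show ?thesis using 1 nn by (simp add: B_def distrib_left)
      next
        case 2
        have "(norm (D x))\<^sup>2 \<le> (2 / c) * V x"
          unfolding D_def V_def by (rule sum_sq[where p="(a, 0)"]) (use 2 elim(2) L1[OF L(2)] in auto)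
        then show ?thesis using 2 L by (simp add: B_def)
      next
        case 3
        have "(norm (D x))\<^sup>2 \<le> (2 / c) * V x"
          unfolding D_def V_def
        proof (rule sum_sq[where p="(0, b)"])
          show "dist (moduli (\<Theta> n x)) (0, b) < e0" using elim(3) 3 by (metis less_imp_le minus_minus)
          show "dist (moduli (\<Phi> x)) (0, b) < e0" using L2[OF L(3)] 3 by (metis less_imp_le minus_minus)
        qed simp_all
        then show ?thesis using 3 L by (simp add: B_def)
      qed
    qed
    have Dm: "D \<in> borel_measurable borel"
      unfolding D_def using primitive_of_continuous[OF P(1)] primitive_of_continuous[OF Q(1)]
      by (intro borel_measurable_continuous_onI continuous_intros)
    have Di: "integrable lborel (\<lambda>x. (norm (D x))\<^sup>2)"
    proof (rule Bochner_Integration.integrable_bound[OF Bi])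
      show "(\<lambda>x. (norm (D x))\<^sup>2) \<in> borel_measurable lborel" using Dm by simp
      show "AE x in lborel. norm ((norm (D x))\<^sup>2) \<le> norm (B x)" using DB by (intro AE_I2) (simp add: order_trans[OF DB abs_ge_self])
    qed
    have "sq_norm D \<le> (\<integral>x. B x \<partial>lborel)" unfolding sq_norm_def by (intro integral_mono Di Bi DB)
    then have "square_integrable D \<and> sq_norm D < e" using Dm Di BI by (simp add: square_integrable_def)
    then show ?case by (simp add: D_def[abs_def])
  qed
qed

end

section \<open>Linear second-order equations and constancy of the phase\<close>

lemma linear_ODE_unique_right:
  fixes v w :: "real \<Rightarrow> 'a::real_inner"
  assumes v: "\<And>x. (v has_vector_derivative w x) (at x)" and w: "\<And>x. (w has_vector_derivative c x *\<^sub>R v x) (at x)"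
    and c: "continuous_on UNIV c" and 0: "v x0 = 0" "w x0 = 0" and x1: "x0 \<le> x1"
  shows "v x1 = 0"
proof -
  define E where "E x = v x \<bullet> v x + w x \<bullet> w x" for x
  have dE: "(E has_real_derivative 2 * (1 + c x) * (v x \<bullet> w x)) (at x)" for x
    unfolding E_def has_real_derivative_iff_has_vector_derivative
    by (rule has_vector_derivative_eq_rhs,
        rule has_vector_derivative_add[OF
          bounded_bilinear.has_vector_derivative[OF bounded_bilinear_inner v v]
          bounded_bilinear.has_vector_derivative[OF bounded_bilinear_inner w w]])
       (simp add: algebra_simps inner_commute)
  have "compact (c ` {x0..x1})" using c by (intro compact_continuous_image) (auto intro: continuous_on_subset)
  from compact_imp_bounded[OF this] obtain B where "\<forall>y\<in>c ` {x0..x1}. norm y \<le> B" unfolding bounded_iff by blast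
  then have B: "\<bar>c x\<bar> \<le> B" if "x \<in> {x0..x1}" for x using that by simp
  \<comment> \<open>Gronwall: on the interval
    \<open>2 * \<bar>v x \<bullet> w x\<bar> \<le> E x\<close> and
    \<open>\<bar>1 + c x\<bar> \<le> 1 + B\<close>, so \<open>E\<close> grows at most at rate
    \<open>1 + B\<close> and \<open>f\<close> is nonincreasing.\<close>
  define f where "f x = exp (- ((1 + B) * x)) * E x" for x
  have df: "(f has_real_derivative exp (- ((1 + B) * x)) * (2 * (1 + c x) * (v x \<bullet> w x) - (1 + B) * E x)) (at x)" for x
    unfolding f_def by (auto intro!: derivative_eq_intros dE simp: algebra_simps)
  have "f x1 \<le> f x0"
  proof (rule DERIV_nonpos_imp_nonincreasing[OF x1])
    fix x assume x: "x0 \<le> x" "x \<le> x1"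
    have "2 * \<bar>v x \<bullet> w x\<bar> \<le> E x"
    proof -
      have "0 \<le> (v x - w x) \<bullet> (v x - w x)" "0 \<le> (v x + w x) \<bullet> (v x + w x)" by simp_all
      then show ?thesis by (simp add: E_def inner_diff_left inner_diff_right inner_add_left inner_add_right inner_commute)
    qed
    moreover have "\<bar>1 + c x\<bar> \<le> 1 + B" using B[of x] x by auto
    ultimately have "\<bar>1 + c x\<bar> * (2 * \<bar>v x \<bullet> w x\<bar>) \<le> (1 + B) * E x" by (intro mult_mono) auto
    moreover have "2 * (1 + c x) * (v x \<bullet> w x) \<le> \<bar>1 + c x\<bar> * (2 * \<bar>v x \<bullet> w x\<bar>)"
      using abs_ge_self[of "(1 + c x) * (2 * (v x \<bullet> w x))"]
      unfolding abs_mult abs_numeral by (simp only: mult.assoc mult.left_commute)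
    ultimately have "exp (- ((1 + B) * x)) * (2 * (1 + c x) * (v x \<bullet> w x) - (1 + B) * E x) \<le> 0"
      by (intro mult_nonneg_nonpos) auto
    then show "\<exists>y. (f has_real_derivative y) (at x) \<and> y \<le> 0" using df by blast
  qed
  also have "f x0 = 0" by (simp add: f_def E_def 0)
  finally have "E x1 \<le> 0" by (simp add: f_def mult_le_0_iff)
  then have "v x1 \<bullet> v x1 \<le> 0" using inner_ge_zero[of "w x1"] unfolding E_def by linarith
  then show ?thesis by (metis inner_eq_zero_iff inner_ge_zero order_antisym)
qed

lemma has_vector_derivative_mirror:
  assumes "(f has_vector_derivative f') (at (- x))"
  shows "((\<lambda>x. f (- x)) has_vector_derivative - f') (at x)"
proof -
  have "((f \<circ> uminus) has_vector_derivative (- 1) *\<^sub>R f') (at x)"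
    using assms by (intro vector_diff_chain_at) (auto intro!: derivative_eq_intros)
  then show ?thesis by (simp add: o_def)
qed

lemma linear_ODE_unique:
  fixes v w :: "real \<Rightarrow> 'a::real_inner"
  assumes v: "\<And>x. (v has_vector_derivative w x) (at x)" and w: "\<And>x. (w has_vector_derivative c x *\<^sub>R v x) (at x)"
    and c: "continuous_on UNIV c" and 0: "v x0 = 0" "w x0 = 0"
  shows "v x1 = 0"
proof (cases "x0 \<le> x1")
  case True
  show ?thesis by (rule linear_ODE_unique_right[OF v w c 0 True])
next
  case False
  have "v (- (- x1)) = 0"
  proof (rule linear_ODE_unique_right[where v = "\<lambda>x. v (- x)" and w = "\<lambda>x. - w (- x)" and c = "\<lambda>x. c (- x)" and ?x0.0 = "- x0"])
    show "((\<lambda>x. v (- x)) has_vector_derivative - w (- x)) (at x)" for x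
      by (rule has_vector_derivative_mirror[OF v])
    show "((\<lambda>x. - w (- x)) has_vector_derivative c (- x) *\<^sub>R v (- x)) (at x)" for x
      using has_vector_derivative_minus[OF has_vector_derivative_mirror[OF w], of x] by simp
    show "continuous_on UNIV (\<lambda>x. c (- x))"
      using c by (intro continuous_on_compose2[OF c] continuous_intros) auto
  qed (use 0 False in auto)
  then show ?thesis by simp
qed

text \<open>By \<open>zeros\<close>, a zero of \<open>\<psi>\<close> would have vanishing derivative
  and spread to the whole line, against \<open>nz\<close>. So \<open>\<psi>\<close> has no zero at
  all, and vanishing angular momentum then keeps it on one ray from the origin.\<close>

lemma constant_phase:
  fixes \<psi> G :: "real \<Rightarrow> complex"
  assumes d: "\<And>x. (\<psi> has_vector_derivative G x) (at x)" and dG: "\<And>x. (G has_vector_derivative c x *\<^sub>R \<psi> x) (at x)"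
    and c: "continuous_on UNIV c" and G: "square_integrable G"
    and lim: "(\<psi> \<longlongrightarrow> 0) at_top \<or> (\<psi> \<longlongrightarrow> 0) at_bot"
    and nz: "\<psi> x1 \<noteq> 0" and zeros: "\<And>x. \<psi> x = 0 \<Longrightarrow> G x = 0"
  obtains \<beta> where "\<And>x. \<psi> x = exp (\<i> * of_real \<beta>) * of_real (cmod (\<psi> x))"
proof -
  have never: "\<psi> x \<noteq> 0" for x
    using linear_ODE_unique[OF d dG c, of x x1] zeros nz by blast
  have re: "((\<lambda>x. Re (\<psi> x)) has_real_derivative Re (G x)) (at x)" "((\<lambda>x. Im (\<psi> x)) has_real_derivative Im (G x)) (at x)"
    "((\<lambda>x. Re (G x)) has_real_derivative c x * Re (\<psi> x)) (at x)" "((\<lambda>x. Im (G x)) has_real_derivative c x * Im (\<psi> x)) (at x)" for x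
    using bounded_linear.has_vector_derivative[OF bounded_linear_Re d, of x] bounded_linear.has_vector_derivative[OF bounded_linear_Im d, of x]
      bounded_linear.has_vector_derivative[OF bounded_linear_Re dG, of x] bounded_linear.has_vector_derivative[OF bounded_linear_Im dG, of x]
    by (simp_all add: has_real_derivative_iff_has_vector_derivative)
  \<comment> \<open>The angular momentum is conserved and, by integrability of the kinetic energy, vanishes.\<close>
  define J where "J x = Re (\<psi> x) * Im (G x) - Im (\<psi> x) * Re (G x)" for x
  have dJ: "(J has_real_derivative 0) (at x)" for x
    unfolding J_def by (rule DERIV_cong[OF DERIV_diff[OF DERIV_mult[OF re(1) re(4)] DERIV_mult[OF re(2) re(3)]]]) simp
  have Jc: "J x = J 0" for x using DERIV_isconst_all[of J] dJ by blast
  have J0: "J 0 = 0"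
  proof (rule ccontr)
    assume j: "J 0 \<noteq> 0"
    have Jle: "\<bar>J x\<bar> \<le> cmod (\<psi> x) * cmod (G x)" for x
    proof -
      have "J x = Im (cnj (\<psi> x) * G x)" by (simp add: J_def)
      then show ?thesis using abs_Im_le_cmod[of "cnj (\<psi> x) * G x"] by (simp add: norm_mult)
    qed
    \<comment> \<open>Where \<open>\<psi>\<close> has modulus below \<open>1\<close>, the modulus of
      \<open>G\<close> is at least \<open>\<bar>J 0\<bar>\<close>. An interval of length
      \<open>T\<close> of this kind, found near the end where \<open>\<psi>\<close> tends to
      \<open>0\<close>, would carry \<open>(J 0)\<^sup>2 * T = sq_norm G + 1\<close>, more than all
      of \<open>G\<close>.\<close>
    define T where "T = (sq_norm G + 1) / (J 0)\<^sup>2"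
    have T: "T \<ge> 0" "(J 0)\<^sup>2 * T = sq_norm G + 1" using j sq_norm_nonneg[of G] by (auto simp: T_def)
    have "\<exists>s. \<forall>x\<in>{s..s + T}. cmod (\<psi> x) < 1"
      using lim
    proof
      assume "(\<psi> \<longlongrightarrow> 0) at_top"
      then have "\<forall>\<^sub>F x in at_top. dist (\<psi> x) 0 < 1" by (rule tendstoD) simp
      then obtain N where "\<And>x. x \<ge> N \<Longrightarrow> cmod (\<psi> x) < 1" by (auto simp: eventually_at_top_linorder)
      then show ?thesis by (intro exI[of _ N]) auto
    next
      assume "(\<psi> \<longlongrightarrow> 0) at_bot"
      then have "\<forall>\<^sub>F x in at_bot. dist (\<psi> x) 0 < 1" by (rule tendstoD) simp
      then obtain N where "\<And>x. x \<le> N \<Longrightarrow> cmod (\<psi> x) < 1" by (auto simp: eventually_at_bot_linorder)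
      then show ?thesis by (intro exI[of _ "N - T"]) auto
    qed
    then obtain s where s: "\<And>x. x \<in> {s..s + T} \<Longrightarrow> cmod (\<psi> x) < 1" by blast
    have "(J 0)\<^sup>2 * T = (LINT x:{s..s + T}|lborel. (J 0)\<^sup>2)" using T by (simp add: set_lebesgue_integral_def mult.commute)
    also have "\<dots> \<le> (LINT x:{s..s + T}|lborel. (norm (G x))\<^sup>2)"
    proof (rule set_integral_mono)
      show "set_integrable lborel {s..s + T} (\<lambda>x. (J 0)\<^sup>2)"
        using continuous_locally_integrable[of "\<lambda>_. (J 0)\<^sup>2"] by (auto simp: locally_integrable_def)
      show "set_integrable lborel {s..s + T} (\<lambda>x. (norm (G x))\<^sup>2)" using G by (rule square_integrable_set_integrable) simp
      fix x assume "x \<in> {s..s + T}"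
      then have "\<bar>J 0\<bar> \<le> 1 * cmod (G x)"
        using Jle[of x] s[of x] Jc[of x] mult_right_mono[of "cmod (\<psi> x)" 1 "cmod (G x)"] by (simp add: less_imp_le)
      then have "\<bar>J 0\<bar>\<^sup>2 \<le> (norm (G x))\<^sup>2" by (intro power_mono) auto
      then show "(J 0)\<^sup>2 \<le> (norm (G x))\<^sup>2" by simp
    qed
    also have "\<dots> \<le> sq_norm G" using G by (rule set_integral_square_le_sq_norm) simp
    finally show False using T by simp
  qed
  \<comment> \<open>After multiplication by the fixed factor \<open>cnj (\<psi> 0)\<close> the
    imaginary part solves the same linear equation, with value \<open>0\<close> and derivative
    \<open>J 0 = 0\<close> at \<open>0\<close>. So the product is real, and being continuous without
    zeros it keeps its sign.\<close>
  define R where "R x = Re (\<psi> x * cnj (\<psi> 0))" for x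
  have real: "Im (\<psi> x * cnj (\<psi> 0)) = 0" for x
  proof (rule linear_ODE_unique[where v = "\<lambda>x. Im (\<psi> x * cnj (\<psi> 0))" and w = "\<lambda>x. Im (G x * cnj (\<psi> 0))" and c = c and ?x0.0 = 0])
    have bl: "bounded_linear (\<lambda>z. Im (z * cnj (\<psi> 0)))"
      by (intro bounded_linear_compose[OF bounded_linear_Im] bounded_linear_mult_left)
    show "((\<lambda>x. Im (\<psi> x * cnj (\<psi> 0))) has_vector_derivative Im (G x * cnj (\<psi> 0))) (at x)" for x
      by (rule bounded_linear.has_vector_derivative[OF bl d])
    show "((\<lambda>x. Im (G x * cnj (\<psi> 0))) has_vector_derivative c x *\<^sub>R Im (\<psi> x * cnj (\<psi> 0))) (at x)" for x
      using bounded_linear.has_vector_derivative[OF bl dG, of x] by (simp add: algebra_simps)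
    show "Im (G 0 * cnj (\<psi> 0)) = 0" using J0 by (simp add: J_def algebra_simps)
  qed (use c in auto)
  have eq: "\<psi> x * cnj (\<psi> 0) = of_real (R x)" for x
    using real[of x] by (simp add: R_def complex_eq_iff)
  have Rnz: "R x \<noteq> 0" for x using eq[of x] never[of x] never[of 0] by auto
  have cR: "continuous_on UNIV R"
    unfolding R_def using has_vector_derivative_continuous[OF d]
    by (intro continuous_intros) (simp add: continuous_on_eq_continuous_at)
  have "R 0 > 0" using never[of 0] by (simp add: R_def complex_mult_cnj add_nonneg_pos sum_power2_gt_zero_iff complex_eq_iff flip: power2_eq_square)
  have Rpos: "R x > 0" for x
  proof (rule ccontr)
    assume "\<not> R x > 0"
    have "connected (R ` UNIV)" using cR by (intro connected_continuous_image) auto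
    then have "0 \<in> range R"
      using \<open>R 0 > 0\<close> \<open>\<not> R x > 0\<close> connectedD_interval[of "range R" "R x" "R 0" 0] by auto
    then show False using Rnz by force
  qed
  have sgn_eq: "sgn (\<psi> x) = sgn (\<psi> 0)" for x
  proof -
    have "\<psi> x * of_real ((cmod (\<psi> 0))\<^sup>2) = of_real (R x) * \<psi> 0"
      unfolding complex_norm_square eq[symmetric] by (simp only: ac_simps)
    then have "\<psi> x = (R x / (cmod (\<psi> 0))\<^sup>2) *\<^sub>R \<psi> 0"
      using never[of 0] by (simp add: scaleR_conv_of_real field_simps)
    moreover have "sgn (R x / (cmod (\<psi> 0))\<^sup>2) = 1"
      using Rpos[of x] never[of 0] by simp
    ultimately show ?thesis by (metis sgn_scaleR scaleR_one)
  qed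
  have "exp (\<i> * of_real (Arg (\<psi> 0))) = sgn (\<psi> 0)"
    using cis_Arg[OF never[of 0]] by (simp add: cis_conv_exp)
  then have "\<psi> x = exp (\<i> * of_real (Arg (\<psi> 0))) * of_real (cmod (\<psi> x))" for x
    using never[of x] unfolding sgn_eq[of x, symmetric] by (simp add: sgn_div_norm scaleR_conv_of_real)
  then show ?thesis using that by blast
qed

section \<open>The Euler-Lagrange equation and the phases\<close>

lemma square_integrable_inner:
  assumes g: "square_integrable g" and v: "square_integrable v"
  shows "integrable lborel (\<lambda>x. g x \<bullet> v x)"
    "sq_norm (\<lambda>x. g x + t *\<^sub>R v x) = sq_norm g + 2 * t * (\<integral>x. g x \<bullet> v x \<partial>lborel) + t\<^sup>2 * sq_norm v"
proof -
  have [measurable]: "g \<in> borel_measurable borel" "v \<in> borel_measurable borel"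
    using g v by (auto simp: square_integrable_def)
  have ig: "integrable lborel (\<lambda>x. (norm (g x))\<^sup>2)" and iv: "integrable lborel (\<lambda>x. (norm (v x))\<^sup>2)"
    using g v by (auto simp: square_integrable_def)
  show i: "integrable lborel (\<lambda>x. g x \<bullet> v x)"
  proof (rule Bochner_Integration.integrable_bound)
    show "integrable lborel (\<lambda>x. (norm (g x))\<^sup>2 + (norm (v x))\<^sup>2)" using ig iv by simp
    have "\<bar>g x \<bullet> v x\<bar> \<le> (norm (g x))\<^sup>2 + (norm (v x))\<^sup>2" for x
    proof -
      have "\<bar>g x \<bullet> v x\<bar> \<le> norm (g x) * norm (v x)" by (rule Cauchy_Schwarz_ineq2)
      also have "2 * (norm (g x) * norm (v x)) \<le> (norm (g x))\<^sup>2 + (norm (v x))\<^sup>2"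
        using sum_squares_bound[of "norm (g x)" "norm (v x)"] by simp
      then have "norm (g x) * norm (v x) \<le> (norm (g x))\<^sup>2 + (norm (v x))\<^sup>2"
        using mult_nonneg_nonneg[OF norm_ge_zero[of "g x"] norm_ge_zero[of "v x"]] by linarith
      finally show ?thesis .
    qed
    then show "AE x in lborel. norm (g x \<bullet> v x) \<le> norm ((norm (g x))\<^sup>2 + (norm (v x))\<^sup>2)"
      by (intro AE_I2) simp
  qed simp
  have "(norm (g x + t *\<^sub>R v x))\<^sup>2 = (norm (g x))\<^sup>2 + (2 * t * (g x \<bullet> v x) + t\<^sup>2 * (norm (v x))\<^sup>2)" for x
    unfolding power2_norm_eq_inner
    by (simp add: inner_add_left inner_add_right inner_commute power2_eq_square algebra_simps)
  then show "sq_norm (\<lambda>x. g x + t *\<^sub>R v x) = sq_norm g + 2 * t * (\<integral>x. g x \<bullet> v x \<partial>lborel) + t\<^sup>2 * sq_norm v"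
    using ig iv i by (simp add: sq_norm_def)
qed

text \<open>\<open>F1\<close> and \<open>F2\<close> stand for the partial derivatives of
  \<open>F\<close> at the squared moduli. That the gradient multiplies each component by a real
  factor is what turns the Euler-Lagrange equation, along a fixed curve, into two linear equations
  with real coefficients.\<close>

locale smooth_double_well = double_well +
  fixes F1 F2 :: "complex \<times> complex \<Rightarrow> real"
  assumes contF: "continuous_on UNIV F1" "continuous_on UNIV F2"
    and der: "(W has_derivative (\<lambda>v. 2 * ((F1 z *\<^sub>R fst z, F2 z *\<^sub>R snd z) \<bullet> v))) (at z)"
begin

text \<open>Half the gradient of \<open>W\<close>, so that the Euler-Lagrange equation of
  \<open>total\<close> says that the second derivative of the curve is the force.\<close>

definition force :: "complex \<times> complex \<Rightarrow> complex \<times> complex" where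
  "force z = (F1 z *\<^sub>R fst z, F2 z *\<^sub>R snd z)"

definition minimizer :: "(real \<Rightarrow> complex \<times> complex) \<Rightarrow> (real \<Rightarrow> complex \<times> complex) \<Rightarrow> bool" where
  "minimizer \<Psi> g \<longleftrightarrow> competitor \<Psi> g \<and> (\<forall>\<Phi> h. competitor \<Phi> h \<longrightarrow> total \<Psi> g \<le> total \<Phi> h)"

lemma continuous_force: "continuous_on S f \<Longrightarrow> continuous_on S (\<lambda>x. force (f x))"
  unfolding force_def
  by (intro continuous_intros continuous_on_compose2[OF contF(1)] continuous_on_compose2[OF contF(2)]) auto

text \<open>The kinetic part is a quadratic polynomial in \<open>t\<close>, and the potential part
  is a parameter integral over \<open>{-L..L}\<close>, differentiated under the integral sign. Since
  \<open>\<phi>\<close> vanishes elsewhere, the perturbed curves are competitors with the same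
  tails. The common factor \<open>2\<close> of both terms is cancelled.\<close>

lemma first_variation:
  fixes \<phi> q :: "real \<Rightarrow> real"
  assumes min: "minimizer \<Psi> g" and \<phi>: "primitive_of q \<phi>" and q: "square_integrable q" and L: "L > 0"
    and out: "\<And>x. x \<notin> {-L..L} \<Longrightarrow> \<phi> x = 0"
  shows "(\<integral>x. q x * (g x \<bullet> e) \<partial>lborel) + (LINT x:{-L..L}|lborel. \<phi> x * (force (\<Psi> x) \<bullet> e)) = 0"
proof -
  have comp: "competitor \<Psi> g" using min by (simp add: minimizer_def)
  note c = comp[unfolded competitor_def]
  have c\<Psi>: "continuous_on UNIV \<Psi>" using c primitive_of_continuous by blast
  have c\<phi>: "continuous_on UNIV \<phi>" using \<phi> by (rule primitive_of_continuous)
  define v where "v x = q x *\<^sub>R e" for x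
  have sv: "square_integrable v"
    using q by (auto simp: square_integrable_def v_def[abs_def] power_mult_distrib)
  have Pv: "primitive_of v (\<lambda>x. \<phi> x *\<^sub>R e)"
    unfolding v_def by (rule primitive_of_bounded_linear[OF \<phi> bounded_linear_scaleR_left])
  define X where "X t x = \<Psi> x + (t * \<phi> x) *\<^sub>R e" for t x
  define Y where "Y t x = g x + t *\<^sub>R v x" for t x
  have cX: "continuous_on UNIV (X t)" for t unfolding X_def by (intro continuous_intros c\<Psi> c\<phi>)
  define J where "J t = integral {-L..L} (\<lambda>x. W (X t x))" for t
  have X0: "X 0 = \<Psi>" by (rule ext) (simp add: X_def)
  have siW: "set_integrable lborel {-L..L} (\<lambda>x. W (X t x))" for t
    using locally_integrableD[OF continuous_locally_integrable[OF continuous_W[OF cX]]] .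
  have Xout: "X t x = \<Psi> x" if "x \<notin> {-L..L}" for t x using out[OF that] by (simp add: X_def)
  have Wdec: "W (X t x) = W (\<Psi> x) + (indicator {-L..L} x *\<^sub>R W (X t x) - indicator {-L..L} x *\<^sub>R W (X 0 x))" for t x
    using Xout[of x t] by (auto simp: X0 indicator_def)
  have WX: "integrable lborel (\<lambda>x. W (X t x))" "(\<integral>x. W (X t x) \<partial>lborel) = (\<integral>x. W (\<Psi> x) \<partial>lborel) + (J t - J 0)" for t
  proof -
    have i: "integrable lborel (\<lambda>x. W (\<Psi> x))" "integrable lborel (\<lambda>x. indicator {-L..L} x *\<^sub>R W (X t x))"
      "integrable lborel (\<lambda>x. indicator {-L..L} x *\<^sub>R W (X 0 x))"
      using c siW[of t] siW[of 0] by (auto simp: set_integrable_def)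
    have Jt: "J t = (\<integral>x. indicator {-L..L} x *\<^sub>R W (X t x) \<partial>lborel)" for t
      unfolding J_def using set_borel_integral_eq_integral(2)[OF siW[of t]] by (simp add: set_lebesgue_integral_def)
    show "integrable lborel (\<lambda>x. W (X t x))"
      by (subst Wdec) (intro Bochner_Integration.integrable_add Bochner_Integration.integrable_diff i)
    show "(\<integral>x. W (X t x) \<partial>lborel) = (\<integral>x. W (\<Psi> x) \<partial>lborel) + (J t - J 0)"
      unfolding Jt
      by (subst Wdec, subst Bochner_Integration.integral_add[OF i(1) Bochner_Integration.integrable_diff[OF i(2,3)]],
          subst Bochner_Integration.integral_diff[OF i(2,3)], rule refl)
  qed
  have compX: "competitor (X t) (Y t)" for t
    unfolding competitor_def
  proof (intro conjI)
    show "primitive_of (Y t) (X t)"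
      using primitive_of_add[OF _ primitive_of_scaleR[OF Pv, of t], of g \<Psi>] c by (simp add: X_def[abs_def] Y_def[abs_def])
    show "square_integrable (Y t)"
      unfolding Y_def[abs_def] using c by (intro square_integrable_add square_integrable_scaleR(1) sv) blast
    show "((\<lambda>x. dist (moduli (X t x)) (a, 0)) \<longlongrightarrow> 0) at_top"
      using c by (elim conjE Lim_transform_eventually)
        (rule eventually_mono[OF eventually_gt_at_top[of L]], simp add: Xout)
    show "((\<lambda>x. dist (moduli (X t x)) (0, b)) \<longlongrightarrow> 0) at_bot"
      using c by (elim conjE Lim_transform_eventually)
        (rule eventually_mono[OF eventually_le_at_bot[of "- L - 1"]], simp add: Xout)
  qed (rule WX)
  define A where "A = (\<integral>x. g x \<bullet> v x \<partial>lborel)"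
  define f where "f t = 2 * t * A + t\<^sup>2 * sq_norm v + (J t - J 0)" for t
  have "total (X t) (Y t) = total \<Psi> g + f t" for t
    using square_integrable_inner(2)[OF _ sv, of g t] c WX(2)[of t]
    by (simp add: total_def Y_def[abs_def] f_def A_def)
  then have f_ge: "f 0 \<le> f t" for t
    using min compX[of t] by (simp add: minimizer_def f_def) (metis add_le_cancel_left add.right_neutral)
  define dW where "dW t x = 2 * (force (X t x) \<bullet> (\<phi> x *\<^sub>R e))" for t x
  have dX: "((\<lambda>t. W (X t x)) has_real_derivative dW t x) (at t)" for t x
  proof -
    have "((\<lambda>t. X t x) has_derivative (\<lambda>s. s *\<^sub>R (\<phi> x *\<^sub>R e))) (at t)"
      unfolding X_def by (auto intro!: derivative_eq_intros simp: algebra_simps)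
    from has_derivative_compose[OF this der]
    show ?thesis
      unfolding has_field_derivative_def dW_def force_def
      by (rule has_derivative_eq_rhs) (auto simp: fun_eq_iff)
  qed
  have "(J has_real_derivative integral (cbox (-L) L) (dW 0)) (at 0 within UNIV)"
    unfolding J_def[abs_def] interval_cbox
  proof (rule leibniz_rule_field_derivative)
    show "((\<lambda>t. W (X t x)) has_real_derivative dW t x) (at t within UNIV)" for t x using dX by simp
    show "(\<lambda>x. W (X t x)) integrable_on cbox (- L) L" for t
      using set_borel_integral_eq_integral(1)[OF siW[of t]] by simp
    have "continuous_on (UNIV \<times> cbox (- L) L) (\<lambda>p. dW (fst p) (snd p))"
      unfolding dW_def X_def
      by (intro continuous_intros continuous_force continuous_on_compose2[OF c\<Psi>] continuous_on_compose2[OF c\<phi>]) auto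
    then show "continuous_on (UNIV \<times> cbox (- L) L) (\<lambda>(t, x). dW t x)" by (simp add: split_beta')
  qed auto
  then have dJ: "(J has_real_derivative integral {-L..L} (dW 0)) (at 0)" by simp
  have "(f has_real_derivative 2 * A + integral {-L..L} (dW 0)) (at 0)"
    unfolding f_def by (auto intro!: derivative_eq_intros dJ)
  then have 0: "2 * A + integral {-L..L} (dW 0) = 0"
    by (rule DERIV_local_min[of _ _ _ 1]) (use f_ge in auto)
  have "integral {-L..L} (dW 0) = (LINT x:{-L..L}|lborel. 2 * (\<phi> x * (force (\<Psi> x) \<bullet> e)))"
  proof -
    have "continuous_on UNIV (dW 0)" unfolding dW_def X0
      by (intro continuous_intros continuous_force c\<Psi> c\<phi>)
    from set_borel_integral_eq_integral(2)[OF locally_integrableD[OF continuous_locally_integrable[OF this]]]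
    show ?thesis by (simp add: dW_def[abs_def] X0)
  qed
  moreover have "A = (\<integral>x. q x * (g x \<bullet> e) \<partial>lborel)" by (simp add: A_def v_def)
  ultimately show ?thesis using 0 by simp
qed

text \<open>The test function is built from the defect itself: \<open>q\<close> is
  \<open>(g x - P x) \<bullet> e\<close> minus its mean \<open>\<mu>\<close> on
  \<open>{-L..L}\<close>, so a primitive of \<open>q\<close> can vanish at both ends. First
  variation and integration by parts then show that the integral of the square of \<open>q\<close>
  is \<open>0\<close>.\<close>

lemma first_integral:
  fixes P :: "real \<Rightarrow> complex \<times> complex"
  assumes min: "minimizer \<Psi> g" and dP: "\<And>x. (P has_vector_derivative force (\<Psi> x)) (at x)" and L: "L > 0"
  shows "\<exists>\<mu>. AE x in lborel. x \<in> {-L..L} \<longrightarrow> (g x - P x) \<bullet> e = \<mu>"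
proof -
  have comp: "competitor \<Psi> g" using min by (simp add: minimizer_def)
  note c = comp[unfolded competitor_def]
  have c\<Psi>: "continuous_on UNIV \<Psi>" using c primitive_of_continuous by blast
  have cP: "continuous_on UNIV P"
    using has_vector_derivative_continuous[OF dP] by (simp add: continuous_on_eq_continuous_at)
  have PP: "primitive_of (\<lambda>x. force (\<Psi> x)) P" using dP by (rule primitive_of_C1) (rule continuous_force[OF c\<Psi>])
  define w where "w x = indicator {-L..L} x *\<^sub>R ((g x - P x) \<bullet> e)" for x
  have sw: "square_integrable (\<lambda>x. indicator {-L..L} x *\<^sub>R f x)" if "f \<in> L2_loc" for f :: "real \<Rightarrow> complex \<times> complex"
  proof -
    have "(norm (indicator {-L..L} x *\<^sub>R f x))\<^sup>2 = indicator {-L..L} x *\<^sub>R (norm (f x))\<^sup>2" for x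
      by (auto simp: indicator_def)
    then show ?thesis using that L2_loc_square[OF that, of "-L" L]
      by (auto simp: square_integrable_def L2_loc_def set_integrable_def)
  qed
  have sgP: "square_integrable (\<lambda>x. indicator {-L..L} x *\<^sub>R g x - indicator {-L..L} x *\<^sub>R P x)"
    using c cP by (intro square_integrable_diff sw continuous_L2_loc square_integrable_L2_loc) auto
  have sww: "square_integrable w"
    unfolding square_integrable_def
  proof (intro conjI)
    have [measurable]: "g \<in> borel_measurable borel" "P \<in> borel_measurable borel"
      using c borel_measurable_continuous_onI[OF cP] by (auto simp: square_integrable_def)
    show [measurable]: "w \<in> borel_measurable borel" unfolding w_def by measurable
    show "integrable lborel (\<lambda>x. (norm (w x))\<^sup>2)"
    proof (rule Bochner_Integration.integrable_bound)
      show "integrable lborel (\<lambda>x. (norm e)\<^sup>2 * (norm (indicator {-L..L} x *\<^sub>R g x - indicator {-L..L} x *\<^sub>R P x))\<^sup>2)"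
        using sgP by (simp add: square_integrable_def)
      have "\<bar>w x\<bar> \<le> norm e * norm (indicator {-L..L} x *\<^sub>R g x - indicator {-L..L} x *\<^sub>R P x)" for x
        using Cauchy_Schwarz_ineq2[of "g x - P x" e] by (auto simp: w_def indicator_def mult.commute)
      then have "(w x)\<^sup>2 \<le> (norm e * norm (indicator {-L..L} x *\<^sub>R g x - indicator {-L..L} x *\<^sub>R P x))\<^sup>2" for x
        by (metis abs_ge_zero power2_abs power_mono)
      then show "AE x in lborel. norm ((norm (w x))\<^sup>2) \<le> norm ((norm e)\<^sup>2 * (norm (indicator {-L..L} x *\<^sub>R g x - indicator {-L..L} x *\<^sub>R P x))\<^sup>2)"
        by (intro AE_I2) (simp add: power_mult_distrib abs_mult)
    qed simp
  qed
  define \<mu> where "\<mu> = (LINT x:{-L..L}|lborel. w x) / (2 * L)"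
  define q where "q x = indicator {-L..L} x *\<^sub>R (w x - \<mu>)" for x
  have sq: "square_integrable q"
  proof -
    have "square_integrable (\<lambda>x. indicator {-L..L} x *\<^sub>R \<mu>)"
    proof -
      have "(norm (indicator {-L..L} x *\<^sub>R \<mu>))\<^sup>2 = indicator {-L..L} x *\<^sub>R \<mu>\<^sup>2" for x
        by (auto simp: indicator_def)
      then show ?thesis
        using locally_integrableD[OF continuous_locally_integrable[of "\<lambda>_. \<mu>\<^sup>2"], of "-L" L]
        by (simp add: square_integrable_def set_integrable_def)
    qed
    from square_integrable_diff[OF sww this] show ?thesis
      by (rule back_subst[of square_integrable]) (auto simp: q_def w_def indicator_def fun_eq_iff)
  qed
  have liq: "locally_integrable q" using sq by (rule square_integrable_locally_integrable)
  obtain f where f: "primitive_of q f" "f 0 = 0" using primitive_exists[OF liq] by blast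
  define \<phi> where "\<phi> x = f x - f (- L)" for x
  have P\<phi>: "primitive_of q \<phi>" using f(1) by (simp add: primitive_of_def \<phi>_def)
  have siw: "set_integrable lborel {-L..L} w"
    using locally_integrableD[OF square_integrable_locally_integrable[OF sww]] .
  have si\<mu>: "set_integrable lborel {-L..L} (\<lambda>_. \<mu>)"
    using locally_integrableD[OF continuous_locally_integrable[of "\<lambda>_. \<mu>"]] by simp
  have "(LINT x:{-L..L}|lborel. q x) = (LINT x:{-L..L}|lborel. w x - \<mu>)"
    unfolding set_lebesgue_integral_def by (rule Bochner_Integration.integral_cong) (auto simp: q_def indicator_def)
  also have "\<dots> = 0"
    using set_integral_diff(2)[OF siw si\<mu>] L by (simp add: \<mu>_def set_lebesgue_integral_def)
  finally have q0: "(LINT x:{-L..L}|lborel. q x) = 0" .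
  have out: "\<phi> x = 0" if x: "x \<notin> {-L<..<L}" for x
  proof -
    have zero: "(LINT x:{s..t}|lborel. q x) = 0" if "\<And>x. s < x \<Longrightarrow> x < t \<Longrightarrow> x \<notin> {-L..L}" for s t
    proof -
      have "(LINT x:{s..t}|lborel. q x) = integral\<^sup>L lborel (\<lambda>x::real. 0::real)"
        unfolding set_lebesgue_integral_def
      proof (rule integral_cong_AE)
        show "AE x in lborel. indicator {s..t} x *\<^sub>R q x = 0"
          using AE_lborel_singleton[of s] AE_lborel_singleton[of t]
          by eventually_elim (use that in \<open>auto simp: q_def indicator_def\<close>)
      qed (use sq in \<open>auto simp: square_integrable_def\<close>)
      then show ?thesis by simp
    qed
    have \<phi>L: "\<phi> L = 0" using primitive_ofD(2)[OF f(1), of "-L" L] L q0 by (simp add: \<phi>_def)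
    consider "x \<le> - L" | "x \<ge> L" using x by force
    then show ?thesis
    proof cases
      case 1
      then show ?thesis using primitive_ofD(2)[OF f(1), of x "-L"] zero[of x "-L"] by (simp add: \<phi>_def)
    next
      case 2
      then show ?thesis using primitive_ofD(2)[OF P\<phi>, of L x] zero[of L x] \<phi>L by simp
    qed
  qed
  have fv: "(\<integral>x. q x * (g x \<bullet> e) \<partial>lborel) + (LINT x:{-L..L}|lborel. \<phi> x * (force (\<Psi> x) \<bullet> e)) = 0"
    by (rule first_variation[OF min P\<phi> sq L]) (use out in auto)
  have bp: "(LINT x:{-L..L}|lborel. q x * (P x \<bullet> e) + \<phi> x * (force (\<Psi> x) \<bullet> e)) = 0"
    using primitive_of_by_parts[OF P\<phi> primitive_of_inner[OF PP, of e], of "-L" L] L out[of L] out[of "-L"] by simp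
  have c\<phi>: "continuous_on UNIV \<phi>" using P\<phi> by (rule primitive_of_continuous)
  have s1: "set_integrable lborel {-L..L} (\<lambda>x. q x * (P x \<bullet> e))"
    using locally_integrableD[OF locally_integrable_scaleR_continuous[OF liq, of "\<lambda>x. P x \<bullet> e"], of "-L" L] cP
    by (simp add: mult.commute continuous_on_inner)
  have s2: "set_integrable lborel {-L..L} (\<lambda>x. \<phi> x * (force (\<Psi> x) \<bullet> e))"
    by (intro locally_integrableD continuous_locally_integrable continuous_intros c\<phi> continuous_force c\<Psi>)
  have qg: "integrable lborel (\<lambda>x. q x * (g x \<bullet> e))"
    using square_integrable_inner(1)[of g "\<lambda>x. q x *\<^sub>R e"] c sq
    by (auto simp: square_integrable_def power_mult_distrib)
  have qg': "(\<integral>x. q x * (g x \<bullet> e) \<partial>lborel) = (LINT x:{-L..L}|lborel. q x * (g x \<bullet> e))"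
    unfolding set_lebesgue_integral_def by (rule Bochner_Integration.integral_cong) (auto simp: q_def indicator_def)
  have s3: "set_integrable lborel {-L..L} (\<lambda>x. q x * (g x \<bullet> e))" using qg by (rule integrable_set_integrable) simp
  have "(LINT x:{-L..L}|lborel. q x * (g x \<bullet> e) - q x * (P x \<bullet> e)) = 0"
    using fv bp qg' set_integral_add(2)[OF s1 s2] set_integral_diff(2)[OF s3 s1] by simp
  \<comment> \<open>On the interval \<open>(g x - P x) \<bullet> e = q x + \<mu>\<close>; the term
    with \<open>\<mu>\<close> integrates to \<open>0\<close>.\<close>
  moreover have "(LINT x:{-L..L}|lborel. q x * (g x \<bullet> e) - q x * (P x \<bullet> e)) = (LINT x:{-L..L}|lborel. (norm (q x))\<^sup>2 + \<mu> * q x)"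
    unfolding set_lebesgue_integral_def
    by (rule Bochner_Integration.integral_cong)
       (auto simp: q_def w_def indicator_def power2_eq_square algebra_simps inner_diff_left)
  moreover have "(LINT x:{-L..L}|lborel. (norm (q x))\<^sup>2 + \<mu> * q x) = (LINT x:{-L..L}|lborel. (norm (q x))\<^sup>2)"
    using set_integral_add(2)[OF square_integrable_set_integrable[OF sq, of "{-L..L}"], of "\<lambda>x. \<mu> * q x"] locally_integrableD[OF liq] q0 by simp
  moreover have "(LINT x:{-L..L}|lborel. (norm (q x))\<^sup>2) = (\<integral>x. (norm (q x))\<^sup>2 \<partial>lborel)"
    unfolding set_lebesgue_integral_def by (rule Bochner_Integration.integral_cong) (auto simp: q_def indicator_def)
  ultimately have "(\<integral>x. (norm (q x))\<^sup>2 \<partial>lborel) = 0" by simp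
  then have "AE x in lborel. (norm (q x))\<^sup>2 = 0"
    using sq by (subst (asm) integral_nonneg_eq_0_iff_AE) (auto simp: square_integrable_def)
  then have "AE x in lborel. x \<in> {-L..L} \<longrightarrow> (g x - P x) \<bullet> e = \<mu>"
    by eventually_elim (auto simp: q_def w_def indicator_def)
  then show ?thesis by blast
qed

end

context smooth_double_well
begin

text \<open>With \<open>P\<close> an antiderivative of the force and \<open>Q\<close> one of
  \<open>P\<close>, \<open>first_integral\<close> makes \<open>\<Psi> - Q\<close> affine on bounded
  intervals, hence on the line. So \<open>\<Psi>\<close> is twice continuously differentiable, and
  its classical derivative agrees almost everywhere with \<open>g\<close>, which preserves
  minimality.\<close>

lemma Euler_Lagrange:
  assumes min: "minimizer \<Psi> g"
  obtains G where "\<And>x. (\<Psi> has_vector_derivative G x) (at x)"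
    "\<And>x. (G has_vector_derivative force (\<Psi> x)) (at x)" "minimizer \<Psi> G"
proof -
  have comp: "competitor \<Psi> g" using min by (simp add: minimizer_def)
  note c = comp[unfolded competitor_def]
  have Pg: "primitive_of g \<Psi>" and sg: "square_integrable g" using c by auto
  have c\<Psi>: "continuous_on UNIV \<Psi>" using Pg by (rule primitive_of_continuous)
  have antideriv: "\<exists>P. \<forall>x. (P has_vector_derivative f x) (at x)" if "continuous_on UNIV f"
    for f :: "real \<Rightarrow> complex \<times> complex"
  proof -
    have "isCont f x" for x using that by (simp add: continuous_on_eq_continuous_at)
    then show ?thesis using einterval_antiderivative[of "-\<infinity>" "\<infinity>" f] by auto
  qed
  obtain P where P: "\<And>x. (P has_vector_derivative force (\<Psi> x)) (at x)"
    using antideriv[OF continuous_force[OF c\<Psi>]] by blast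
  have cP: "continuous_on UNIV P"
    using has_vector_derivative_continuous[OF P] by (simp add: continuous_on_eq_continuous_at)
  obtain Q where Q: "\<And>x. (Q has_vector_derivative P x) (at x)"
    using antideriv[OF cP] by blast
  have PQ: "primitive_of P Q" using Q cP by (rule primitive_of_C1)
  define d where "d = (\<Psi> 1 - Q 1) - (\<Psi> 0 - Q 0)"
  have lin: "(\<Psi> t - Q t) - (\<Psi> 0 - Q 0) = t *\<^sub>R d" for t
  proof -
    \<comment> \<open>The interval contains \<open>0\<close>, \<open>1\<close> and \<open>t\<close>,
      so the slope found on it equals the increment \<open>d\<close> between \<open>0\<close> and
      \<open>1\<close>, which does not depend on \<open>L\<close>.\<close>
    define L where "L = max 1 \<bar>t\<bar>"
    have L: "L > 0" "1 \<le> L" "\<bar>t\<bar> \<le> L" by (auto simp: L_def)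
    have inn: "((\<Psi> t - Q t) - (\<Psi> 0 - Q 0)) \<bullet> e = (t *\<^sub>R d) \<bullet> e" for e
    proof -
      obtain \<mu> where \<mu>: "AE x in lborel. x \<in> {-L..L} \<longrightarrow> (g x - P x) \<bullet> e = \<mu>"
        using first_integral[OF min P L(1)] by blast
      have "primitive_of (\<lambda>x. g x + (-1) *\<^sub>R P x) (\<lambda>x. \<Psi> x + (-1) *\<^sub>R Q x)"
        by (intro primitive_of_add primitive_of_scaleR Pg PQ)
      then have pr: "primitive_of (\<lambda>x. (g x - P x) \<bullet> e) (\<lambda>x. (\<Psi> x - Q x) \<bullet> e)"
        using primitive_of_inner[of "\<lambda>x. g x - P x" "\<lambda>x. \<Psi> x - Q x"] by simp
      have inc: "(\<Psi> y - Q y) \<bullet> e - (\<Psi> x - Q x) \<bullet> e = \<mu> * (y - x)" if "x \<le> y" "x \<in> {-L..L}" "y \<in> {-L..L}" for x y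
      proof -
        have "(LINT u:{x..y}|lborel. (g u - P u) \<bullet> e) = (LINT u:{x..y}|lborel. \<mu>)"
          unfolding set_lebesgue_integral_def
        proof (rule integral_cong_AE)
          show "AE u in lborel. indicator {x..y} u *\<^sub>R ((g u - P u) \<bullet> e) = indicator {x..y} u *\<^sub>R \<mu>"
            using \<mu> by eventually_elim (use that in \<open>auto simp: indicator_def\<close>)
          have [measurable]: "g \<in> borel_measurable borel" "P \<in> borel_measurable borel"
            using sg borel_measurable_continuous_onI[OF cP] by (auto simp: square_integrable_def)
          show "(\<lambda>u. indicator {x..y} u *\<^sub>R ((g u - P u) \<bullet> e)) \<in> borel_measurable lborel" by measurable
        qed measurable
        then show ?thesis using primitive_ofD(2)[OF pr that(1)] that(1) by (simp add: set_lebesgue_integral_def)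
      qed
      have "(\<Psi> x - Q x) \<bullet> e - (\<Psi> 0 - Q 0) \<bullet> e = \<mu> * x" if "x \<in> {-L..L}" for x
        using inc[of 0 x] inc[of x 0] that L by (cases "0 \<le> x") auto
      from this[of t] this[of 1] show ?thesis
        using L unfolding d_def by (simp add: inner_diff_left[symmetric] abs_le_iff mult.commute)
    qed
    show ?thesis by (rule euclidean_eqI) (rule inn)
  qed
  define G where "G x = P x + d" for x
  have "\<Psi> = (\<lambda>t. \<Psi> 0 - Q 0 + Q t + t *\<^sub>R d)"
    by (rule ext) (use lin in \<open>simp add: algebra_simps\<close>)
  then have d\<Psi>: "(\<Psi> has_vector_derivative G x) (at x)" for x
    by (rule ssubst[where P = "\<lambda>f. (f has_vector_derivative G x) (at x)"])
       (auto intro!: derivative_eq_intros Q simp: G_def)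
  have dG: "(G has_vector_derivative force (\<Psi> x)) (at x)" for x
    unfolding G_def by (auto intro!: derivative_eq_intros P)
  have cG: "continuous_on UNIV G" unfolding G_def by (intro continuous_intros cP)
  have PG: "primitive_of G \<Psi>" using d\<Psi> cG by (rule primitive_of_C1)
  have AE: "AE x in lborel. G x = g x" using PG Pg by (rule primitive_of_unique)
  have Gm: "G \<in> borel_measurable borel" "g \<in> borel_measurable borel"
    using borel_measurable_continuous_onI[OF cG] sg by (auto simp: square_integrable_def)
  have "integrable lborel (\<lambda>x. (norm (G x))\<^sup>2) \<longleftrightarrow> integrable lborel (\<lambda>x. (norm (g x))\<^sup>2)"
    using Gm AE by (intro integrable_cong_AE) auto
  then have sG: "square_integrable G" using sg Gm by (simp add: square_integrable_def)
  have "sq_norm G = sq_norm g" using AE Gm by (rule sq_norm_cong_AE)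
  then have "minimizer \<Psi> G"
    using min PG sG by (simp add: minimizer_def competitor_def total_def)
  then show ?thesis using that d\<Psi> dG by blast
qed

text \<open>Applying an energy-preserving isometry \<open>T\<close> on one side of \<open>x0\<close> only, to a minimizer with
  \<open>T\<close>-invariant value at \<open>x0\<close>, produces another minimizer, which has to be differentiable at
  \<open>x0\<close> as well.\<close>

lemma minimizer_reflection:
  assumes min: "minimizer \<Psi> G" and d: "\<And>x. (\<Psi> has_vector_derivative G x) (at x)"
    and T: "bounded_linear T" "\<And>z. norm (T z) = norm z" "\<And>z. moduli (T z) = moduli z"
    and fixed: "T (\<Psi> x0) = \<Psi> x0"
  shows "T (G x0) = G x0"
proof -
  interpret T: bounded_linear T by (rule T)
  have comp: "competitor \<Psi> G" using min by (simp add: minimizer_def)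
  note c = comp[unfolded competitor_def]
  define \<Phi> where "\<Phi> x = \<Psi> (max x x0) + T (\<Psi> (min x x0)) + (- \<Psi> x0)" for x
  define h where "h x = indicator {x0..} x *\<^sub>R G x + T (indicator {..x0} x *\<^sub>R G x) + 0" for x
  have Ph: "primitive_of h \<Phi>"
    unfolding h_def[abs_def] \<Phi>_def[abs_def] using c
    by (intro primitive_of_add primitive_of_const primitive_of_start primitive_of_bounded_linear[OF primitive_of_stop T(1)]) auto
  have right: "\<Phi> x = \<Psi> x" if "x \<ge> x0" for x using that fixed by (simp add: \<Phi>_def)
  have left: "\<Phi> x = T (\<Psi> x)" if "x \<le> x0" for x using that by (simp add: \<Phi>_def)
  have mod: "moduli (\<Phi> x) = moduli (\<Psi> x)" for x using right[of x] left[of x] T(3) by (cases "x \<ge> x0") auto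
  have W: "W (\<Phi> x) = W (\<Psi> x)" for x by (rule phase) (rule mod)
  have hm: "h \<in> borel_measurable borel" by (rule locally_integrable_measurable[OF primitive_ofD(1)[OF Ph]])
  have Gm: "G \<in> borel_measurable borel" using c by (simp add: square_integrable_def)
  have nh: "norm (h x) = norm (G x)" if "x \<noteq> x0" for x
    using that T(2) by (cases "x > x0") (auto simp: h_def indicator_def T.zero)
  have AE: "AE x in lborel. (norm (h x))\<^sup>2 = (norm (G x))\<^sup>2"
    using AE_lborel_singleton[of x0] by eventually_elim (simp add: nh)
  have "integrable lborel (\<lambda>x. (norm (h x))\<^sup>2) \<longleftrightarrow> integrable lborel (\<lambda>x. (norm (G x))\<^sup>2)"
    using AE hm Gm by (intro integrable_cong_AE) auto
  then have sh: "square_integrable h" using c hm by (simp add: square_integrable_def)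
  have "sq_norm h = sq_norm G"
    unfolding sq_norm_def using AE hm Gm by (intro integral_cong_AE) auto
  then have "minimizer \<Phi> h"
    using min Ph sh by (simp add: minimizer_def competitor_def total_def mod W)
  then obtain H where H: "\<And>x. (\<Phi> has_vector_derivative H x) (at x)" using Euler_Lagrange by blast
  have "(\<Phi> has_vector_derivative G x0) (at x0 within cbox x0 (x0 + 1))"
    by (rule has_vector_derivative_transform[OF _ _ has_vector_derivative_at_within[OF d]]) (auto simp: right)
  then have "H x0 = G x0"
    using has_vector_derivative_at_within[OF H] by (intro vector_derivative_unique_within_closed_interval[of x0 "x0 + 1" x0 \<Phi>]) auto
  moreover have "(\<Phi> has_vector_derivative T (G x0)) (at x0 within cbox (x0 - 1) x0)"
    by (rule has_vector_derivative_transform[OF _ _ has_vector_derivative_at_within[OF T.has_vector_derivative[OF d]]]) (auto simp: left)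
  then have "H x0 = T (G x0)"
    using has_vector_derivative_at_within[OF H] by (intro vector_derivative_unique_within_closed_interval[of "x0 - 1" x0 x0 \<Phi>]) auto
  ultimately show ?thesis by simp
qed

text \<open>Each component tends to \<open>0\<close> at one end and is nonzero near the other.
  Negating one component preserves norms and moduli and fixes \<open>\<Psi> x\<close> where that
  component vanishes, so \<open>minimizer_reflection\<close> makes its derivative vanish there
  too.\<close>

lemma minimizer_phases:
  assumes min0: "minimizer \<Psi> g"
  obtains \<beta>1 \<beta>2 where "\<And>x. fst (\<Psi> x) = exp (\<i> * of_real \<beta>1) * of_real (cmod (fst (\<Psi> x)))"
    "\<And>x. snd (\<Psi> x) = exp (\<i> * of_real \<beta>2) * of_real (cmod (snd (\<Psi> x)))"
proof -
  obtain G where d: "\<And>x. (\<Psi> has_vector_derivative G x) (at x)"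
    and dG: "\<And>x. (G has_vector_derivative force (\<Psi> x)) (at x)" and min: "minimizer \<Psi> G"
    using Euler_Lagrange[OF min0] by blast
  have comp: "competitor \<Psi> G" using min by (simp add: minimizer_def)
  note c = comp[unfolded competitor_def]
  have c\<Psi>: "continuous_on UNIV \<Psi>" using c primitive_of_continuous by blast
  have sG: "square_integrable G" using c by blast
  have top: "((\<lambda>x. dist (moduli (\<Psi> x)) (a, 0)) \<longlongrightarrow> 0) at_top"
    and bot: "((\<lambda>x. dist (moduli (\<Psi> x)) (0, b)) \<longlongrightarrow> 0) at_bot" using c by auto
  have t1: "((\<lambda>x. cmod (fst (\<Psi> x))) \<longlongrightarrow> 0) at_bot"
  proof (rule Lim_null_comparison[OF _ bot], rule always_eventually, rule allI)
    show "norm (cmod (fst (\<Psi> x))) \<le> dist (moduli (\<Psi> x)) (0, b)" for x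
      using dist_fst_le[of "moduli (\<Psi> x)" "(0, b)"] by (simp add: moduli_def dist_real_def)
  qed
  have t2: "((\<lambda>x. cmod (snd (\<Psi> x))) \<longlongrightarrow> 0) at_top"
  proof (rule Lim_null_comparison[OF _ top], rule always_eventually, rule allI)
    show "norm (cmod (snd (\<Psi> x))) \<le> dist (moduli (\<Psi> x)) (a, 0)" for x
      using dist_snd_le[of "moduli (\<Psi> x)" "(a, 0)"] by (simp add: moduli_def dist_real_def)
  qed
  obtain x1 where x1: "fst (\<Psi> x1) \<noteq> 0"
  proof -
    have "\<forall>\<^sub>F x in at_top. dist (moduli (\<Psi> x)) (a, 0) < a" using top ab by (intro order_tendstoD) auto
    then obtain x where "dist (moduli (\<Psi> x)) (a, 0) < a" by (auto dest: eventually_happens)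
    then have "fst (\<Psi> x) \<noteq> 0" using dist_fst_le[of "moduli (\<Psi> x)" "(a, 0)"] ab by (auto simp: moduli_def dist_real_def)
    then show ?thesis by (rule that)
  qed
  obtain x2 where x2: "snd (\<Psi> x2) \<noteq> 0"
  proof -
    have "\<forall>\<^sub>F x in at_bot. dist (moduli (\<Psi> x)) (0, b) < b" using bot ab by (intro order_tendstoD) auto
    then obtain x where "dist (moduli (\<Psi> x)) (0, b) < b" by (auto dest: eventually_happens)
    then have "snd (\<Psi> x) \<noteq> 0" using dist_snd_le[of "moduli (\<Psi> x)" "(0, b)"] ab by (auto simp: moduli_def dist_real_def)
    then show ?thesis by (rule that)
  qed
  obtain \<beta>1 where \<beta>1: "\<And>x. fst (\<Psi> x) = exp (\<i> * of_real \<beta>1) * of_real (cmod (fst (\<Psi> x)))"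
  proof (rule constant_phase[of "\<lambda>x. fst (\<Psi> x)" "\<lambda>x. fst (G x)" "\<lambda>x. F1 (\<Psi> x)" x1])
    show "((\<lambda>x. fst (\<Psi> x)) has_vector_derivative fst (G x)) (at x)" for x
      by (rule bounded_linear.has_vector_derivative[OF bounded_linear_fst d])
    show "((\<lambda>x. fst (G x)) has_vector_derivative F1 (\<Psi> x) *\<^sub>R fst (\<Psi> x)) (at x)" for x
      using bounded_linear.has_vector_derivative[OF bounded_linear_fst dG, of x] by (simp add: force_def)
    show "continuous_on UNIV (\<lambda>x. F1 (\<Psi> x))" by (rule continuous_on_compose2[OF contF(1) c\<Psi>]) simp
    show "square_integrable (\<lambda>x. fst (G x))" by (rule square_integrable_linear[OF sG bounded_linear_fst]) (simp add: norm_prod_def)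
    show "((\<lambda>x. fst (\<Psi> x)) \<longlongrightarrow> 0) at_top \<or> ((\<lambda>x. fst (\<Psi> x)) \<longlongrightarrow> 0) at_bot"
      using t1 tendsto_norm_zero_iff by blast
    show "fst (\<Psi> x1) \<noteq> 0" by (rule x1)
    show "fst (G x) = 0" if "fst (\<Psi> x) = 0" for x
    proof -
      have "(\<lambda>z. (- fst z, snd z)) (G x) = G x"
        by (rule minimizer_reflection[OF min d])
           (use that in \<open>auto simp: moduli_def norm_prod_def prod_eq_iff intro!: bounded_linear_Pair bounded_linear_minus bounded_linear_fst bounded_linear_snd\<close>)
      then show ?thesis by (simp add: prod_eq_iff)
    qed
  qed (rule that)
  obtain \<beta>2 where \<beta>2: "\<And>x. snd (\<Psi> x) = exp (\<i> * of_real \<beta>2) * of_real (cmod (snd (\<Psi> x)))"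
  proof (rule constant_phase[of "\<lambda>x. snd (\<Psi> x)" "\<lambda>x. snd (G x)" "\<lambda>x. F2 (\<Psi> x)" x2])
    show "((\<lambda>x. snd (\<Psi> x)) has_vector_derivative snd (G x)) (at x)" for x
      by (rule bounded_linear.has_vector_derivative[OF bounded_linear_snd d])
    show "((\<lambda>x. snd (G x)) has_vector_derivative F2 (\<Psi> x) *\<^sub>R snd (\<Psi> x)) (at x)" for x
      using bounded_linear.has_vector_derivative[OF bounded_linear_snd dG, of x] by (simp add: force_def)
    show "continuous_on UNIV (\<lambda>x. F2 (\<Psi> x))" by (rule continuous_on_compose2[OF contF(2) c\<Psi>]) simp
    show "square_integrable (\<lambda>x. snd (G x))" by (rule square_integrable_linear[OF sG bounded_linear_snd]) (simp add: norm_prod_def)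
    show "((\<lambda>x. snd (\<Psi> x)) \<longlongrightarrow> 0) at_top \<or> ((\<lambda>x. snd (\<Psi> x)) \<longlongrightarrow> 0) at_bot"
      using t2 tendsto_norm_zero_iff by blast
    show "snd (\<Psi> x2) \<noteq> 0" by (rule x2)
    show "snd (G x) = 0" if "snd (\<Psi> x) = 0" for x
    proof -
      have "(\<lambda>z. (fst z, - snd z)) (G x) = G x"
        by (rule minimizer_reflection[OF min d])
           (use that in \<open>auto simp: moduli_def norm_prod_def prod_eq_iff intro!: bounded_linear_Pair bounded_linear_minus bounded_linear_fst bounded_linear_snd\<close>)
      then show ?thesis by (simp add: prod_eq_iff)
    qed
  qed (rule that)
  show ?thesis using that \<beta>1 \<beta>2 by blast
qed

end

section \<open>Admissible potentials\<close>

text \<open>A negative \<open>k\<close> would make \<open>f\<close> decrease to the right of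
  \<open>p\<close>, below \<open>0\<close>. For positive \<open>k\<close>, the function
  \<open>f x - k / 4 * (x - p)\<^sup>2\<close> has near \<open>p\<close> a derivative with the sign
  of \<open>x - p\<close>, so it is smallest at \<open>p\<close>.\<close>

lemma quadratic_growth_at_min:
  fixes f :: "real \<Rightarrow> real"
  assumes f: "\<And>x. (f has_real_derivative f' x) (at x)" and f': "(f' has_real_derivative k) (at p)"
    and k: "k \<noteq> 0" and p: "f p = 0" and d: "d > 0" "\<And>x. \<bar>x - p\<bar> < d \<Longrightarrow> f x \<ge> 0"
  obtains r c where "r > 0" "c > 0" "\<And>x. \<bar>x - p\<bar> \<le> r \<Longrightarrow> c * (x - p)\<^sup>2 \<le> f x"
proof -
  have f'p: "f' p = 0"
    by (rule DERIV_local_min[OF f d(1)]) (use d p in \<open>auto simp: abs_minus_commute\<close>)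
  have lim: "((\<lambda>x. f' x / (x - p)) \<longlongrightarrow> k) (at p)"
    using f' f'p by (simp add: has_field_derivative_iff)
  have "k > 0"
  proof (rule ccontr)
    assume "\<not> k > 0"
    with k have "\<forall>\<^sub>F x in at p. f' x / (x - p) < 0" by (intro order_tendstoD(2)[OF lim]) auto
    then obtain r where r: "r > 0" "\<And>x. x \<noteq> p \<Longrightarrow> \<bar>x - p\<bar> < r \<Longrightarrow> f' x / (x - p) < 0"
      by (auto simp: eventually_at dist_real_def)
    define x where "x = p + min r d / 2"
    have x: "p < x" "\<bar>x - p\<bar> < r" "\<bar>x - p\<bar> < d" using r d by (auto simp: x_def min_def)
    obtain z where z: "p < z" "z < x" "f x - f p = (x - p) * f' z" using MVT2[OF x(1), of f f'] f by auto
    have "f' z < 0" using r(2)[of z] z x by (auto simp: divide_less_0_iff)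
    then have "f x < 0" using z x p by (simp add: mult_pos_neg)
    then show False using d(2)[OF x(3)] by simp
  qed
  then have "\<forall>\<^sub>F x in at p. f' x / (x - p) > k / 2" by (intro order_tendstoD(1)[OF lim]) auto
  then obtain r where r: "r > 0" "\<And>x. x \<noteq> p \<Longrightarrow> \<bar>x - p\<bar> < r \<Longrightarrow> f' x / (x - p) > k / 2"
    by (auto simp: eventually_at dist_real_def)
  define g where "g x = f x - k / 4 * (x - p)\<^sup>2" for x
  have dg: "(g has_real_derivative f' x - k / 2 * (x - p)) (at x)" for x
    unfolding g_def by (auto intro!: derivative_eq_intros f)
  have "k / 4 * (x - p)\<^sup>2 \<le> f x" if x: "\<bar>x - p\<bar> \<le> r / 2" for x
  proof -
    consider "x = p" | "p < x" | "x < p" by linarith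
    then have "g x \<ge> g p"
    proof cases
      case 2
      obtain z where z: "p < z" "z < x" "g x - g p = (x - p) * (f' z - k / 2 * (z - p))" using MVT2[OF 2 dg] by auto
      have "f' z > k / 2 * (z - p)" using r(2)[of z] z x r(1) by (auto simp: pos_less_divide_eq)
      then have "(x - p) * (f' z - k / 2 * (z - p)) \<ge> 0" using 2 by (intro mult_nonneg_nonneg) auto
      then show ?thesis using z by simp
    next
      case 3
      obtain z where z: "x < z" "z < p" "g p - g x = (p - x) * (f' z - k / 2 * (z - p))" using MVT2[OF 3 dg] by auto
      have "f' z < k / 2 * (z - p)" using r(2)[of z] z x r(1) by (auto simp: neg_less_divide_eq)
      then have "(p - x) * (f' z - k / 2 * (z - p)) \<le> 0" using 3 by (intro mult_nonneg_nonpos) auto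
      then show ?thesis using z by simp
    qed simp
    then show ?thesis by (simp add: g_def p)
  qed
  then show ?thesis using that[of "r / 2" "k / 4"] r \<open>k > 0\<close> by simp
qed

text \<open>In the variables \<open>s = u\<^sup>2\<close> and \<open>t = v\<^sup>2\<close> the well
  is a boundary point of the quadrant. Along \<open>s\<close> it is an interior minimum with nonzero
  second derivative \<open>k\<close>; along \<open>t\<close> the slope \<open>D2\<close> is
  positive, and linear growth in \<open>t\<close> is quadratic growth in \<open>v\<close>.\<close>

lemma quadratic_growth_at_well:
  fixes F :: "real \<times> real \<Rightarrow> real"
  assumes F: "\<And>p. (F has_derivative (\<lambda>h. fst h * D1 p + snd h * D2 p)) (at p)"
    and D2: "continuous_on UNIV D2" and \<alpha>: "\<alpha> > 0"
    and k: "((\<lambda>s. D1 (s, 0)) has_real_derivative k) (at (\<alpha>\<^sup>2))" "k \<noteq> 0" and D2nz: "D2 (\<alpha>\<^sup>2, 0) \<noteq> 0"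
    and nn: "\<And>s t. s \<ge> 0 \<Longrightarrow> t \<ge> 0 \<Longrightarrow> F (s, t) \<ge> 0" and z: "F (\<alpha>\<^sup>2, 0) = 0"
  shows "\<exists>r>0. \<exists>c>0. \<forall>u v. u \<ge> 0 \<longrightarrow> v \<ge> 0 \<longrightarrow> dist (u, v) (\<alpha>, 0) \<le> r \<longrightarrow> c * (dist (u, v) (\<alpha>, 0))\<^sup>2 \<le> F (u\<^sup>2, v\<^sup>2)"
proof -
  have d1: "((\<lambda>s. F (s, t)) has_real_derivative D1 (s, t)) (at s)" for s t
  proof -
    have "((\<lambda>s. (s, t)) has_derivative (\<lambda>h. (h, 0))) (at s)" by (auto intro!: derivative_eq_intros)
    from has_derivative_compose[OF this F] show ?thesis by (simp add: has_field_derivative_def mult_commute_abs)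
  qed
  have d2: "((\<lambda>t. F (s, t)) has_real_derivative D2 (s, t)) (at t)" for s t
  proof -
    have "((\<lambda>t. (s, t)) has_derivative (\<lambda>h. (0, h))) (at t)" by (auto intro!: derivative_eq_intros)
    from has_derivative_compose[OF this F] show ?thesis by (simp add: has_field_derivative_def mult_commute_abs)
  qed
  obtain r1 c1 where rc: "r1 > 0" "c1 > 0" "\<And>x. \<bar>x - \<alpha>\<^sup>2\<bar> \<le> r1 \<Longrightarrow> c1 * (x - \<alpha>\<^sup>2)\<^sup>2 \<le> F (x, 0)"
  proof (rule quadratic_growth_at_min[OF d1 k z])
    show "\<alpha>\<^sup>2 > 0" using \<alpha> by simp
    show "0 \<le> F (x, 0)" if "\<bar>x - \<alpha>\<^sup>2\<bar> < \<alpha>\<^sup>2" for x using that by (intro nn) auto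
  qed (rule that)
  have "D2 (\<alpha>\<^sup>2, 0) > 0"
  proof (rule ccontr)
    assume "\<not> D2 (\<alpha>\<^sup>2, 0) > 0"
    with D2nz have "D2 (\<alpha>\<^sup>2, 0) < 0" by simp
    from DERIV_neg_dec_right[OF d2 this] obtain d where "d > 0" "\<And>h. 0 < h \<Longrightarrow> h < d \<Longrightarrow> F (\<alpha>\<^sup>2, 0 + h) < F (\<alpha>\<^sup>2, 0)" by blast
    from this(2)[of "d / 2"] \<open>d > 0\<close> z nn[of "\<alpha>\<^sup>2" "d / 2"] show False by simp
  qed
  define m where "m = D2 (\<alpha>\<^sup>2, 0) / 2"
  have m: "m > 0" using \<open>D2 (\<alpha>\<^sup>2, 0) > 0\<close> by (simp add: m_def)
  have "isCont D2 (\<alpha>\<^sup>2, 0)" using continuous_on_interior[OF D2] by simp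
  then obtain r2 where r2: "r2 > 0" "\<And>q. dist q (\<alpha>\<^sup>2, 0) < r2 \<Longrightarrow> dist (D2 q) (D2 (\<alpha>\<^sup>2, 0)) < m"
    using m by (metis continuous_at_eps_delta)
  have D2m: "D2 q \<ge> m" if "dist q (\<alpha>\<^sup>2, 0) < r2" for q
    using r2(2)[OF that] unfolding m_def dist_real_def by linarith
  have step: "c1 * (s - \<alpha>\<^sup>2)\<^sup>2 + m * t \<le> F (s, t)" if st: "\<bar>s - \<alpha>\<^sup>2\<bar> \<le> r1" "\<bar>s - \<alpha>\<^sup>2\<bar> < r2 / 2" "0 \<le> t" "t < r2 / 2" for s t
  proof (cases "t = 0")
    case True
    then show ?thesis using rc(3)[OF st(1)] by simp
  next
    case False
    with st have t: "0 < t" by simp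
    obtain \<xi> where \<xi>: "0 < \<xi>" "\<xi> < t" "F (s, t) - F (s, 0) = (t - 0) * D2 (s, \<xi>)"
      using MVT2[OF t, of "\<lambda>t. F (s, t)" "\<lambda>t. D2 (s, t)"] d2 by auto
    have "dist (s, \<xi>) (\<alpha>\<^sup>2, 0) \<le> \<bar>s - \<alpha>\<^sup>2\<bar> + \<bar>\<xi>\<bar>"
      using sqrt_sum_squares_le_sum_abs[of "s - \<alpha>\<^sup>2" \<xi>] by (simp add: dist_prod_def dist_real_def)
    also have "\<dots> < r2" using \<xi> st by simp
    finally have "D2 (s, \<xi>) \<ge> m" by (rule D2m)
    then have "t * D2 (s, \<xi>) \<ge> m * t" using t by (simp add: mult.commute)
    then show ?thesis using \<xi>(3) rc(3)[OF st(1)] by simp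
  qed
  \<comment> \<open>For \<open>\<bar>u - \<alpha>\<bar> \<le> r \<le> 1\<close> and
    \<open>0 \<le> v \<le> r\<close> the first squared variable moves by at most
    \<open>r * (2 * \<alpha> + 1)\<close> and the second by at most \<open>r\<close>; the minimum
    keeps both in the range of \<open>step\<close>.\<close>
  define r where "r = min 1 (min (r1 / (2 * \<alpha> + 1)) (min (r2 / (4 * (2 * \<alpha> + 1))) (r2 / 4)))"
  \<comment> \<open>The factor \<open>\<alpha>\<^sup>2\<close> comes from
    \<open>u + \<alpha> \<ge> \<alpha>\<close> in the factorization \<open>u\<^sup>2 -
    \<alpha>\<^sup>2 = (u - \<alpha>) * (u + \<alpha>)\<close>.\<close>
  define c where "c = min (c1 * \<alpha>\<^sup>2) m"
  have r: "r > 0" "r \<le> 1" "r * (2 * \<alpha> + 1) \<le> r1" "r * (2 * \<alpha> + 1) \<le> r2 / 4" "r \<le> r2 / 4"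
  proof -
    show "r > 0" using rc r2 \<alpha> by (auto simp: r_def)
    show "r \<le> 1" "r \<le> r2 / 4" unfolding r_def by (meson min.cobounded1 min.cobounded2 order_trans)+
    have "r \<le> r1 / (2 * \<alpha> + 1)" by (auto simp: r_def)
    then show "r * (2 * \<alpha> + 1) \<le> r1" using \<alpha> by (simp add: pos_le_divide_eq)
    have "r \<le> (r2 / 4) / (2 * \<alpha> + 1)" by (auto simp: r_def)
    then show "r * (2 * \<alpha> + 1) \<le> r2 / 4" using \<alpha> by (simp only: pos_le_divide_eq)
  qed
  have c: "c > 0" using rc m \<alpha> by (simp add: c_def)
  have "c * (dist (u, v) (\<alpha>, 0))\<^sup>2 \<le> F (u\<^sup>2, v\<^sup>2)" if uv: "u \<ge> 0" "v \<ge> 0" "dist (u, v) (\<alpha>, 0) \<le> r" for u v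
  proof -
    have u: "\<bar>u - \<alpha>\<bar> \<le> r" and v: "v \<le> r"
      using dist_fst_le[of "(u, v)" "(\<alpha>, 0)"] dist_snd_le[of "(u, v)" "(\<alpha>, 0)"] uv by (auto simp: dist_real_def)
    have fac: "u\<^sup>2 - \<alpha>\<^sup>2 = (u - \<alpha>) * (u + \<alpha>)" by (simp add: power2_eq_square algebra_simps)
    have "\<bar>u\<^sup>2 - \<alpha>\<^sup>2\<bar> \<le> r * (2 * \<alpha> + 1)"
      unfolding fac abs_mult using u uv \<alpha> r by (intro mult_mono) auto
    moreover have "v\<^sup>2 \<le> r * 1" unfolding power2_eq_square using v uv r by (intro mult_mono) auto
    ultimately have "c1 * (u\<^sup>2 - \<alpha>\<^sup>2)\<^sup>2 + m * v\<^sup>2 \<le> F (u\<^sup>2, v\<^sup>2)" using r r2(1) by (intro step) auto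
    moreover have "c * (u - \<alpha>)\<^sup>2 \<le> c1 * (u\<^sup>2 - \<alpha>\<^sup>2)\<^sup>2"
    proof -
      have "\<alpha>\<^sup>2 \<le> (u + \<alpha>)\<^sup>2" using uv \<alpha> by (intro power_mono) auto
      then have "c1 * \<alpha>\<^sup>2 * (u - \<alpha>)\<^sup>2 \<le> c1 * (u + \<alpha>)\<^sup>2 * (u - \<alpha>)\<^sup>2"
        using rc by (intro mult_right_mono mult_left_mono) auto
      moreover have "c * (u - \<alpha>)\<^sup>2 \<le> c1 * \<alpha>\<^sup>2 * (u - \<alpha>)\<^sup>2" by (intro mult_right_mono) (auto simp: c_def)
      ultimately have "c * (u - \<alpha>)\<^sup>2 \<le> c1 * (u + \<alpha>)\<^sup>2 * (u - \<alpha>)\<^sup>2" by linarith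
      then show ?thesis unfolding fac power_mult_distrib by (simp only: ac_simps)
    qed
    moreover have "c * v\<^sup>2 \<le> m * v\<^sup>2" by (intro mult_right_mono) (auto simp: c_def)
    moreover have "(dist (u, v) (\<alpha>, 0))\<^sup>2 = (u - \<alpha>)\<^sup>2 + v\<^sup>2" by (simp add: dist_prod_def dist_real_def)
    ultimately show ?thesis by (simp add: distrib_left)
  qed
  then show ?thesis using r c by blast
qed

section \<open>Derivatives of functions of the squared moduli\<close>

lemma Ck_continuous: "Ck k f \<Longrightarrow> continuous_on UNIV f"
  by (cases k) (auto simp: continuous_on_eq_continuous_at differentiable_imp_continuous_within)

lemma Ck_partial_derivatives:
  fixes F :: "real \<times> real \<Rightarrow> real"
  assumes "Ck (Suc k) F"
  shows "\<exists>D1 D2. (\<forall>p. (F has_derivative (\<lambda>h. fst h * D1 p + snd h * D2 p)) (at p)) \<and> Ck k D1 \<and> Ck k D2"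
proof -
  define D1 where "D1 p = frechet_derivative F (at p) (1, 0)" for p
  define D2 where "D2 p = frechet_derivative F (at p) (0, 1)" for p
  have "(F has_derivative (\<lambda>h. fst h * D1 p + snd h * D2 p)) (at p)" for p
  proof -
    have d: "(F has_derivative frechet_derivative F (at p)) (at p)"
      using assms unfolding Ck.simps frechet_derivative_works by blast
    then interpret l: linear "frechet_derivative F (at p)" by (rule has_derivative_linear)
    have "frechet_derivative F (at p) h = fst h * D1 p + snd h * D2 p" for h
    proof -
      have "h = fst h *\<^sub>R (1, 0) + snd h *\<^sub>R (0, 1)" by (simp add: prod_eq_iff)
      then have "frechet_derivative F (at p) h = frechet_derivative F (at p) (fst h *\<^sub>R (1, 0) + snd h *\<^sub>R (0, 1))" by simp
      also have "\<dots> = fst h * D1 p + snd h * D2 p" unfolding l.add l.scale by (simp add: D1_def D2_def)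
      finally show ?thesis .
    qed
    then show ?thesis using d by (metis (no_types, lifting) ext)
  qed
  moreover have "Ck k D1" "Ck k D2" using assms unfolding D1_def[abs_def] D2_def[abs_def] by auto
  ultimately show ?thesis by blast
qed

lemma hessian_of_squares:
  fixes F :: "real \<times> real \<Rightarrow> real"
  assumes w: "\<And>U. w U = F ((fst U)\<^sup>2, (snd U)\<^sup>2)"
    and F: "\<And>p. (F has_derivative (\<lambda>h. fst h * D1 p + snd h * D2 p)) (at p)"
    and E1: "\<And>p. (D1 has_derivative (\<lambda>h. fst h * D11 p + snd h * D12 p)) (at p)"
    and E2: "\<And>p. (D2 has_derivative (\<lambda>h. fst h * D21 p + snd h * D22 p)) (at p)"
  shows "(w has_derivative (\<lambda>h. 2 * fst U * fst h * D1 ((fst U)\<^sup>2, (snd U)\<^sup>2) + 2 * snd U * snd h * D2 ((fst U)\<^sup>2, (snd U)\<^sup>2))) (at U)"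
    and "hessian w U h v = (let p = ((fst U)\<^sup>2, (snd U)\<^sup>2) in
      2 * fst h * (fst v * D1 p + fst U * (2 * fst U * fst v * D11 p + 2 * snd U * snd v * D12 p)) +
      2 * snd h * (snd v * D2 p + snd U * (2 * fst U * fst v * D21 p + 2 * snd U * snd v * D22 p)))"
proof -
  have sq: "((\<lambda>U. ((fst U)\<^sup>2, (snd U)\<^sup>2)) has_derivative (\<lambda>h. (2 * fst U * fst h, 2 * snd U * snd h))) (at U)" for U :: "real \<times> real"
    by (auto intro!: derivative_eq_intros simp: fun_eq_iff)
  have dw: "(w has_derivative (\<lambda>h. 2 * fst U * fst h * D1 ((fst U)\<^sup>2, (snd U)\<^sup>2) + 2 * snd U * snd h * D2 ((fst U)\<^sup>2, (snd U)\<^sup>2))) (at U)" for U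
    using has_derivative_compose[OF sq F, of U] unfolding w[abs_def] by simp
  then show "(w has_derivative (\<lambda>h. 2 * fst U * fst h * D1 ((fst U)\<^sup>2, (snd U)\<^sup>2) + 2 * snd U * snd h * D2 ((fst U)\<^sup>2, (snd U)\<^sup>2))) (at U)" .
  have fd: "(\<lambda>q. frechet_derivative w (at q) h) = (\<lambda>q. 2 * fst q * fst h * D1 ((fst q)\<^sup>2, (snd q)\<^sup>2) + 2 * snd q * snd h * D2 ((fst q)\<^sup>2, (snd q)\<^sup>2))"
    by (rule ext) (subst frechet_derivative_at[OF dw, symmetric], rule refl)
  have "((\<lambda>q. frechet_derivative w (at q) h) has_derivative (\<lambda>v. let p = ((fst U)\<^sup>2, (snd U)\<^sup>2) in
      2 * fst h * (fst v * D1 p + fst U * (2 * fst U * fst v * D11 p + 2 * snd U * snd v * D12 p)) +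
      2 * snd h * (snd v * D2 p + snd U * (2 * fst U * fst v * D21 p + 2 * snd U * snd v * D22 p)))) (at U)"
    unfolding fd
    by (auto intro!: derivative_eq_intros has_derivative_compose[OF sq E1] has_derivative_compose[OF sq E2] simp: Let_def fun_eq_iff algebra_simps)
  from frechet_derivative_at[OF this, symmetric]
  show "hessian w U h v = (let p = ((fst U)\<^sup>2, (snd U)\<^sup>2) in
      2 * fst h * (fst v * D1 p + fst U * (2 * fst U * fst v * D11 p + 2 * snd U * snd v * D12 p)) +
      2 * snd h * (snd v * D2 p + snd U * (2 * fst U * fst v * D21 p + 2 * snd U * snd v * D22 p)))"
    by (simp add: hessian_def)
qed

lemma gradient_eq:
  assumes "(w has_derivative (\<lambda>h. D \<bullet> h)) (at U)"
  shows "gradient w U = D"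
  unfolding gradient_def
proof (rule the_equality)
  show "GDERIV w U :> D" using assms by (simp add: gderiv_def inner_commute)
  fix D' assume "GDERIV w U :> D'"
  then have "(\<lambda>h. h \<bullet> D') = (\<lambda>h. D \<bullet> h)" using assms has_derivative_unique by (auto simp: gderiv_def)
  then have "(D' - D) \<bullet> (D' - D) = 0" by (metis inner_commute inner_diff_right right_minus_eq)
  then show "D' = D" by simp
qed

text \<open>Non-degeneracy becomes \<open>quadratic\<close> through the derivatives of
  \<open>F\<close> at the wells, and radial coercivity with compactness becomes
  \<open>small\<close>. The rest is the chain rule.\<close>

lemma admissible_smooth_double_well:
  assumes adm: "admissible_potential W a b"
  obtains F1 F2 where "smooth_double_well W a b F1 F2"
proof -
  note adm_def = adm[unfolded admissible_potential_def]
  define w where "w = restrict_R2 W"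
  obtain F where CF: "Ck 3 F" and Ww: "\<And>z1 z2. W (z1, z2) = w (cmod z1, cmod z2)"
    and WF: "\<And>z1 z2. W (z1, z2) = F ((cmod z1)\<^sup>2, (cmod z2)\<^sup>2)"
    using adm_def unfolding w_def by blast
  have nonneg: "W z \<ge> 0" for z using adm_def by blast
  have ab: "a > 0" "b > 0" using adm_def by blast+
  have zero: "W (z1, z2) = 0 \<longleftrightarrow> (cmod z1, cmod z2) = (a, 0) \<or> (cmod z1, cmod z2) = (0, b)" for z1 z2
    using adm_def by blast
  have nda: "nondegenerate_global_min w (a, 0)" and ndb: "nondegenerate_global_min w (0, b)"
    using adm_def unfolding w_def by blast+
  obtain R0 c0 where coer: "R0 > 0" "c0 > 0"
    "\<And>U. fst U \<ge> 0 \<Longrightarrow> snd U \<ge> 0 \<Longrightarrow> norm U \<ge> R0 \<Longrightarrow> gradient w U \<bullet> U \<ge> c0 * (norm U)\<^sup>2"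
    using adm_def unfolding w_def by blast
  have wF: "w U = F ((fst U)\<^sup>2, (snd U)\<^sup>2)" for U by (simp add: w_def restrict_R2_def WF)
  have wW: "w U = W (of_real (fst U), of_real (snd U))" for U by (simp add: w_def restrict_R2_def)
  have "Ck (Suc 2) F" using CF by (simp add: numeral_3_eq_3 numeral_2_eq_2)
  from Ck_partial_derivatives[OF this] obtain D1 D2 where dF: "\<And>p. (F has_derivative (\<lambda>h. fst h * D1 p + snd h * D2 p)) (at p)"
    and C: "Ck 2 D1" "Ck 2 D2" by blast
  have "Ck (Suc 1) D1" "Ck (Suc 1) D2" using C by (simp_all add: numeral_2_eq_2)
  from this[THEN Ck_partial_derivatives] obtain D11 D12 D21 D22
    where dD1: "\<And>p. (D1 has_derivative (\<lambda>h. fst h * D11 p + snd h * D12 p)) (at p)"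
    and dD2: "\<And>p. (D2 has_derivative (\<lambda>h. fst h * D21 p + snd h * D22 p)) (at p)"
    by blast
  have cD: "continuous_on UNIV D1" "continuous_on UNIV D2" using C Ck_continuous by blast+
  have cF: "continuous_on UNIV F" using CF by (rule Ck_continuous)
  have Fnn: "F (s, t) \<ge> 0" if "s \<ge> 0" "t \<ge> 0" for s t
    using nonneg[of "(of_real (sqrt s), of_real (sqrt t))"] that by (simp add: WF)
  have Fa: "F (a\<^sup>2, 0) = 0" using zero[of "of_real a" 0] ab by (simp add: WF)
  have Fb: "F (0, b\<^sup>2) = 0" using zero[of 0 "of_real b"] ab by (simp add: WF)
  note dw = hessian_of_squares(1)[OF wF dF dD1 dD2]
  note hess = hessian_of_squares(2)[OF wF dF dD1 dD2]
  \<comment> \<open>Along the first variable \<open>(a\<^sup>2, 0)\<close> is an interior point of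
    the half-line, so the minimum makes \<open>D1\<close> vanish; along the second it is an
    endpoint, where a positive slope is possible.\<close>
  have D1a: "D1 (a\<^sup>2, 0) = 0"
  proof -
    have "((\<lambda>s. F (s, 0)) has_real_derivative D1 (a\<^sup>2, 0)) (at (a\<^sup>2))"
    proof -
      have "((\<lambda>s. (s, 0)) has_derivative (\<lambda>h. (h, 0))) (at (a\<^sup>2))" by (auto intro!: derivative_eq_intros)
      from has_derivative_compose[OF this dF] show ?thesis by (simp add: has_field_derivative_def mult_commute_abs)
    qed
    then show ?thesis
      by (rule DERIV_local_min[of _ _ _ "a\<^sup>2"]) (use ab Fa in \<open>auto intro!: Fnn\<close>)
  qed
  have D2b: "D2 (0, b\<^sup>2) = 0"
  proof -
    have "((\<lambda>t. F (0, t)) has_real_derivative D2 (0, b\<^sup>2)) (at (b\<^sup>2))"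
    proof -
      have "((\<lambda>t. (0, t)) has_derivative (\<lambda>h. (0, h))) (at (b\<^sup>2))" by (auto intro!: derivative_eq_intros)
      from has_derivative_compose[OF this dF] show ?thesis by (simp add: has_field_derivative_def mult_commute_abs)
    qed
    then show ?thesis
      by (rule DERIV_local_min[of _ _ _ "b\<^sup>2"]) (use ab Fb in \<open>auto intro!: Fnn\<close>)
  qed
  have nd: "\<exists>v. hessian w p u v \<noteq> 0" if "nondegenerate_global_min w p" "u \<noteq> 0" for p u
    using that unfolding nondegenerate_global_min_def by blast
  \<comment> \<open>Because \<open>D1\<close> vanishes there, the Hessian at \<open>(a, 0)\<close>
    is diagonal, with entries \<open>4 * a\<^sup>2 * D11 (a\<^sup>2, 0)\<close> and
    \<open>2 * D2 (a\<^sup>2, 0)\<close>; testing with the two unit vectors gives both.\<close>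
  have nza: "D11 (a\<^sup>2, 0) \<noteq> 0" "D2 (a\<^sup>2, 0) \<noteq> 0"
    using nd[OF nda, of "(1, 0)"] nd[OF nda, of "(0, 1)"] by (auto simp: hess Let_def D1a zero_prod_def)
  have nzb: "D22 (0, b\<^sup>2) \<noteq> 0" "D1 (0, b\<^sup>2) \<noteq> 0"
    using nd[OF ndb, of "(1, 0)"] nd[OF ndb, of "(0, 1)"] by (auto simp: hess Let_def D2b zero_prod_def)
  have "\<exists>r>0. \<exists>c>0. \<forall>u v. u \<ge> 0 \<longrightarrow> v \<ge> 0 \<longrightarrow> dist (u, v) (a, 0) \<le> r \<longrightarrow> c * (dist (u, v) (a, 0))\<^sup>2 \<le> F (u\<^sup>2, v\<^sup>2)"
  proof (rule quadratic_growth_at_well[OF dF cD(2) ab(1) _ nza])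
    have "((\<lambda>s. (s, 0)) has_derivative (\<lambda>h. (h, 0))) (at (a\<^sup>2))" by (auto intro!: derivative_eq_intros)
    from has_derivative_compose[OF this dD1]
    show "((\<lambda>s. D1 (s, 0)) has_real_derivative D11 (a\<^sup>2, 0)) (at (a\<^sup>2))"
      by (simp add: has_field_derivative_def mult_commute_abs)
  qed (use Fnn Fa in auto)
  then obtain ra ca where qa: "ra > 0" "ca > 0"
    "\<And>u v. u \<ge> 0 \<Longrightarrow> v \<ge> 0 \<Longrightarrow> dist (u, v) (a, 0) \<le> ra \<Longrightarrow> ca * (dist (u, v) (a, 0))\<^sup>2 \<le> F (u\<^sup>2, v\<^sup>2)" by blast
  \<comment> \<open>Exchanging the variables reduces the well \<open>(0, b)\<close> to the case
    already treated.\<close>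
  define F' D1' D2' where "F' p = F (snd p, fst p)" and "D1' p = D2 (snd p, fst p)" and "D2' p = D1 (snd p, fst p)" for p
  have "\<exists>r>0. \<exists>c>0. \<forall>u v. u \<ge> 0 \<longrightarrow> v \<ge> 0 \<longrightarrow> dist (u, v) (b, 0) \<le> r \<longrightarrow> c * (dist (u, v) (b, 0))\<^sup>2 \<le> F' (u\<^sup>2, v\<^sup>2)"
  proof (rule quadratic_growth_at_well[where k = "D22 (0, b\<^sup>2)" and ?D1.0 = D1' and ?D2.0 = D2'])
    show "(F' has_derivative (\<lambda>h. fst h * D1' p + snd h * D2' p)) (at p)" for p
    proof -
      have "((\<lambda>p. (snd p, fst p)) has_derivative (\<lambda>h. (snd h, fst h))) (at p)" by (auto intro!: derivative_eq_intros)
      from has_derivative_compose[OF this dF] show ?thesis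
        by (simp add: F'_def[abs_def] D1'_def D2'_def add.commute)
    qed
    show "continuous_on UNIV D2'" unfolding D2'_def[abs_def]
      by (intro continuous_on_compose2[OF cD(1)] continuous_intros) auto
    have "((\<lambda>t. (0, t)) has_derivative (\<lambda>h. (0, h))) (at (b\<^sup>2))" by (auto intro!: derivative_eq_intros)
    from has_derivative_compose[OF this dD2]
    show "((\<lambda>s. D1' (s, 0)) has_real_derivative D22 (0, b\<^sup>2)) (at (b\<^sup>2))"
      by (simp add: has_field_derivative_def mult_commute_abs D1'_def)
  qed (use Fnn Fb nzb ab in \<open>auto simp: F'_def D2'_def\<close>)
  then obtain rb cb where qb: "rb > 0" "cb > 0"
    "\<And>u v. u \<ge> 0 \<Longrightarrow> v \<ge> 0 \<Longrightarrow> dist (u, v) (b, 0) \<le> rb \<Longrightarrow> cb * (dist (u, v) (b, 0))\<^sup>2 \<le> F (v\<^sup>2, u\<^sup>2)"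
    unfolding F'_def by auto
  have Wmod: "W z = F ((fst (moduli z))\<^sup>2, (snd (moduli z))\<^sup>2)" for z by (cases z) (simp add: WF moduli_def)
  have cont: "continuous_on UNIV W"
    unfolding Wmod[abs_def] by (intro continuous_on_compose2[OF cF] continuous_intros continuous_on_id) auto
  have "\<exists>r>0. \<exists>c>0. \<forall>z. \<forall>p\<in>{(a, 0), (0, b)}. dist (moduli z) p \<le> r \<longrightarrow> c * (dist (moduli z) p)\<^sup>2 \<le> W z"
  proof (intro exI conjI allI ballI impI)
    show "min ra rb > 0" "min ca cb > 0" using qa qb by auto
    fix z and p assume p: "p \<in> {(a, 0), (0, b)}" and d: "dist (moduli z) p \<le> min ra rb"
    have m: "moduli z = (cmod (fst z), cmod (snd z))" by (simp add: moduli_def)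
    show "min ca cb * (dist (moduli z) p)\<^sup>2 \<le> W z"
    proof (cases "p = (a, 0)")
      case True
      have "min ca cb * (dist (moduli z) p)\<^sup>2 \<le> ca * (dist (moduli z) p)\<^sup>2" by (intro mult_right_mono) auto
      also have "\<dots> \<le> W z" using qa(3)[of "cmod (fst z)" "cmod (snd z)"] d True by (simp add: Wmod m)
      finally show ?thesis .
    next
      case False
      with p have pb: "p = (0, b)" by simp
      have sw: "dist (moduli z) p = dist (cmod (snd z), cmod (fst z)) (b, 0)"
        by (simp add: m pb dist_prod_def add.commute)
      have "min ca cb * (dist (moduli z) p)\<^sup>2 \<le> cb * (dist (moduli z) p)\<^sup>2" by (intro mult_right_mono) auto
      also have "\<dots> \<le> W z" using qb(3)[of "cmod (snd z)" "cmod (fst z)"] d unfolding sw by (simp add: Wmod m)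
      finally show ?thesis .
    qed
  qed
  note quadratic = this
  have grad: "gradient w U = (2 * fst U * D1 ((fst U)\<^sup>2, (snd U)\<^sup>2), 2 * snd U * D2 ((fst U)\<^sup>2, (snd U)\<^sup>2))" for U
  proof (rule gradient_eq)
    show "(w has_derivative (\<lambda>h. (2 * fst U * D1 ((fst U)\<^sup>2, (snd U)\<^sup>2), 2 * snd U * D2 ((fst U)\<^sup>2, (snd U)\<^sup>2)) \<bullet> h)) (at U)"
      using dw[of U] by (rule has_derivative_eq_rhs) (auto simp: fun_eq_iff inner_prod_def)
  qed
  have dwg: "(w has_derivative (\<lambda>h. gradient w U \<bullet> h)) (at U)" for U
    using dw[of U] by (rule has_derivative_eq_rhs) (auto simp: fun_eq_iff grad inner_prod_def)
  \<comment> \<open>Coercivity along the ray through \<open>U\<close>: between norm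
    \<open>R0\<close> and \<open>norm U\<close>, a length of at least \<open>1\<close>, the radial
    derivative is at least \<open>c0 * R0\<close>, and \<open>w\<close> is nonnegative at the
    start.\<close>
  have big: "c0 * R0 \<le> w U" if U: "fst U \<ge> 0" "snd U \<ge> 0" "norm U \<ge> R0 + 1" for U
  proof -
    have nU: "norm U > 0" using U coer by linarith
    define s where "s = R0 / norm U"
    have s: "0 < s" "s < 1" using nU U coer by (auto simp: s_def)
    have ray: "((\<lambda>t. w (t *\<^sub>R U)) has_real_derivative gradient w (t *\<^sub>R U) \<bullet> U) (at t)" for t
    proof -
      have "((\<lambda>t. t *\<^sub>R U) has_derivative (\<lambda>h. h *\<^sub>R U)) (at t)" by (auto intro!: derivative_eq_intros)
      from has_derivative_compose[OF this dwg] show ?thesis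
        by (simp add: has_field_derivative_def mult_commute_abs)
    qed
    obtain \<xi> where \<xi>: "s < \<xi>" "\<xi> < 1" "w (1 *\<^sub>R U) - w (s *\<^sub>R U) = (1 - s) * (gradient w (\<xi> *\<^sub>R U) \<bullet> U)"
      using MVT2[OF s(2), of "\<lambda>t. w (t *\<^sub>R U)" "\<lambda>t. gradient w (t *\<^sub>R U) \<bullet> U"] ray by blast
    have x: "\<xi> > 0" "\<xi> * norm U \<ge> R0"
      using \<xi>(1) s(1) nU by (linarith, simp add: s_def pos_divide_less_eq)
    have "c0 * (norm (\<xi> *\<^sub>R U))\<^sup>2 \<le> gradient w (\<xi> *\<^sub>R U) \<bullet> (\<xi> *\<^sub>R U)"
      using x U by (intro coer) auto
    then have "\<xi> * (c0 * \<xi> * (norm U)\<^sup>2) \<le> \<xi> * (gradient w (\<xi> *\<^sub>R U) \<bullet> U)"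
      using x by (simp add: power_mult_distrib power2_eq_square algebra_simps)
    then have "c0 * \<xi> * (norm U)\<^sup>2 \<le> gradient w (\<xi> *\<^sub>R U) \<bullet> U" using x by simp
    moreover have "c0 * R0 * norm U \<le> c0 * \<xi> * (norm U)\<^sup>2"
    proof -
      have "c0 * R0 * norm U \<le> c0 * (\<xi> * norm U) * norm U"
        using coer x nU by (intro mult_right_mono mult_left_mono) auto
      then show ?thesis by (simp add: power2_eq_square mult.assoc)
    qed
    ultimately have "(1 - s) * (c0 * R0 * norm U) \<le> (1 - s) * (gradient w (\<xi> *\<^sub>R U) \<bullet> U)"
      using s by (intro mult_left_mono) auto
    moreover have "(1 - s) * (c0 * R0 * norm U) = c0 * R0 * (norm U - R0)" using nU by (simp add: s_def field_simps)
    moreover have "c0 * R0 * 1 \<le> c0 * R0 * (norm U - R0)" using U coer by (intro mult_left_mono) auto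
    moreover have "w (s *\<^sub>R U) \<ge> 0" by (simp add: wW nonneg)
    ultimately show ?thesis using \<xi>(3) by simp
  qed
  have cw: "continuous_on S w" for S
    using dw has_derivative_continuous by (intro continuous_at_imp_continuous_on) blast
  \<comment> \<open>Up to norm \<open>R0 + 1\<close>, \<open>w\<close> has a positive lower bound on
    the compact set \<open>K\<close> of points of the quadrant at distance at least \<open>e\<close>
    from both wells; beyond that norm \<open>big\<close> applies.\<close>
  have small: "\<exists>\<delta>>0. \<forall>z. W z < \<delta> \<longrightarrow> dist (moduli z) (a, 0) < e \<or> dist (moduli z) (0, b) < e" if e: "e > 0" for e
  proof -
    define K where "K = {U. 0 \<le> fst U \<and> 0 \<le> snd U \<and> norm U \<le> R0 + 1 \<and> e \<le> dist U (a, 0) \<and> e \<le> dist U (0, b)}"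
    have "closed K" unfolding K_def by (intro closed_Collect_conj closed_Collect_le continuous_intros)
    moreover have "bounded K" unfolding bounded_iff K_def by blast
    ultimately have "compact K" by (simp add: compact_eq_bounded_closed)
    have pos: "w U > 0" if "U \<in> K" for U
    proof -
      have "w U \<noteq> 0"
        using that e zero[of "of_real (fst U)" "of_real (snd U)"] by (cases U) (auto simp: wW K_def)
      then show ?thesis using nonneg by (simp add: wW order.not_eq_order_implies_strict)
    qed
    have "\<exists>\<delta>>0. \<forall>U\<in>K. \<delta> \<le> w U"
    proof (cases "K = {}")
      case False
      then obtain U0 where "U0 \<in> K" "\<forall>U\<in>K. w U0 \<le> w U"
        using continuous_attains_inf[OF \<open>compact K\<close> _ cw] by blast
      then show ?thesis using pos by blast
    qed (auto intro: exI[of _ 1])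
    then obtain \<delta> where \<delta>: "\<delta> > 0" "\<And>U. U \<in> K \<Longrightarrow> \<delta> \<le> w U" by blast
    have "dist (moduli z) (a, 0) < e \<or> dist (moduli z) (0, b) < e" if "W z < min \<delta> (c0 * R0)" for z
    proof (rule ccontr)
      assume n: "\<not> ?thesis"
      have Wz: "W z = w (moduli z)" by (cases z) (simp add: Ww moduli_def)
      have nn: "fst (moduli z) \<ge> 0" "snd (moduli z) \<ge> 0" by (auto simp: moduli_def)
      show False
      proof (cases "norm (moduli z) \<le> R0 + 1")
        case True
        then have "moduli z \<in> K" using n nn by (simp add: K_def)
        from \<delta>(2)[OF this] show False using that Wz by simp
      next
        case False
        then have "c0 * R0 \<le> w (moduli z)" by (intro big nn) simp
        then show False using that Wz by simp
      qed
    qed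
    then show ?thesis using \<delta>(1) coer by (intro exI[of _ "min \<delta> (c0 * R0)"]) auto
  qed
  define F1 where "F1 z = D1 ((cmod (fst z))\<^sup>2, (cmod (snd z))\<^sup>2)" for z :: "complex \<times> complex"
  define F2 where "F2 z = D2 ((cmod (fst z))\<^sup>2, (cmod (snd z))\<^sup>2)" for z :: "complex \<times> complex"
  have "smooth_double_well W a b F1 F2"
  proof
    show "0 < a" "0 < b" by (fact ab)+
    show "continuous_on UNIV W" by (fact cont)
    show "0 \<le> W z" for z by (fact nonneg)
    show "W z = W z'" if "moduli z = moduli z'" for z z' using that by (simp add: Wmod)
    show "W z = 0" if "moduli z = (a, 0) \<or> moduli z = (0, b)" for z
      using that zero[of "fst z" "snd z"] by (simp add: moduli_def)
    show "\<exists>\<delta>>0. \<forall>z. W z < \<delta> \<longrightarrow> dist (moduli z) (a, 0) < e \<or> dist (moduli z) (0, b) < e" if "e > 0" for e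
      using that by (rule small)
    show "\<exists>r>0. \<exists>c>0. \<forall>z. \<forall>p\<in>{(a, 0), (0, b)}. dist (moduli z) p \<le> r \<longrightarrow> c * (dist (moduli z) p)\<^sup>2 \<le> W z"
      by (fact quadratic)
    show "continuous_on UNIV F1" unfolding F1_def by (intro continuous_on_compose2[OF cD(1)] continuous_intros) auto
    show "continuous_on UNIV F2" unfolding F2_def by (intro continuous_on_compose2[OF cD(2)] continuous_intros) auto
    show "(W has_derivative (\<lambda>v. 2 * ((F1 z *\<^sub>R fst z, F2 z *\<^sub>R snd z) \<bullet> v))) (at z)" for z
    proof -
      \<comment> \<open>Squared moduli are written as inner products, which are differentiable at
        \<open>0\<close> as well, unlike \<open>cmod\<close>.\<close>
      have W: "W = (\<lambda>z. F (fst z \<bullet> fst z, snd z \<bullet> snd z))"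
        by (rule ext) (simp add: Wmod moduli_def power2_norm_eq_inner)
      have "((\<lambda>z. (fst z \<bullet> fst z, snd z \<bullet> snd z)) has_derivative (\<lambda>v. (2 * (fst z \<bullet> fst v), 2 * (snd z \<bullet> snd v)))) (at z)"
        by (auto intro!: derivative_eq_intros simp: fun_eq_iff inner_commute)
      from has_derivative_compose[OF this dF] show ?thesis
        unfolding W by (rule has_derivative_eq_rhs)
          (auto simp: fun_eq_iff F1_def F2_def inner_prod_def power2_norm_eq_inner)
    qed
  qed
  then show ?thesis by (rule that)
qed

section \<open>The main theorem\<close>

lemma energy_primitive:
  assumes P: "primitive_of g \<Psi>"
  shows "energy W \<Psi> = (1 / 2) * (\<integral>\<^sup>+x. ennreal ((norm (g x))\<^sup>2 + W (\<Psi> x)) \<partial>lborel)"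
proof -
  have 1: "AE x in lborel. weak_derivative (\<lambda>y. fst (\<Psi> y)) x = fst (g x)"
    by (rule primitive_of_weak_derivative(2)[OF primitive_of_bounded_linear[OF P bounded_linear_fst]])
  have 2: "AE x in lborel. weak_derivative (\<lambda>y. snd (\<Psi> y)) x = snd (g x)"
    by (rule primitive_of_weak_derivative(2)[OF primitive_of_bounded_linear[OF P bounded_linear_snd]])
  have "(\<integral>\<^sup>+x. ennreal ((cmod (weak_derivative (\<lambda>y. fst (\<Psi> y)) x))\<^sup>2 +
       (cmod (weak_derivative (\<lambda>y. snd (\<Psi> y)) x))\<^sup>2 + W (\<Psi> x)) \<partial>lborel)
    = (\<integral>\<^sup>+x. ennreal ((norm (g x))\<^sup>2 + W (\<Psi> x)) \<partial>lborel)"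
    by (rule nn_integral_cong_AE, use 1 2 in eventually_elim) (simp add: norm_prod_def)
  then show ?thesis by (simp add: energy_def)
qed

lemma ennreal_tendsto_0I:
  fixes f :: "'b \<Rightarrow> ennreal"
  assumes "\<And>e. e > 0 \<Longrightarrow> \<forall>\<^sub>F x in F. f x \<le> ennreal e"
  shows "(f \<longlongrightarrow> 0) F"
proof (rule order_tendstoI)
  fix c :: ennreal assume "0 < c"
  then obtain y where y: "0 < y" "y < c" using dense by blast
  then have "y < top" using less_le_trans top_greatest by blast
  with y obtain e where e: "y = ennreal e" "e > 0" by (cases y) auto
  show "\<forall>\<^sub>F x in F. f x < c"
    using assms[OF e(2)] by eventually_elim (use y e in auto)
qed simp

lemma L2_norm_le:
  assumes g: "square_integrable g" and le: "AE x in lborel. norm (f x) \<le> norm (g x)"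
  shows "L2_norm f \<le> ennreal (sqrt (sq_norm g))"
proof -
  have "(\<integral>\<^sup>+x. ennreal ((norm (f x))\<^sup>2) \<partial>lborel) \<le> (\<integral>\<^sup>+x. ennreal ((norm (g x))\<^sup>2) \<partial>lborel)"
    by (rule nn_integral_mono_AE, use le in eventually_elim) (auto intro!: ennreal_leI power_mono)
  also have "\<dots> = ennreal (sq_norm g)"
    unfolding sq_norm_def using g by (intro nn_integral_eq_integral) (auto simp: square_integrable_def)
  finally have le: "(\<integral>\<^sup>+x. ennreal ((norm (f x))\<^sup>2) \<partial>lborel) \<le> ennreal (sq_norm g)" .
  then have "(\<integral>\<^sup>+x. ennreal ((norm (f x))\<^sup>2) \<partial>lborel) \<noteq> \<infinity>" by (auto simp: top_unique)
  moreover have "enn2real (\<integral>\<^sup>+x. ennreal ((norm (f x))\<^sup>2) \<partial>lborel) \<le> sq_norm g"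
    using enn2real_mono[OF le] sq_norm_nonneg[of g] by simp
  ultimately show ?thesis by (simp add: L2_norm_def Let_def ennreal_leI)
qed

lemma Linf_norm_on_le:
  fixes f :: "real \<Rightarrow> complex"
  assumes "continuous_on UNIV f" "\<And>x. x \<in> S \<Longrightarrow> norm (f x) \<le> c" "S \<in> sets borel"
  shows "Linf_norm_on S f \<le> ennreal c"
  unfolding Linf_norm_on_def
proof (rule esssup_I)
  have [measurable]: "f \<in> borel_measurable borel" using assms(1) by (rule borel_measurable_continuous_onI)
  show "(\<lambda>x. ennreal (norm (f x))) \<in> borel_measurable (restrict_space lborel S)"
    by (intro measurable_restrict_space1) simp
  show "AE x in restrict_space lborel S. ennreal (norm (f x)) \<le> ennreal c"
    using assms by (intro AE_I2) (auto simp: space_restrict_space intro: ennreal_leI)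
qed

text \<open>\<open>pr\<close> stands for either projection. The three summands use, in this order,
  strong convergence of the derivatives, L^2 convergence of the moduli and locally uniform
  convergence.\<close>

lemma rho_comp_tendsto_0:
  fixes pr :: "complex \<times> complex \<Rightarrow> complex"
  assumes pr: "bounded_linear pr" "\<And>z. norm (pr z) \<le> norm z"
    and prm: "\<And>z z'. \<bar>cmod (pr z) - cmod (pr z')\<bar> \<le> norm (moduli z - moduli z')"
    and \<Theta>: "\<And>n. primitive_of (\<gamma> n) (\<Theta> n)" "\<And>n. square_integrable (\<gamma> n)"
    and \<Phi>: "primitive_of h \<Phi>" "square_integrable h"
    and u: "\<And>R. uniform_limit {-R..R} \<Theta> \<Phi> sequentially"
    and sq: "(\<lambda>n. sq_norm (\<lambda>x. \<gamma> n x - h x)) \<longlonglongrightarrow> 0"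
    and mod: "\<And>e. e > 0 \<Longrightarrow> \<forall>\<^sub>F n in sequentially. square_integrable (\<lambda>x. moduli (\<Theta> n x) - moduli (\<Phi> x)) \<and>
      sq_norm (\<lambda>x. moduli (\<Theta> n x) - moduli (\<Phi> x)) < e"
  shows "(\<lambda>n. rho_comp A (\<lambda>x. pr (\<Theta> n x)) (\<lambda>x. pr (\<Phi> x))) \<longlonglongrightarrow> 0"
proof -
  interpret pr: bounded_linear pr by (rule pr)
  have "(\<lambda>n. L2_norm (\<lambda>x. weak_derivative (\<lambda>x. pr (\<Theta> n x)) x - weak_derivative (\<lambda>x. pr (\<Phi> x)) x)) \<longlonglongrightarrow> 0"
  proof (rule ennreal_tendsto_0I)
    fix e :: real assume "e > 0"
    then have "\<forall>\<^sub>F n in sequentially. sq_norm (\<lambda>x. \<gamma> n x - h x) < e\<^sup>2" using sq by (intro order_tendstoD) auto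
    then show "\<forall>\<^sub>F n in sequentially. L2_norm (\<lambda>x. weak_derivative (\<lambda>x. pr (\<Theta> n x)) x - weak_derivative (\<lambda>x. pr (\<Phi> x)) x) \<le> ennreal e"
    proof eventually_elim
      case (elim n)
      have "L2_norm (\<lambda>x. weak_derivative (\<lambda>x. pr (\<Theta> n x)) x - weak_derivative (\<lambda>x. pr (\<Phi> x)) x) \<le> ennreal (sqrt (sq_norm (\<lambda>x. \<gamma> n x - h x)))"
      proof (rule L2_norm_le)
        show "square_integrable (\<lambda>x. \<gamma> n x - h x)" using \<Theta>(2) \<Phi>(2) by (rule square_integrable_diff)
        show "AE x in lborel. norm (weak_derivative (\<lambda>x. pr (\<Theta> n x)) x - weak_derivative (\<lambda>x. pr (\<Phi> x)) x) \<le> norm (\<gamma> n x - h x)"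
          using primitive_of_weak_derivative(2)[OF primitive_of_bounded_linear[OF \<Theta>(1) pr(1)], of n]
            primitive_of_weak_derivative(2)[OF primitive_of_bounded_linear[OF \<Phi>(1) pr(1)]]
          by eventually_elim (simp add: pr.diff[symmetric] pr(2))
      qed
      also have "\<dots> \<le> ennreal e"
        using real_sqrt_le_mono[of "sq_norm (\<lambda>x. \<gamma> n x - h x)" "e\<^sup>2"] elim \<open>e > 0\<close> by (intro ennreal_leI) simp
      finally show ?case .
    qed
  qed
  moreover have "(\<lambda>n. L2_norm (\<lambda>x. cmod (pr (\<Theta> n x)) - cmod (pr (\<Phi> x)))) \<longlonglongrightarrow> 0"
  proof (rule ennreal_tendsto_0I)
    fix e :: real assume "e > 0"
    then have "e\<^sup>2 > 0" by simp
    from mod[OF this] show "\<forall>\<^sub>F n in sequentially. L2_norm (\<lambda>x. cmod (pr (\<Theta> n x)) - cmod (pr (\<Phi> x))) \<le> ennreal e"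
    proof eventually_elim
      case (elim n)
      have "L2_norm (\<lambda>x. cmod (pr (\<Theta> n x)) - cmod (pr (\<Phi> x))) \<le> ennreal (sqrt (sq_norm (\<lambda>x. moduli (\<Theta> n x) - moduli (\<Phi> x))))"
        using elim prm by (intro L2_norm_le AE_I2) auto
      also have "\<dots> \<le> ennreal e"
        using real_sqrt_le_mono[of "sq_norm (\<lambda>x. moduli (\<Theta> n x) - moduli (\<Phi> x))" "e\<^sup>2"] elim \<open>e > 0\<close> by (intro ennreal_leI) simp
      finally show ?case .
    qed
  qed
  moreover have "(\<lambda>n. Linf_norm_on {-A<..<A} (\<lambda>x. pr (\<Theta> n x) - pr (\<Phi> x))) \<longlonglongrightarrow> 0"
  proof (rule ennreal_tendsto_0I)
    fix e :: real assume "e > 0"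
    from uniform_limitD[OF u this, of A]
    show "\<forall>\<^sub>F n in sequentially. Linf_norm_on {-A<..<A} (\<lambda>x. pr (\<Theta> n x) - pr (\<Phi> x)) \<le> ennreal e"
    proof eventually_elim
      case (elim n)
      show ?case
      proof (rule Linf_norm_on_le)
        show "continuous_on UNIV (\<lambda>x. pr (\<Theta> n x) - pr (\<Phi> x))"
          using primitive_of_continuous[OF primitive_of_bounded_linear[OF \<Theta>(1) pr(1)]]
            primitive_of_continuous[OF primitive_of_bounded_linear[OF \<Phi>(1) pr(1)]] by (intro continuous_intros)
        show "norm (pr (\<Theta> n x) - pr (\<Phi> x)) \<le> e" if "x \<in> {-A<..<A}" for x
        proof -
          have "norm (pr (\<Theta> n x - \<Phi> x)) \<le> norm (\<Theta> n x - \<Phi> x)" by (rule pr(2))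
          also have "\<dots> < e" using elim that by (simp add: dist_norm)
          finally show ?thesis by (simp add: pr.diff)
        qed
      qed simp
    qed
  qed
  ultimately have "(\<lambda>n. rho_comp A (\<lambda>x. pr (\<Theta> n x)) (\<lambda>x. pr (\<Phi> x))) \<longlonglongrightarrow> 0 + 0 + 0"
    unfolding rho_comp_def by (intro tendsto_add)
  then show ?thesis by simp
qed

context double_well
begin

lemma competitor_space_Y:
  assumes "competitor \<Psi> g"
  shows "\<Psi> \<in> space_Y a b" "energy W \<Psi> = ennreal (total \<Psi> g / 2)"
proof -
  note c = assms[unfolded competitor_def]
  have "\<Psi> \<in> H1_loc" using c square_integrable_L2_loc H1_loc_iff by blast
  then show "\<Psi> \<in> space_Y a b"
    using c by (simp add: space_Y_def tendsto_dist_iff[where l = "(_, _)"] moduli_def)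
  have i: "integrable lborel (density \<Psi> g)" "total \<Psi> g = (\<integral>x. density \<Psi> g x \<partial>lborel)"
    using c density_integrable by blast+
  have "energy W \<Psi> = (1 / 2) * (\<integral>\<^sup>+x. ennreal (density \<Psi> g x) \<partial>lborel)"
    using c energy_primitive by (simp add: density_def)
  also have "(\<integral>\<^sup>+x. ennreal (density \<Psi> g x) \<partial>lborel) = ennreal (total \<Psi> g)"
    unfolding i(2) using i(1) density_nonneg by (intro nn_integral_eq_integral) auto
  also have "(1 / 2) * ennreal (total \<Psi> g) = ennreal ((1 / 2) * total \<Psi> g)"
  proof -
    have half: "(1 / 2 :: ennreal) = ennreal (1 / 2)" using divide_ennreal[of 1 2] by simp
    show ?thesis unfolding half by (rule ennreal_mult'[symmetric]) simp
  qed
  finally show "energy W \<Psi> = ennreal (total \<Psi> g / 2)" by simp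
qed

text \<open>Membership in \<open>space_Y a b\<close> gives only local square integrability of the
  derivative. The global integrability of both parts is extracted from the finiteness of their
  nonnegative sum.\<close>

lemma space_Y_competitor:
  assumes Y: "\<Psi> \<in> space_Y a b" and fin: "energy W \<Psi> < \<infinity>"
  obtains g where "competitor \<Psi> g"
proof -
  obtain g where g: "g \<in> L2_loc" "primitive_of g \<Psi>" using Y by (auto simp: space_Y_def H1_loc_iff)
  have c\<Psi>: "continuous_on UNIV \<Psi>" using g(2) by (rule primitive_of_continuous)
  have m: "g \<in> borel_measurable borel" "(\<lambda>x. W (\<Psi> x)) \<in> borel_measurable borel"
    using g(1) borel_measurable_continuous_onI[OF continuous_W[OF c\<Psi>]] by (auto simp: L2_loc_def)
  have "(\<integral>\<^sup>+x. ennreal ((norm (g x))\<^sup>2 + W (\<Psi> x)) \<partial>lborel) < \<infinity>"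
    using fin energy_primitive[OF g(2), of W] by (auto simp: ennreal_mult_less_top less_top[symmetric])
  then have i: "integrable lborel (\<lambda>x. (norm (g x))\<^sup>2 + W (\<Psi> x))"
    using m nonneg by (intro integrableI_nonneg) auto
  have "integrable lborel (\<lambda>x. (norm (g x))\<^sup>2)"
    by (rule Bochner_Integration.integrable_bound[OF i]) (use m nonneg in auto)
  moreover have "integrable lborel (\<lambda>x. W (\<Psi> x))"
    by (rule Bochner_Integration.integrable_bound[OF i]) (use m nonneg in auto)
  ultimately have "competitor \<Psi> g"
    using Y g(2) m by (simp add: competitor_def square_integrable_def space_Y_def tendsto_dist_iff[where l = "(_, _)"] moduli_def)
  then show ?thesis by (rule that)
qed

text \<open>The straight segment from \<open>(0, b)\<close> to \<open>(a, 0)\<close>, run through in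
  unit time with rest before and after, shows that the infimum is finite.\<close>

lemma competitor_exists: "\<exists>\<Psi> g. competitor \<Psi> g"
proof -
  define v :: "complex \<times> complex" where "v = (of_real a, - of_real b)"
  define B :: "complex \<times> complex" where "B = (0, of_real b)"
  define \<Psi> where "\<Psi> y = max (min y 1) 0 *\<^sub>R v + B" for y
  define g where "g y = indicator {..1} y *\<^sub>R (indicator {0..} y *\<^sub>R v) + 0" for y :: real
  have "primitive_of (\<lambda>_. v) (\<lambda>y. y *\<^sub>R v)"
    by (rule primitive_of_C1) (auto intro!: derivative_eq_intros continuous_intros)
  note P = primitive_of_add[OF primitive_of_stop[OF primitive_of_start[OF this, of 0], of 1] primitive_of_const[of B]]
  have P: "primitive_of g \<Psi>" using P by (simp only: g_def[abs_def] \<Psi>_def[abs_def])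
  have left: "moduli (\<Psi> y) = (0, b)" if "y \<le> 0" for y using that ab by (simp add: \<Psi>_def B_def moduli_def)
  have right: "moduli (\<Psi> y) = (a, 0)" if "y \<ge> 1" for y using that ab by (simp add: \<Psi>_def B_def v_def moduli_def)
  have sg: "square_integrable g"
    unfolding square_integrable_def
  proof (intro conjI)
    show "g \<in> borel_measurable borel" using P primitive_ofD(1) locally_integrable_measurable by blast
    have "(\<lambda>x. (norm (g x))\<^sup>2) = (\<lambda>x. indicator {0..1} x *\<^sub>R (norm v)\<^sup>2)"
      by (auto simp: g_def indicator_def fun_eq_iff)
    then show "integrable lborel (\<lambda>x. (norm (g x))\<^sup>2)"
      using locally_integrableD[OF continuous_locally_integrable[of "\<lambda>_. (norm v)\<^sup>2"], of 0 1]
      by (simp add: set_integrable_def)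
  qed
  have "W (\<Psi> x) = 0" if "x \<notin> {0..1}" for x using that left[of x] right[of x] by (intro zero) force
  then have "(\<lambda>x. W (\<Psi> x)) = (\<lambda>x. indicator {0..1} x *\<^sub>R W (\<Psi> x))" by (auto simp: indicator_def fun_eq_iff)
  moreover have "integrable lborel (\<lambda>x. indicator {0..1} x *\<^sub>R W (\<Psi> x))"
    using locally_integrableD[OF continuous_locally_integrable[OF continuous_W[OF primitive_of_continuous[OF P]]], of 0 1]
    by (simp add: set_integrable_def)
  ultimately have Wi: "integrable lborel (\<lambda>x. W (\<Psi> x))" by simp
  have "((\<lambda>x. dist (moduli (\<Psi> x)) (a, 0)) \<longlongrightarrow> 0) at_top"
    by (rule tendsto_eventually, rule eventually_mono[OF eventually_ge_at_top[of 1]]) (simp add: right)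
  moreover have "((\<lambda>x. dist (moduli (\<Psi> x)) (0, b)) \<longlongrightarrow> 0) at_bot"
    by (rule tendsto_eventually, rule eventually_mono[OF eventually_le_at_bot[of 0]]) (simp add: left)
  ultimately show ?thesis using P sg Wi unfolding competitor_def by blast
qed

end

lemma moduli_component_le:
  "\<bar>cmod (fst z) - cmod (fst z')\<bar> \<le> norm (moduli z - moduli z')"
  "\<bar>cmod (snd z) - cmod (snd z')\<bar> \<le> norm (moduli z - moduli z')"
  using dist_fst_le[of "moduli z" "moduli z'"] dist_snd_le[of "moduli z" "moduli z'"]
  by (simp_all add: moduli_def dist_norm)

context smooth_double_well
begin

lemma minimizing_sequence_rho:
  assumes comp: "\<And>n. competitor (\<Psi> n) (g n)"
    and lower: "\<And>\<Phi> h. competitor \<Phi> h \<Longrightarrow> M \<le> total \<Phi> h"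
    and lim: "(\<lambda>n. total (\<Psi> n) (g n)) \<longlonglongrightarrow> M"
  obtains \<Phi> h \<tau> k where "competitor \<Phi> h" "total \<Phi> h = M" "strict_mono (k :: nat \<Rightarrow> nat)"
    "\<And>A. (\<lambda>n. rho A (\<lambda>x. \<Psi> (k n) (x + \<tau> (k n))) \<Phi>) \<longlonglongrightarrow> 0"
proof -
  obtain \<Phi> h \<tau> k where lim': "competitor \<Phi> h" "total \<Phi> h = M" "strict_mono (k :: nat \<Rightarrow> nat)"
    "\<And>R. uniform_limit {-R..R} (\<lambda>n x. \<Psi> (k n) (x + \<tau> (k n))) \<Phi> sequentially"
    "(\<lambda>n. sq_norm (\<lambda>x. g (k n) (x + \<tau> (k n)) - h x)) \<longlonglongrightarrow> 0"
    "(\<lambda>n. \<integral>x. W (\<Psi> (k n) (x + \<tau> (k n))) \<partial>lborel) \<longlonglongrightarrow> (\<integral>x. W (\<Phi> x) \<partial>lborel)"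
  proof (rule minimizing_limit[OF comp _ lim])
    show "M \<le> total \<Phi> h" if "competitor \<Phi> h" for \<Phi> h using that by (rule lower)
  qed (rule that)
  define \<Theta> \<gamma> where "\<Theta> n x = \<Psi> (k n) (x + \<tau> (k n))" and "\<gamma> n x = g (k n) (x + \<tau> (k n))" for n x
  have c: "competitor (\<Theta> n) (\<gamma> n)" for n
    unfolding \<Theta>_def \<gamma>_def by (rule competitor_translate(1)[OF comp])
  have mod: "\<forall>\<^sub>F n in sequentially. square_integrable (\<lambda>x. moduli (\<Theta> n x) - moduli (\<Phi> x)) \<and>
      sq_norm (\<lambda>x. moduli (\<Theta> n x) - moduli (\<Phi> x)) < e" if "e > 0" for e
    using c lim'(1) lim'(4-6)[folded \<Theta>_def \<gamma>_def] that by (rule moduli_convergence)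
  have P: "primitive_of (\<gamma> n) (\<Theta> n)" "square_integrable (\<gamma> n)" "primitive_of h \<Phi>" "square_integrable h" for n
    using c lim'(1) by (auto simp: competitor_def)
  have "(\<lambda>n. rho A (\<Theta> n) \<Phi>) \<longlonglongrightarrow> 0" for A
  proof -
    have "(\<lambda>n. rho_comp A (\<lambda>x. fst (\<Theta> n x)) (\<lambda>x. fst (\<Phi> x)) + rho_comp A (\<lambda>x. snd (\<Theta> n x)) (\<lambda>x. snd (\<Phi> x))) \<longlonglongrightarrow> 0 + 0"
    proof (rule tendsto_add)
      show "(\<lambda>n. rho_comp A (\<lambda>x. fst (\<Theta> n x)) (\<lambda>x. fst (\<Phi> x))) \<longlonglongrightarrow> 0"
        by (rule rho_comp_tendsto_0[OF bounded_linear_fst _ moduli_component_le(1) P lim'(4,5)[folded \<Theta>_def \<gamma>_def] mod])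
           (simp add: norm_prod_def)
      show "(\<lambda>n. rho_comp A (\<lambda>x. snd (\<Theta> n x)) (\<lambda>x. snd (\<Phi> x))) \<longlonglongrightarrow> 0"
        by (rule rho_comp_tendsto_0[OF bounded_linear_snd _ moduli_component_le(2) P lim'(4,5)[folded \<Theta>_def \<gamma>_def] mod])
           (simp add: norm_prod_def)
    qed
    then show ?thesis by (simp add: rho_def)
  qed
  then show ?thesis using that[of \<Phi> h k \<tau>] lim' unfolding \<Theta>_def by blast
qed

text \<open>\<open>U\<close> is the curve of moduli. Taking moduli is not linear, but along a
  minimizer it coincides with the linear map \<open>T\<close> that undoes the constant phases, so a
  derivative of \<open>U\<close> is obtained by applying \<open>T\<close> to
  \<open>g\<close>.\<close>

lemma minimizer_real_form:
  assumes min: "minimizer \<Psi> g"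
  shows "\<exists>U\<in>space_X a b. \<exists>\<beta>1 \<beta>2 :: real.
    (\<forall>x. fst (U x) \<ge> 0 \<and> snd (U x) \<ge> 0) \<and>
    (\<forall>x. fst (\<Psi> x) = exp (\<i> * complex_of_real \<beta>1) * complex_of_real (fst (U x)) \<and>
         snd (\<Psi> x) = exp (\<i> * complex_of_real \<beta>2) * complex_of_real (snd (U x)))"
proof -
  obtain \<beta>1 \<beta>2 where \<beta>: "\<And>x. fst (\<Psi> x) = exp (\<i> * of_real \<beta>1) * of_real (cmod (fst (\<Psi> x)))"
    "\<And>x. snd (\<Psi> x) = exp (\<i> * of_real \<beta>2) * of_real (cmod (snd (\<Psi> x)))"
    using minimizer_phases[OF min] by metis
  have c: "primitive_of g \<Psi>" "square_integrable g" "((\<lambda>x. dist (moduli (\<Psi> x)) (a, 0)) \<longlongrightarrow> 0) at_top"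
    "((\<lambda>x. dist (moduli (\<Psi> x)) (0, b)) \<longlongrightarrow> 0) at_bot"
    using min by (auto simp: minimizer_def competitor_def)
  define T :: "complex \<times> complex \<Rightarrow> real \<times> real"
    where "T z = (Re (exp (- (\<i> * of_real \<beta>1)) * fst z), Re (exp (- (\<i> * of_real \<beta>2)) * snd z))" for z
  have T: "bounded_linear T" unfolding T_def[abs_def]
    by (intro bounded_linear_Pair bounded_linear_compose[OF bounded_linear_Re]
        bounded_linear_compose[OF bounded_linear_mult_right] bounded_linear_fst bounded_linear_snd)
  have "\<bar>Re (exp (- (\<i> * of_real \<beta>)) * z)\<bar>\<^sup>2 \<le> (cmod z)\<^sup>2" for \<beta> z
    using abs_Re_le_cmod[of "exp (- (\<i> * of_real \<beta>)) * z"] by (intro power_mono) (simp_all add: norm_mult)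
  then have nT: "norm (T z) \<le> norm z" for z
    by (simp add: T_def norm_prod_def add_mono)
  have TU: "T (\<Psi> x) = moduli (\<Psi> x)" for x
  proof -
    have *: "exp (- (\<i> * of_real \<beta>)) * (exp (\<i> * of_real \<beta>) * of_real r) = (of_real r :: complex)" for \<beta> r
      by (simp add: exp_minus field_simps)
    have "exp (- (\<i> * of_real \<beta>1)) * fst (\<Psi> x) = of_real (cmod (fst (\<Psi> x)))"
      using *[of \<beta>1] \<beta>(1)[of x] by metis
    moreover have "exp (- (\<i> * of_real \<beta>2)) * snd (\<Psi> x) = of_real (cmod (snd (\<Psi> x)))"
      using *[of \<beta>2] \<beta>(2)[of x] by metis
    ultimately show ?thesis unfolding T_def moduli_def by (simp only: Re_complex_of_real)
  qed
  have "primitive_of (\<lambda>x. T (g x)) (\<lambda>x. T (\<Psi> x))"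
    by (rule primitive_of_bounded_linear[OF c(1) T])
  moreover have "(\<lambda>x. T (g x)) \<in> L2_loc"
    by (rule square_integrable_L2_loc[OF square_integrable_linear[OF c(2) T nT]])
  ultimately have "(\<lambda>x. moduli (\<Psi> x)) \<in> H1_loc" unfolding H1_loc_iff TU by blast
  moreover define U where "U x = moduli (\<Psi> x)" for x
  ultimately have "U \<in> space_X a b"
    using c by (simp add: U_def[abs_def] space_X_def tendsto_dist_iff[where l = "(_, _)"])
  moreover have "(\<forall>x. fst (U x) \<ge> 0 \<and> snd (U x) \<ge> 0) \<and>
    (\<forall>x. fst (\<Psi> x) = exp (\<i> * complex_of_real \<beta>1) * complex_of_real (fst (U x)) \<and>
         snd (\<Psi> x) = exp (\<i> * complex_of_real \<beta>2) * complex_of_real (snd (U x)))"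
    unfolding U_def moduli_def fst_conv snd_conv by (intro conjI allI norm_ge_zero \<beta>)
  ultimately show ?thesis by blast
qed

end

theorem theorem1p1:
  fixes W :: "complex \<times> complex \<Rightarrow> real" and a b :: real and m :: ennreal
  assumes W: "admissible_potential W a b"
    and m: "m = (INF \<Psi>\<in>space_Y a b. energy W \<Psi>)"
  shows "(\<exists>\<Psi>\<in>space_Y a b. energy W \<Psi> = m) \<and>
    (\<forall>\<Psi>\<in>space_Y a b. energy W \<Psi> = m \<longrightarrow>
      (\<exists>U\<in>space_X a b. \<exists>\<beta>1 \<beta>2 :: real.
        (\<forall>x. fst (U x) \<ge> 0 \<and> snd (U x) \<ge> 0) \<and>
        (\<forall>x. fst (\<Psi> x) = exp (\<i> * complex_of_real \<beta>1) * complex_of_real (fst (U x)) \<and>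
             snd (\<Psi> x) = exp (\<i> * complex_of_real \<beta>2) * complex_of_real (snd (U x))))) \<and>
    (\<forall>\<Psi>s :: nat \<Rightarrow> real \<Rightarrow> complex \<times> complex.
      (\<forall>n. \<Psi>s n \<in> space_Y a b) \<and> (\<lambda>n. energy W (\<Psi>s n)) \<longlonglongrightarrow> m \<longrightarrow>
      (\<exists>\<Psi>\<in>space_Y a b. energy W \<Psi> = m \<and>
        (\<exists>(\<tau> :: nat \<Rightarrow> real) (r :: nat \<Rightarrow> nat). strict_mono r \<and>
          (\<forall>A>0. (\<lambda>k. rho A (\<lambda>x. \<Psi>s (r k) (x + \<tau> (r k))) \<Psi>) \<longlonglongrightarrow> 0))))"
proof -
  obtain F1 F2 where "smooth_double_well W a b F1 F2"
    using admissible_smooth_double_well[OF W] by blast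
  then interpret smooth_double_well W a b F1 F2 .
  have m_le: "m \<le> energy W \<Psi>" if "\<Psi> \<in> space_Y a b" for \<Psi>
    unfolding m using that by (rule INF_lower)
  have m_fin: "m < \<infinity>"
  proof -
    obtain \<Psi> g where "competitor \<Psi> g" using competitor_exists by blast
    from competitor_space_Y[OF this] m_le[of \<Psi>] show ?thesis
      by (auto intro: le_less_trans)
  qed
  \<comment> \<open>The factor \<open>2\<close> reflects that \<open>total\<close> is twice the
    energy.\<close>
  define M where "M = 2 * enn2real m"
  have mM: "m = ennreal (M / 2)" and M0: "M \<ge> 0" using m_fin by (auto simp: M_def)
  have tot0: "total \<Psi> g \<ge> 0" for \<Psi> g
    using sq_norm_nonneg[of g] by (simp add: total_def nonneg)
  have lower: "M \<le> total \<Phi> h" if "competitor \<Phi> h" for \<Phi> h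
    using m_le[OF competitor_space_Y(1)[OF that]] competitor_space_Y(2)[OF that] M0 tot0[of \<Phi> h]
    by (simp add: mM ennreal_le_iff)
  have part3: "\<exists>\<Psi>\<in>space_Y a b. energy W \<Psi> = m \<and>
        (\<exists>(\<tau> :: nat \<Rightarrow> real) (r :: nat \<Rightarrow> nat). strict_mono r \<and>
          (\<forall>A>0. (\<lambda>k. rho A (\<lambda>x. \<Psi>s (r k) (x + \<tau> (r k))) \<Psi>) \<longlonglongrightarrow> 0))"
    if Y: "\<And>n. \<Psi>s n \<in> space_Y a b" and lim: "(\<lambda>n. energy W (\<Psi>s n)) \<longlonglongrightarrow> m"
    for \<Psi>s :: "nat \<Rightarrow> real \<Rightarrow> complex \<times> complex"
  proof -
    \<comment> \<open>Finitely many members may have infinite energy and then are not competitors;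
      the shift by \<open>N\<close> skips them.\<close>
    have "\<forall>\<^sub>F n in sequentially. energy W (\<Psi>s n) < \<infinity>" using lim m_fin by (rule order_tendstoD(2))
    then obtain N where N: "\<And>n. n \<ge> N \<Longrightarrow> energy W (\<Psi>s n) < \<infinity>" by (auto simp: eventually_sequentially)
    have "\<exists>g. competitor (\<Psi>s (n + N)) g" for n
      using space_Y_competitor[OF Y N[of "n + N"]] by (metis le_add2)
    then obtain g where g: "\<And>n. competitor (\<Psi>s (n + N)) (g n)" by metis
    have "(\<lambda>n. enn2real (energy W (\<Psi>s (n + N)))) \<longlonglongrightarrow> M / 2"
      using LIMSEQ_ignore_initial_segment[OF lim, of N] M0 unfolding mM by (intro tendsto_enn2real) auto
    then have "(\<lambda>n. 2 * enn2real (energy W (\<Psi>s (n + N)))) \<longlonglongrightarrow> 2 * (M / 2)"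
      by (rule tendsto_mult_left)
    then have tl: "(\<lambda>n. total (\<Psi>s (n + N)) (g n)) \<longlonglongrightarrow> M"
      using tot0 by (simp add: competitor_space_Y(2)[OF g])
    obtain \<Phi> h \<tau> k
      where \<Phi>: "competitor \<Phi> h" "total \<Phi> h = M" "strict_mono (k :: nat \<Rightarrow> nat)"
        "\<And>A. (\<lambda>n. rho A (\<lambda>x. \<Psi>s (k n + N) (x + \<tau> (k n))) \<Phi>) \<longlonglongrightarrow> 0"
    proof (rule minimizing_sequence_rho[OF g _ tl])
      show "M \<le> total \<Phi> h" if "competitor \<Phi> h" for \<Phi> h using that by (rule lower)
    qed (rule that)
    have "strict_mono (\<lambda>n. k n + N)" using \<Phi>(3) by (simp add: strict_mono_def)
    moreover have "\<forall>A>0. (\<lambda>n. rho A (\<lambda>x. \<Psi>s (k n + N) (x + \<tau> (k n + N - N))) \<Phi>) \<longlonglongrightarrow> 0"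
      using \<Phi>(4) by simp
    moreover have "\<Phi> \<in> space_Y a b" "energy W \<Phi> = m"
      using competitor_space_Y[OF \<Phi>(1)] \<Phi>(2) mM by simp_all
    \<comment> \<open>The translations found are indexed by the shifted sequence, those of the claim
      by the original one; \<open>j - N\<close> undoes the shift, as
      \<open>k n + N - N = k n\<close>.\<close>
    ultimately show ?thesis
      by (intro bexI[of _ \<Phi>] conjI exI[of _ "\<lambda>j. \<tau> (j - N)"] exI[of _ "\<lambda>n. k n + N"]) auto
  qed
  \<comment> \<open>Existence is the compactness statement applied to a sequence with energies below
    \<open>m + 1 / (n + 1)\<close>. Such a sequence exists because \<open>m\<close> is finite, which
    makes these bounds strictly larger than \<open>m\<close>.\<close>
  have part1: "\<exists>\<Psi>\<in>space_Y a b. energy W \<Psi> = m"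
  proof -
    have "\<exists>\<Psi>\<in>space_Y a b. energy W \<Psi> < m + ennreal (inverse (real (Suc n)))" for n
    proof -
      have "m < m + ennreal (inverse (real (Suc n)))"
        using m_fin by (cases m) (auto simp: ennreal_plus[symmetric] ennreal_less_iff simp del: ennreal_plus)
      then show ?thesis unfolding m INF_less_iff .
    qed
    then obtain \<Psi>s where \<Psi>s: "\<And>n. \<Psi>s n \<in> space_Y a b"
      "\<And>n. energy W (\<Psi>s n) < m + ennreal (inverse (real (Suc n)))" by metis
    have "(\<lambda>n. m + ennreal (inverse (real (Suc n)))) \<longlonglongrightarrow> m + ennreal 0"
      by (intro tendsto_add tendsto_const tendsto_ennrealI LIMSEQ_inverse_real_of_nat)
    then have up: "(\<lambda>n. m + ennreal (inverse (real (Suc n)))) \<longlonglongrightarrow> m" by simp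
    have "(\<lambda>n. energy W (\<Psi>s n)) \<longlonglongrightarrow> m"
      by (rule tendsto_sandwich[OF _ _ tendsto_const up])
         (intro always_eventually allI m_le \<Psi>s less_imp_le)+
    from part3[of \<Psi>s, OF \<Psi>s(1) this] show ?thesis by blast
  qed
  have part2: "\<exists>U\<in>space_X a b. \<exists>\<beta>1 \<beta>2 :: real.
        (\<forall>x. fst (U x) \<ge> 0 \<and> snd (U x) \<ge> 0) \<and>
        (\<forall>x. fst (\<Psi> x) = exp (\<i> * complex_of_real \<beta>1) * complex_of_real (fst (U x)) \<and>
             snd (\<Psi> x) = exp (\<i> * complex_of_real \<beta>2) * complex_of_real (snd (U x)))"
    if Y: "\<Psi> \<in> space_Y a b" and E: "energy W \<Psi> = m" for \<Psi>
  proof -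
    obtain g where g: "competitor \<Psi> g" using space_Y_competitor[OF Y] E m_fin by blast
    have "total \<Psi> g = M"
      using competitor_space_Y(2)[OF g] E mM M0 tot0[of \<Psi> g] by (simp add: ennreal_inj)
    then have "minimizer \<Psi> g" using g lower by (simp add: minimizer_def)
    then show ?thesis by (rule minimizer_real_form)
  qed
  show ?thesis using part1 part2 part3 by blast
qed

end
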